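(* Let $d\ge1$ be an integer, $\alpha>-1/2$, $\sigma>0$, $\eta>0$, and let $\zeta$ be a positive measurable function on $\mathbb{R}^{d+1}_+$ with $\zeta(\xi)\ge1$ for all $\xi\in\mathbb{R}^{d+1}_+$ and $\zeta^{-1}\in L^1_\alpha(\mathbb{R}^{d+1}_+)$. Let $m\in L^\infty_\alpha(\mathbb{R}^{d+1}_+)$ and $h\in L^2_\alpha(\mathbb{R}^{d+1}_+)$. Then the extremal function $\varphi^*_{\eta,h,\sigma}$ satisfies $$\mathcal{F}_{W,\alpha}(\varphi^*_{\eta,h,\sigma})(\xi)=\frac{\overline{m_\sigma(\xi)}}{\eta\zeta(\xi)+|m_\sigma(\xi)|^2}\,\mathcal{F}_{W,\alpha}(h)(\xi),\qquad\xi\in\mathbb{R}^{d+1}_+,$$ (as elements of $L^2_\alpha(\mathbb{R}^{d+1}_+)$) and $$\|\varphi^*_{\eta,h,\sigma}\|_\zeta^2\le\frac{1}{4\eta}\,\|h\|_{\alpha,2}^2.$$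
   Context: Notation: $\mathbb{R}^{d+1}_+=\mathbb{R}^d\times(0,\infty)$; $x=(x',x_{d+1})$; $-x$ denotes $(-x',x_{d+1})$ (only the first $d$ coordinates change sign). Functions are complex-valued. $L^p_\alpha(\mathbb{R}^{d+1}_+)$ is the $L^p$ space, with norm $\|\cdot\|_{\alpha,p}$, of the measure $$d\mu_\alpha(x)=\frac{x_{d+1}^{2\alpha+1}}{(2\pi)^{d/2}2^{\alpha}\Gamma(\alpha+1)}\,dx\quad\text{on }\mathbb{R}^{d+1}_+.$$ The Weinstein kernel is $\Lambda^d_\alpha(\lambda,x)=e^{-i\langle x',\lambda'\rangle}j_\alpha(x_{d+1}\lambda_{d+1})$, where $j_\alpha(t)=\Gamma(\alpha+1)\sum_{k\ge0}\frac{(-1)^k t^{2k}}{2^{2k}k!\,\Gamma(\alpha+k+1)}$. The Weinstein transform is $\mathcal{F}_{W,\alpha}(\varphi)(\lambda)=\int_{\mathbb{R}^{d+1}_+}\varphi(x)\Lambda^d_\alpha(\lambda,x)\,d\mu_\alpha(x)$ for $\varphi\in L^1_\alpha$; it extends uniquely from $L^1_\alpha\cap L^2_\alpha$ to an isometric isomorphism of $L^2_\alpha(\mathbb{R}^{d+1}_+)$ (Plancherel theorem), with inverse $\mathcal{F}^{-1}_{W,\alpha}g(\lambda)=\mathcal{F}_{W,\alpha}g(-\lambda)$. Multiplier operators: $m_\sigma(x)=m(\sigma x)$ and $\mathcal{T}_{w,m,\sigma}\varphi=\mathcal{F}^{-1}_{W,\alpha}\big(m_\sigma\,\mathcal{F}_{W,\alpha}(\varphi)\big)$.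 The Hilbert space $\mathcal{H}_\zeta(\mathbb{R}^{d+1}_+)=\{\varphi\in L^2_\alpha(\mathbb{R}^{d+1}_+):\sqrt\zeta\,\mathcal{F}_{W,\alpha}(\varphi)\in L^2_\alpha(\mathbb{R}^{d+1}_+)\}$ has norm $\|\varphi\|_\zeta^2=\int_{\mathbb{R}^{d+1}_+}\zeta(\xi)|\mathcal{F}_{W,\alpha}(\varphi)(\xi)|^2\,d\mu_\alpha(\xi)$. Extremal function: $\varphi^*_{\eta,h,\sigma}$ is the unique element of $\mathcal{H}_\zeta(\mathbb{R}^{d+1}_+)$ attaining $\inf_{\varphi\in\mathcal{H}_\zeta}\{\eta\|\varphi\|_\zeta^2+\|h-\mathcal{T}_{w,m,\sigma}\varphi\|_{\alpha,2}^2\}$; it is given by $\varphi^*_{\eta,h,\sigma}(y)=\int_{\mathbb{R}^{d+1}_+}h(x)\overline{\Theta_{\zeta,\eta}(x,y)}\,d\mu_\alpha(x)$ with $$\Theta_{\zeta,\eta}(x,y)=\int_{\mathbb{R}^{d+1}_+}\frac{m_\sigma(\xi)\Lambda^d_\alpha(-x,\xi)\Lambda^d_\alpha(y,\xi)}{\eta\zeta(\xi)+|m_\sigma(\xi)|^2}\,d\mu_\alpha(\xi).$$ *)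

theory Defs
  imports "HOL-Analysis.Analysis"
begin

text \<open>
  Points of \<open>\<real>\<^sup>d \<times> \<real>\<close> are pairs \<open>(x', x\<^bsub>d+1\<^esub>)\<close> with \<open>d = CARD('d)\<close>. A function on the half-space
  is a total function whose values off the half-space are irrelevant: the measure below lives on
  the half-space only. Elements of \<open>L\<^sup>p\<close> are represented by functions, and equality in \<open>L\<^sup>p\<close> is
  equality almost everywhere.
\<close>

type_synonym 'd pt = "(real ^ 'd) \<times> real"

definition half_space :: "('d::finite) pt set" where
  "half_space = {x. 0 < snd x}"

definition flip :: "('d::finite) pt \<Rightarrow> 'd pt" where
  "flip x = (- fst x, snd x)"

definition weinstein_measure :: "real \<Rightarrow> ('d::finite) pt measure" where
  "weinstein_measure \<alpha> =
     density (restrict_space lborel half_space)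
       (\<lambda>x. ennreal (snd x powr (2 * \<alpha> + 1) /
          ((2 * pi) powr (real CARD('d) / 2) * 2 powr \<alpha> * Gamma (\<alpha> + 1))))"

definition Lp_space :: "real \<Rightarrow> real \<Rightarrow> (('d::finite) pt \<Rightarrow> 'b::real_normed_vector) set" where
  "Lp_space \<alpha> p = {f. f \<in> borel_measurable (weinstein_measure \<alpha>) \<and>
     integrable (weinstein_measure \<alpha>) (\<lambda>x. norm (f x) powr p)}"

definition Lp_norm :: "real \<Rightarrow> real \<Rightarrow> (('d::finite) pt \<Rightarrow> 'b::real_normed_vector) \<Rightarrow> real" where
  "Lp_norm \<alpha> p f = (\<integral>x. norm (f x) powr p \<partial>weinstein_measure \<alpha>) powr (1 / p)"

definition Linf_space :: "real \<Rightarrow> (('d::finite) pt \<Rightarrow> 'b::real_normed_vector) set" where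
  "Linf_space \<alpha> = {f. f \<in> borel_measurable (weinstein_measure \<alpha>) \<and>
     (\<exists>C. AE x in weinstein_measure \<alpha>. norm (f x) \<le> C)}"

definition bessel_j :: "real \<Rightarrow> real \<Rightarrow> real" where
  "bessel_j \<alpha> t = Gamma (\<alpha> + 1) *
     (\<Sum>k. (-1) ^ k * t ^ (2 * k) / (2 ^ (2 * k) * fact k * Gamma (\<alpha> + real k + 1)))"

definition weinstein_kernel :: "real \<Rightarrow> ('d::finite) pt \<Rightarrow> 'd pt \<Rightarrow> complex" where
  "weinstein_kernel \<alpha> \<xi> x =
     exp (- \<i> * complex_of_real (fst x \<bullet> fst \<xi>)) * complex_of_real (bessel_j \<alpha> (snd x * snd \<xi>))"

definition weinstein_L1 :: "real \<Rightarrow> (('d::finite) pt \<Rightarrow> complex) \<Rightarrow> 'd pt \<Rightarrow> complex" where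
  "weinstein_L1 \<alpha> \<phi> \<xi> = (\<integral>x. \<phi> x * weinstein_kernel \<alpha> \<xi> x \<partial>weinstein_measure \<alpha>)"

text \<open>
  Well-definedness on almost-everywhere classes and injectivity are not listed separately, as they
  follow from linearity and preservation of the norm.
\<close>

definition plancherel_extension ::
  "real \<Rightarrow> ((('d::finite) pt \<Rightarrow> complex) \<Rightarrow> 'd pt \<Rightarrow> complex) \<Rightarrow> bool" where
  "plancherel_extension \<alpha> U \<longleftrightarrow>
     (\<forall>f\<in>Lp_space \<alpha> 2. U f \<in> Lp_space \<alpha> 2) \<and>
     (\<forall>f\<in>Lp_space \<alpha> 2. \<forall>g\<in>Lp_space \<alpha> 2.
        AE \<xi> in weinstein_measure \<alpha>. U (\<lambda>x. f x + g x) \<xi> = U f \<xi> + U g \<xi>) \<and>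
     (\<forall>c. \<forall>f\<in>Lp_space \<alpha> 2. AE \<xi> in weinstein_measure \<alpha>. U (\<lambda>x. c * f x) \<xi> = c * U f \<xi>) \<and>
     (\<forall>f\<in>Lp_space \<alpha> 2. Lp_norm \<alpha> 2 (U f) = Lp_norm \<alpha> 2 f) \<and>
     (\<forall>g\<in>Lp_space \<alpha> 2. \<exists>f\<in>Lp_space \<alpha> 2. AE \<xi> in weinstein_measure \<alpha>. U f \<xi> = g \<xi>) \<and>
     (\<forall>f\<in>Lp_space \<alpha> 1 \<inter> Lp_space \<alpha> 2.
        AE \<xi> in weinstein_measure \<alpha>. U f \<xi> = weinstein_L1 \<alpha> f \<xi>)"

text \<open>
  By the Plancherel theorem such an extension exists, and it is unique up to almost-everywhere
  equality of the values; the choice operator only selects representatives.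
\<close>

definition weinstein_L2 :: "real \<Rightarrow> (('d::finite) pt \<Rightarrow> complex) \<Rightarrow> 'd pt \<Rightarrow> complex" where
  "weinstein_L2 \<alpha> = (SOME U. plancherel_extension \<alpha> U)"

definition weinstein_inv_L2 :: "real \<Rightarrow> (('d::finite) pt \<Rightarrow> complex) \<Rightarrow> 'd pt \<Rightarrow> complex" where
  "weinstein_inv_L2 \<alpha> g \<xi> = weinstein_L2 \<alpha> g (flip \<xi>)"

definition dilate :: "real \<Rightarrow> (('d::finite) pt \<Rightarrow> complex) \<Rightarrow> 'd pt \<Rightarrow> complex" where
  "dilate \<sigma> m x = m (\<sigma> *\<^sub>R x)"

definition multiplier_op ::
  "real \<Rightarrow> (('d::finite) pt \<Rightarrow> complex) \<Rightarrow> real \<Rightarrow> ('d pt \<Rightarrow> complex) \<Rightarrow> 'd pt \<Rightarrow> complex" where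
  "multiplier_op \<alpha> m \<sigma> \<phi> = weinstein_inv_L2 \<alpha> (\<lambda>\<xi>. dilate \<sigma> m \<xi> * weinstein_L2 \<alpha> \<phi> \<xi>)"

definition H_space :: "real \<Rightarrow> (('d::finite) pt \<Rightarrow> real) \<Rightarrow> ('d pt \<Rightarrow> complex) set" where
  "H_space \<alpha> \<zeta> = {\<phi> \<in> Lp_space \<alpha> 2.
     (\<lambda>\<xi>. complex_of_real (sqrt (\<zeta> \<xi>)) * weinstein_L2 \<alpha> \<phi> \<xi>) \<in> Lp_space \<alpha> 2}"

definition H_norm :: "real \<Rightarrow> (('d::finite) pt \<Rightarrow> real) \<Rightarrow> ('d pt \<Rightarrow> complex) \<Rightarrow> real" where
  "H_norm \<alpha> \<zeta> \<phi> = sqrt (\<integral>\<xi>. \<zeta> \<xi> * (norm (weinstein_L2 \<alpha> \<phi> \<xi>))\<^sup>2 \<partial>weinstein_measure \<alpha>)"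

definition tikhonov ::
  "real \<Rightarrow> (('d::finite) pt \<Rightarrow> real) \<Rightarrow> ('d pt \<Rightarrow> complex) \<Rightarrow> real \<Rightarrow> real \<Rightarrow>
    ('d pt \<Rightarrow> complex) \<Rightarrow> ('d pt \<Rightarrow> complex) \<Rightarrow> real" where
  "tikhonov \<alpha> \<zeta> m \<eta> \<sigma> h \<phi> =
     \<eta> * (H_norm \<alpha> \<zeta> \<phi>)\<^sup>2 + (Lp_norm \<alpha> 2 (\<lambda>x. h x - multiplier_op \<alpha> m \<sigma> \<phi> x))\<^sup>2"

text \<open>
  The minimiser is unique as an element of \<open>L\<^sup>2\<close>; the choice operator selects a representative.
\<close>

definition extremal_fun ::
  "real \<Rightarrow> (('d::finite) pt \<Rightarrow> real) \<Rightarrow> ('d pt \<Rightarrow> complex) \<Rightarrow> real \<Rightarrow> real \<Rightarrow>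
    ('d pt \<Rightarrow> complex) \<Rightarrow> 'd pt \<Rightarrow> complex" where
  "extremal_fun \<alpha> \<zeta> m \<eta> \<sigma> h =
     (SOME \<phi>. \<phi> \<in> H_space \<alpha> \<zeta> \<and>
        tikhonov \<alpha> \<zeta> m \<eta> \<sigma> h \<phi> = (INF \<psi>\<in>H_space \<alpha> \<zeta>. tikhonov \<alpha> \<zeta> m \<eta> \<sigma> h \<psi>))"

end

theory Submission imports Defs "HOL-Probability.Characteristic_Functions" begin

text \<open>
  By Plancherel, the functional equals \<open>\<eta> \<integral> \<zeta> |p|\<^sup>2 + \<integral> |a - m\<^bsub>\<sigma>\<^esub> p|\<^sup>2\<close> with \<open>p\<close> and \<open>a\<close> the
  transforms of \<open>\<phi>\<close> and \<open>h\<close>. Completing the square pointwise shows that it is minimal exactly for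
  \<open>p = cnj m\<^bsub>\<sigma>\<^esub> a / (\<eta> \<zeta> + |m\<^bsub>\<sigma>\<^esub>|\<^sup>2)\<close>, and the norm bound is AM-GM in the denominator.

  The Plancherel theorem rests on the fact that Gaussians \<open>exp (- |x'|\<^sup>2 / 2 + i b \<bullet> x' - r x\<^bsub>d+1\<^esub>\<^sup>2)\<close>
  have explicit transforms and satisfy the inversion formula. With the multiplication formula
  \<open>\<integral> F f g = \<integral> f F g\<close> this gives isometry on their span, which is dense in \<open>L\<^sup>2\<close> by
  Stone--Weierstrass.
\<close>

section \<open>Square-integrable functions\<close>

text \<open>The transform on L^2 enters through a choice operator, so nothing is known about it
  until some operator with the defining properties exists and every such operator is identified;
  this is why the Plancherel theorem takes most of the space. The kernel is not multiplicative in
  the last variable, so ordinary translation is of no use there. The Gaussian family is therefore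
  asymmetric: in x' the width is fixed and the phase b varies, in the last variable the width r
  varies. Products add the parameters b and r, so up to one common Gaussian factor the span is an
  algebra, and phases and widths together separate the points of the half-space. Stone-Weierstrass
  wants a compact set; this is obtained by feeding polynomials with bounded coordinates taken from
  the algebra, and the common factor becomes the weight that turns uniform approximation into
  approximation in L^2. Testing against the resulting dense class then pins down the transform of an
  L^2 function up to null sets.\<close>

definition l2 :: "'a measure \<Rightarrow> ('a \<Rightarrow> complex) set" where
  "l2 M = {f \<in> borel_measurable M. integrable M (\<lambda>x. (cmod (f x))\<^sup>2)}"

definition l2norm :: "'a measure \<Rightarrow> ('a \<Rightarrow> complex) \<Rightarrow> real" where
  "l2norm M f = sqrt (\<integral>x. (cmod (f x))\<^sup>2 \<partial>M)"

lemma l2_measurable: "f \<in> l2 M \<Longrightarrow> f \<in> borel_measurable M"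
  by (simp add: l2_def)

lemma l2_integrable: "f \<in> l2 M \<Longrightarrow> integrable M (\<lambda>x. (cmod (f x))\<^sup>2)"
  by (simp add: l2_def)

lemma l2norm_nonneg [simp]: "0 \<le> l2norm M f"
  by (simp add: l2norm_def)

lemma l2norm_square: "(l2norm M f)\<^sup>2 = (\<integral>x. (cmod (f x))\<^sup>2 \<partial>M)"
  by (simp add: l2norm_def)

lemma l2_dominated:
  assumes "g \<in> borel_measurable M" "integrable M w" "AE x in M. (cmod (g x))\<^sup>2 \<le> w x"
  shows "g \<in> l2 M"
  unfolding l2_def
proof (intro CollectI conjI)
  show "integrable M (\<lambda>x. (cmod (g x))\<^sup>2)"
    by (rule Bochner_Integration.integrable_bound[OF assms(2)]) (use assms in auto)
qed (use assms in auto)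

lemma l2_mono:
  assumes "g \<in> borel_measurable M" "f \<in> l2 M" "AE x in M. cmod (g x) \<le> C * cmod (f x)"
  shows "g \<in> l2 M"
proof (rule l2_dominated[OF assms(1)])
  show "integrable M (\<lambda>x. C\<^sup>2 * (cmod (f x))\<^sup>2)"
    using l2_integrable[OF assms(2)] by simp
  show "AE x in M. (cmod (g x))\<^sup>2 \<le> C\<^sup>2 * (cmod (f x))\<^sup>2"
    using assms(3) by eventually_elim (metis norm_ge_zero power_mono power_mult_distrib)
qed

lemma l2_cong_AE:
  assumes "f \<in> l2 M" "g \<in> borel_measurable M" "AE x in M. f x = g x"
  shows "g \<in> l2 M"
  by (rule l2_mono[OF assms(2,1), of 1]) (use assms(3) in auto)

lemma l2norm_cong_AE:
  assumes "f \<in> borel_measurable M" "g \<in> borel_measurable M" "AE x in M. f x = g x"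
  shows "l2norm M f = l2norm M g"
  unfolding l2norm_def
  by (intro arg_cong[where f=sqrt] integral_cong_AE) (use assms in auto)

lemma l2_add:
  assumes "f \<in> l2 M" "g \<in> l2 M"
  shows "(\<lambda>x. f x + g x) \<in> l2 M"
proof (rule l2_dominated)
  show "(\<lambda>x. f x + g x) \<in> borel_measurable M"
    using assms by (auto simp: l2_def)
  show "integrable M (\<lambda>x. 2 * (cmod (f x))\<^sup>2 + 2 * (cmod (g x))\<^sup>2)"
    using assms by (auto simp: l2_def)
  have "(cmod (f x + g x))\<^sup>2 \<le> 2 * (cmod (f x))\<^sup>2 + 2 * (cmod (g x))\<^sup>2" for x
  proof -
    have "(cmod (f x + g x))\<^sup>2 \<le> (cmod (f x) + cmod (g x))\<^sup>2"
      by (intro power_mono norm_triangle_ineq) auto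
    also have "\<dots> \<le> 2 * (cmod (f x))\<^sup>2 + 2 * (cmod (g x))\<^sup>2"
      using sum_squares_bound[of "cmod (f x)" "cmod (g x)"] by (simp add: power2_sum)
    finally show ?thesis .
  qed
  then show "AE x in M. (cmod (f x + g x))\<^sup>2 \<le> 2 * (cmod (f x))\<^sup>2 + 2 * (cmod (g x))\<^sup>2"
    by simp
qed

lemma l2_cmult: "f \<in> l2 M \<Longrightarrow> (\<lambda>x. c * f x) \<in> l2 M"
  by (auto simp: l2_def norm_mult power_mult_distrib)

lemma l2_diff: "f \<in> l2 M \<Longrightarrow> g \<in> l2 M \<Longrightarrow> (\<lambda>x. f x - g x) \<in> l2 M"
  using l2_add[of f M "\<lambda>x. (-1) * g x"] l2_cmult[of g M "-1"] by simp

lemma l2_cnj: "f \<in> l2 M \<Longrightarrow> (\<lambda>x. cnj (f x)) \<in> l2 M"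
  unfolding l2_def by (auto intro: borel_measurable_continuous_on[of cnj] continuous_intros)

lemma l2_zero [simp]: "(\<lambda>x. 0) \<in> l2 M"
  by (auto simp: l2_def)

lemma l2norm_cmult: "l2norm M (\<lambda>x. c * f x) = cmod c * l2norm M f"
  by (simp add: l2norm_def norm_mult power_mult_distrib real_sqrt_mult)

lemma l2norm_minus_commute: "l2norm M (\<lambda>x. f x - g x) = l2norm M (\<lambda>x. g x - f x)"
  by (simp add: l2norm_def norm_minus_commute)

lemma l2_integrable_norm_mult:
  assumes "f \<in> l2 M" "g \<in> l2 M"
  shows "integrable M (\<lambda>x. cmod (f x) * cmod (g x))"
proof (rule Bochner_Integration.integrable_bound)
  show "integrable M (\<lambda>x. (cmod (f x))\<^sup>2 + (cmod (g x))\<^sup>2)"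
    using assms by (auto simp: l2_def)
  have "cmod (f x) * cmod (g x) \<le> (cmod (f x))\<^sup>2 + (cmod (g x))\<^sup>2" for x
    using sum_squares_bound[of "cmod (f x)" "cmod (g x)"]
      mult_nonneg_nonneg[OF norm_ge_zero[of "f x"] norm_ge_zero[of "g x"]] by linarith
  then show "AE x in M. norm (cmod (f x) * cmod (g x)) \<le> norm ((cmod (f x))\<^sup>2 + (cmod (g x))\<^sup>2)"
    by simp
  show "(\<lambda>x. cmod (f x) * cmod (g x)) \<in> borel_measurable M"
    using assms by (auto simp: l2_def)
qed

lemma l2_integrable_mult:
  assumes "f \<in> l2 M" "g \<in> l2 M"
  shows "integrable M (\<lambda>x. f x * g x)"
  by (rule Bochner_Integration.integrable_bound[OF l2_integrable_norm_mult[OF assms]])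
     (use assms in \<open>auto simp: l2_def norm_mult\<close>)

text \<open>The integral of (|f| - t |g|)^2 is a quadratic in t that is never negative.\<close>

lemma l2_Cauchy_Schwarz:
  assumes f: "f \<in> l2 M" and g: "g \<in> l2 M"
  shows "(\<integral>x. cmod (f x) * cmod (g x) \<partial>M) \<le> l2norm M f * l2norm M g"
proof -
  define a where "a = (\<integral>x. (cmod (f x))\<^sup>2 \<partial>M)"
  define b where "b = (\<integral>x. (cmod (g x))\<^sup>2 \<partial>M)"
  define c where "c = (\<integral>x. cmod (f x) * cmod (g x) \<partial>M)"
  note int = l2_integrable[OF f] l2_integrable[OF g] l2_integrable_norm_mult[OF f g]
  have quad: "0 \<le> a - 2 * t * c + t\<^sup>2 * b" for t
  proof -
    have "0 \<le> (\<integral>x. (cmod (f x) - t * cmod (g x))\<^sup>2 \<partial>M)"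
      by simp
    also have "(\<lambda>x. (cmod (f x) - t * cmod (g x))\<^sup>2) =
        (\<lambda>x. ((cmod (f x))\<^sup>2 - (2 * t) * (cmod (f x) * cmod (g x))) + t\<^sup>2 * (cmod (g x))\<^sup>2)"
      by (auto simp: power2_eq_square algebra_simps)
    also have "(\<integral>x. ((cmod (f x))\<^sup>2 - (2 * t) * (cmod (f x) * cmod (g x))) + t\<^sup>2 * (cmod (g x))\<^sup>2 \<partial>M)
       = a - 2 * t * c + t\<^sup>2 * b"
      using int by (simp add: a_def b_def c_def)
    finally show ?thesis .
  qed
  have nn: "0 \<le> a" "0 \<le> b" "0 \<le> c"
    by (auto simp: a_def b_def c_def)
  have "c\<^sup>2 \<le> a * b"
  proof (cases "b = 0")
    case True
    have "c = 0"
    proof (rule ccontr)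
      assume "c \<noteq> 0"
      \<comment> \<open>With b = 0 the quadratic is affine in t, and this t gives it the value
        -1.\<close>
      then show False
        using quad[of "(a + 1) / (2 * c)"] True by (simp add: field_simps)
    qed
    then show ?thesis using nn by simp
  next
    case False
    \<comment> \<open>t = c / b minimises the quadratic.\<close>
    then show ?thesis
      using quad[of "c / b"] nn by (simp add: field_simps power2_eq_square split: if_splits)
  qed
  then have "c \<le> sqrt (a * b)"
    by (simp add: real_le_rsqrt)
  then show ?thesis
    by (simp add: a_def b_def c_def l2norm_def real_sqrt_mult)
qed

lemma l2_norm_integral_mult_le:
  assumes "f \<in> l2 M" "g \<in> l2 M"
  shows "cmod (\<integral>x. f x * g x \<partial>M) \<le> l2norm M f * l2norm M g"
proof -
  have "cmod (\<integral>x. f x * g x \<partial>M) \<le> (\<integral>x. cmod (f x) * cmod (g x) \<partial>M)"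
    using integral_norm_bound[of M "\<lambda>x. f x * g x"] by (simp add: norm_mult)
  with l2_Cauchy_Schwarz[OF assms] show ?thesis by simp
qed

lemma l2norm_triangle:
  assumes f: "f \<in> l2 M" and g: "g \<in> l2 M"
  shows "l2norm M (\<lambda>x. f x + g x) \<le> l2norm M f + l2norm M g"
proof (rule power2_le_imp_le)
  have "(l2norm M (\<lambda>x. f x + g x))\<^sup>2 \<le>
      (\<integral>x. ((cmod (f x))\<^sup>2 + 2 * (cmod (f x) * cmod (g x))) + (cmod (g x))\<^sup>2 \<partial>M)"
    unfolding l2norm_square
  proof (rule integral_mono)
    show "integrable M (\<lambda>x. (cmod (f x + g x))\<^sup>2)"
      using l2_integrable[OF l2_add[OF f g]] .
    show "integrable M (\<lambda>x. ((cmod (f x))\<^sup>2 + 2 * (cmod (f x) * cmod (g x))) + (cmod (g x))\<^sup>2)"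
      using l2_integrable[OF f] l2_integrable[OF g] l2_integrable_norm_mult[OF f g] by simp
    show "(cmod (f x + g x))\<^sup>2 \<le> ((cmod (f x))\<^sup>2 + 2 * (cmod (f x) * cmod (g x))) + (cmod (g x))\<^sup>2" for x
      using power_mono[OF norm_triangle_ineq[of "f x" "g x"], of 2]
      by (simp add: power2_sum)
  qed
  also have "\<dots> = (l2norm M f)\<^sup>2 + 2 * (\<integral>x. cmod (f x) * cmod (g x) \<partial>M) + (l2norm M g)\<^sup>2"
    using l2_integrable[OF f] l2_integrable[OF g] l2_integrable_norm_mult[OF f g]
    by (simp add: l2norm_square)
  also have "\<dots> \<le> (l2norm M f + l2norm M g)\<^sup>2"
    using l2_Cauchy_Schwarz[OF f g] by (simp add: power2_sum)
  finally show "(l2norm M (\<lambda>x. f x + g x))\<^sup>2 \<le> (l2norm M f + l2norm M g)\<^sup>2" .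
qed simp

lemma l2norm_triangle_diff:
  assumes "f \<in> l2 M" "g \<in> l2 M" "h \<in> l2 M"
  shows "l2norm M (\<lambda>x. f x - h x) \<le> l2norm M (\<lambda>x. f x - g x) + l2norm M (\<lambda>x. g x - h x)"
  using l2norm_triangle[OF l2_diff[OF assms(1,2)] l2_diff[OF assms(2,3)]] by simp

lemma l2norm_abs_diff:
  assumes "f \<in> l2 M" "g \<in> l2 M"
  shows "\<bar>l2norm M f - l2norm M g\<bar> \<le> l2norm M (\<lambda>x. f x - g x)"
  using l2norm_triangle_diff[OF assms l2_zero] l2norm_triangle_diff[OF assms(2,1) l2_zero]
    l2norm_minus_commute[of M f g] by simp

lemma l2norm_eq_0_iff_AE:
  assumes "f \<in> l2 M"
  shows "l2norm M f = 0 \<longleftrightarrow> (AE x in M. f x = 0)"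
  using integral_nonneg_eq_0_iff_AE[OF l2_integrable[OF assms]] by (simp add: l2norm_def)

text \<open>The limit inherits the bound w, hence |u n - v|^2 is at most 4 w^2, and dominated
  convergence applies to the squares.\<close>

lemma l2_dominated_convergence:
  assumes [measurable]: "\<And>n. u n \<in> borel_measurable M" "v \<in> borel_measurable M"
    and w: "integrable M (\<lambda>x. (w x)\<^sup>2)"
    and lim: "AE x in M. (\<lambda>n. u n x) \<longlonglongrightarrow> v x"
    and le: "\<And>n. AE x in M. cmod (u n x) \<le> w x"
  shows "v \<in> l2 M" "(\<lambda>n. l2norm M (\<lambda>x. u n x - v x)) \<longlonglongrightarrow> 0"
proof -
  have allle: "AE x in M. \<forall>n. cmod (u n x) \<le> w x"
    using le by (simp add: AE_all_countable)
  have vle: "AE x in M. cmod (v x) \<le> w x"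
    using allle lim
  proof eventually_elim
    case (elim x)
    show ?case
      by (rule tendsto_upperbound[OF tendsto_norm[OF elim(2)]]) (use elim(1) in auto)
  qed
  show "v \<in> l2 M"
  proof (rule l2_dominated[OF _ w])
    show "AE x in M. (cmod (v x))\<^sup>2 \<le> (w x)\<^sup>2"
      using vle by eventually_elim (simp add: power_mono)
  qed simp
  have "(\<lambda>n. \<integral>x. (cmod (u n x - v x))\<^sup>2 \<partial>M) \<longlonglongrightarrow> (\<integral>x. 0 \<partial>M)"
  proof (rule integral_dominated_convergence[where w="\<lambda>x. 4 * (w x)\<^sup>2"])
    show "AE x in M. (\<lambda>n. (cmod (u n x - v x))\<^sup>2) \<longlonglongrightarrow> 0"
      using lim by eventually_elim (auto intro!: tendsto_eq_intros)
    show "AE x in M. norm ((cmod (u n x - v x))\<^sup>2) \<le> 4 * (w x)\<^sup>2" for n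
      using allle vle
    proof eventually_elim
      case (elim x)
      have "cmod (u n x - v x) \<le> 2 * w x"
        using norm_triangle_ineq4[of "u n x" "v x"] elim(1)[rule_format, of n] elim(2) by linarith
      from power_mono[OF this, of 2] show ?case
        by (simp add: power_mult_distrib)
    qed
  qed (use w in auto)
  then show "(\<lambda>n. l2norm M (\<lambda>x. u n x - v x)) \<longlonglongrightarrow> 0"
    unfolding l2norm_def by (auto intro!: tendsto_eq_intros)
qed

text \<open>Riesz--Fischer; the geometric rate is what a suitable subsequence of any Cauchy sequence
  satisfies.\<close>

lemma l2_complete:
  assumes u: "\<And>n. u n \<in> l2 M"
    and C: "\<And>m n. n \<le> m \<Longrightarrow> l2norm M (\<lambda>x. u m x - u n x) \<le> (1 / 2) ^ n"
  obtains v where "v \<in> l2 M" "(\<lambda>n. l2norm M (\<lambda>x. u n x - v x)) \<longlonglongrightarrow> 0"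
proof -
  have [measurable]: "\<And>n. u n \<in> borel_measurable M"
    using u l2_measurable by blast
  define a where "a n x = cmod (u (Suc n) x - u n x)" for n x
  have [measurable]: "\<And>n. a n \<in> borel_measurable M"
    by (auto simp: a_def[abs_def])
  have sq: "(\<integral>\<^sup>+x. ennreal ((cmod (u m x - u n x))\<^sup>2) \<partial>M) \<le> ennreal ((1 / 4) ^ n)" if "n \<le> m" for m n
  proof -
    have "(\<integral>\<^sup>+x. ennreal ((cmod (u m x - u n x))\<^sup>2) \<partial>M) = ennreal ((l2norm M (\<lambda>x. u m x - u n x))\<^sup>2)"
      unfolding l2norm_square
      by (rule nn_integral_eq_integral) (use l2_integrable[OF l2_diff[OF u u]] in auto)
    also have "\<dots> \<le> ennreal (((1 / 2) ^ n)\<^sup>2)"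
      by (intro ennreal_leI power_mono C that) simp
    also have "((1 / 2 :: real) ^ n)\<^sup>2 = (1 / 4) ^ n"
      by (simp add: power2_eq_square flip: power_mult_distrib)
    finally show ?thesis .
  qed
  \<comment> \<open>The weight 2^n is still absorbed by the bound 4^-n, leaving a geometric series;
    it is what lets summability of the squares yield summability of the increments
    themselves.\<close>
  have "(\<integral>\<^sup>+x. (\<Sum>n. ennreal (2 ^ n * (a n x)\<^sup>2)) \<partial>M) = (\<Sum>n. \<integral>\<^sup>+x. ennreal (2 ^ n * (a n x)\<^sup>2) \<partial>M)"
    by (rule nn_integral_suminf) simp
  also have "\<dots> \<le> (\<Sum>n. ennreal ((1 / 2) ^ n))"
  proof (rule suminf_le)
    fix n
    have "(\<integral>\<^sup>+x. ennreal (2 ^ n * (a n x)\<^sup>2) \<partial>M) = ennreal (2 ^ n) * (\<integral>\<^sup>+x. ennreal ((a n x)\<^sup>2) \<partial>M)"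
      by (subst nn_integral_cmult[symmetric]) (auto simp: ennreal_mult)
    also have "\<dots> \<le> ennreal (2 ^ n) * ennreal ((1 / 4) ^ n)"
      unfolding a_def by (intro mult_left_mono sq) auto
    also have "\<dots> = ennreal ((1 / 2) ^ n)"
      by (simp flip: ennreal_mult power_mult_distrib)
    finally show "(\<integral>\<^sup>+x. ennreal (2 ^ n * (a n x)\<^sup>2) \<partial>M) \<le> ennreal ((1 / 2) ^ n)" .
  qed auto
  also have "\<dots> = ennreal (\<Sum>n. (1 / 2) ^ n)"
    by (rule suminf_ennreal2) (auto intro: summable_geometric)
  also have "\<dots> < \<infinity>" by simp
  finally have "AE x in M. (\<Sum>n. ennreal (2 ^ n * (a n x)\<^sup>2)) \<noteq> \<infinity>"
    by (intro nn_integral_PInf_AE) auto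
  then have conv: "AE x in M. convergent (\<lambda>n. u n x)"
  proof eventually_elim
    case (elim x)
    have s: "summable (\<lambda>n. 2 ^ n * (a n x)\<^sup>2)"
      using elim by (intro summable_suminf_not_top) (auto simp: a_def)
    have "summable (\<lambda>n. a n x)"
    proof (rule summable_comparison_test')
      show "summable (\<lambda>n. (1 / 2) ^ n + 2 ^ n * (a n x)\<^sup>2)"
        by (intro summable_add s summable_geometric) simp
      fix n
      \<comment> \<open>AM-GM\<close>
      have "2 * (a n x) \<le> (1 / 2) ^ n + 2 ^ n * (a n x)\<^sup>2"
      proof -
        have "0 \<le> ((1 / 2) ^ n) * (1 - 2 ^ n * a n x)\<^sup>2" by simp
        also have "\<dots> = (1 / 2) ^ n - 2 * (((1 / 2) ^ n * 2 ^ n) * a n x) + ((1 / 2) ^ n * 2 ^ n) * (2 ^ n * (a n x)\<^sup>2)"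
          by (simp add: power2_eq_square algebra_simps)
        also have "(1 / 2 :: real) ^ n * 2 ^ n = 1"
          by (simp flip: power_mult_distrib)
        finally show ?thesis by simp
      qed
      moreover have "0 \<le> a n x" by (simp add: a_def)
      ultimately show "norm (a n x) \<le> (1 / 2) ^ n + 2 ^ n * (a n x)\<^sup>2" by simp
    qed
    then have "summable (\<lambda>n. u (Suc n) x - u n x)"
      unfolding a_def by (rule summable_norm_cancel)
    then have "(\<lambda>n. \<Sum>k<n. u (Suc k) x - u k x) \<longlonglongrightarrow> (\<Sum>k. u (Suc k) x - u k x)"
      by (rule summable_LIMSEQ)
    then have "(\<lambda>n. (u n x - u 0 x) + u 0 x) \<longlonglongrightarrow> (\<Sum>k. u (Suc k) x - u k x) + u 0 x"
      by (intro tendsto_intros) (simp add: sum_lessThan_telescope[of "\<lambda>n. u n x"])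
    then show ?case by (auto simp: convergent_def)
  qed
  define v where "v x = lim (\<lambda>n. u n x)" for x
  have [measurable]: "v \<in> borel_measurable M"
    unfolding v_def[abs_def] by (rule borel_measurable_lim_metric) simp
  have lim: "AE x in M. (\<lambda>n. u n x) \<longlonglongrightarrow> v x"
    using conv by eventually_elim (simp add: v_def convergent_LIMSEQ_iff)
  \<comment> \<open>Fatou's lemma carries the Cauchy estimate for u m - u n to the limit in
    m.\<close>
  have bd: "(\<integral>\<^sup>+x. ennreal ((cmod (v x - u n x))\<^sup>2) \<partial>M) \<le> ennreal ((1 / 4) ^ n)" for n
  proof -
    have "(\<integral>\<^sup>+x. ennreal ((cmod (v x - u n x))\<^sup>2) \<partial>M) =
        (\<integral>\<^sup>+x. liminf (\<lambda>m. ennreal ((cmod (u m x - u n x))\<^sup>2)) \<partial>M)"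
    proof (rule nn_integral_cong_AE)
      show "AE x in M. ennreal ((cmod (v x - u n x))\<^sup>2) = liminf (\<lambda>m. ennreal ((cmod (u m x - u n x))\<^sup>2))"
        using lim
      proof eventually_elim
        case (elim x)
        have "(\<lambda>m. ennreal ((cmod (u m x - u n x))\<^sup>2)) \<longlonglongrightarrow> ennreal ((cmod (v x - u n x))\<^sup>2)"
          using elim by (intro tendsto_intros)
        then show ?case
          by (intro lim_imp_Liminf[symmetric]) auto
      qed
    qed
    also have "\<dots> \<le> liminf (\<lambda>m. \<integral>\<^sup>+x. ennreal ((cmod (u m x - u n x))\<^sup>2) \<partial>M)"
      by (rule nn_integral_liminf) simp
    also have "\<dots> \<le> liminf (\<lambda>m. ennreal ((1 / 4) ^ n))"
      by (rule Liminf_mono) (auto intro!: eventually_sequentiallyI[of n] sq)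
    also have "\<dots> = ennreal ((1 / 4) ^ n)"
      by (simp add: Liminf_const)
    finally show ?thesis .
  qed
  have dl2: "(\<lambda>x. v x - u n x) \<in> l2 M" for n
    unfolding l2_def using le_less_trans[OF bd[of n] ennreal_less_top]
    by (auto simp: integrable_iff_bounded)
  have v: "v \<in> l2 M"
    using l2_add[OF dl2[of 0] u[of 0]] by simp
  have "l2norm M (\<lambda>x. u n x - v x) \<le> (1 / 2) ^ n" for n
  proof (rule power2_le_imp_le)
    have "ennreal ((l2norm M (\<lambda>x. v x - u n x))\<^sup>2) = (\<integral>\<^sup>+x. ennreal ((cmod (v x - u n x))\<^sup>2) \<partial>M)"
      unfolding l2norm_square
      by (rule nn_integral_eq_integral[symmetric]) (use l2_integrable[OF dl2] in auto)
    also have "\<dots> \<le> ennreal (((1 / 2) ^ n)\<^sup>2)"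
      using bd[of n] by (simp add: power2_eq_square flip: power_mult_distrib)
    finally show "(l2norm M (\<lambda>x. u n x - v x))\<^sup>2 \<le> ((1 / 2) ^ n)\<^sup>2"
      by (simp add: l2norm_minus_commute)
  qed simp
  then have "(\<lambda>n. l2norm M (\<lambda>x. u n x - v x)) \<longlonglongrightarrow> 0"
    by (intro tendsto_sandwich[OF _ _ tendsto_const LIMSEQ_realpow_zero[of "1/2"]]) auto
  with v that show ?thesis by blast
qed

lemma l2_tendsto_integral_mult:
  assumes u: "\<And>n. u n \<in> l2 M" "v \<in> l2 M" "(\<lambda>n. l2norm M (\<lambda>x. u n x - v x)) \<longlonglongrightarrow> 0"
    and g: "g \<in> l2 M"
  shows "(\<lambda>n. \<integral>x. u n x * g x \<partial>M) \<longlonglongrightarrow> (\<integral>x. v x * g x \<partial>M)"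
proof (rule Lim_transform2[OF tendsto_const], rule tendsto_norm_zero_cancel)
  have "(\<lambda>n. l2norm M (\<lambda>x. u n x - v x) * l2norm M g) \<longlonglongrightarrow> 0"
    using u(3) by (auto intro!: tendsto_eq_intros)
  then show "(\<lambda>n. cmod ((\<integral>x. v x * g x \<partial>M) - (\<integral>x. u n x * g x \<partial>M))) \<longlonglongrightarrow> 0"
  proof (rule tendsto_sandwich[OF _ _ tendsto_const, rotated 2])
    have "cmod ((\<integral>x. v x * g x \<partial>M) - (\<integral>x. u n x * g x \<partial>M)) \<le> l2norm M (\<lambda>x. u n x - v x) * l2norm M g" for n
    proof -
      have "(\<integral>x. v x * g x \<partial>M) - (\<integral>x. u n x * g x \<partial>M) = (\<integral>x. (v x - u n x) * g x \<partial>M)"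
        by (subst Bochner_Integration.integral_diff[symmetric])
           (auto intro: l2_integrable_mult u g simp: left_diff_distrib)
      then show ?thesis
        using l2_norm_integral_mult_le[OF l2_diff[OF u(2) u(1)[of n]] g]
        by (simp add: l2norm_minus_commute)
    qed
    then show "\<forall>\<^sub>F n in sequentially. cmod ((\<integral>x. v x * g x \<partial>M) - (\<integral>x. u n x * g x \<partial>M))
        \<le> l2norm M (\<lambda>x. u n x - v x) * l2norm M g" by simp
  qed simp
qed

lemma l2_tendsto_l2norm:
  assumes u: "\<And>n. u n \<in> l2 M" "v \<in> l2 M" "(\<lambda>n. l2norm M (\<lambda>x. u n x - v x)) \<longlonglongrightarrow> 0"
  shows "(\<lambda>n. l2norm M (u n)) \<longlonglongrightarrow> l2norm M v"
proof (rule Lim_transform2[OF tendsto_const], rule tendsto_rabs_zero_cancel)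
  show "(\<lambda>n. \<bar>l2norm M v - l2norm M (u n)\<bar>) \<longlonglongrightarrow> 0"
    by (rule tendsto_sandwich[OF _ _ tendsto_const u(3)])
       (use l2norm_abs_diff[OF u(2) u(1)] in \<open>auto simp: l2norm_minus_commute[of M v]\<close>)
qed

section \<open>Bessel functions and Gaussian integrals\<close>

definition bessel_coeff :: "real \<Rightarrow> nat \<Rightarrow> real" where
  "bessel_coeff \<alpha> k = Gamma (\<alpha> + 1) * ((-1) ^ k / (2 ^ (2 * k) * fact k * Gamma (\<alpha> + real k + 1)))"

text \<open>The argument is the square of the Bessel variable: \<open>bessel_j \<alpha> t\<close> is
  even in t, and in \<open>y = t\<^sup>2\<close> it becomes an ordinary power series that
  \<open>diffs\<close> differentiates termwise.\<close>

definition bessel_J :: "real \<Rightarrow> real \<Rightarrow> real" where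
  "bessel_J \<alpha> y = (\<Sum>k. bessel_coeff \<alpha> k * y ^ k)"

context
  fixes \<alpha> :: real
  assumes \<alpha>: "\<alpha> > - 1 / 2"
begin

lemma bessel_coeff_0: "bessel_coeff \<alpha> 0 = 1"
proof -
  have "Gamma (\<alpha> + 1) > 0" using \<alpha> by (intro Gamma_real_pos) simp
  then show ?thesis by (simp add: bessel_coeff_def)
qed

text \<open>The functional equation of Gamma turns the explicit coefficients into a two-term
  recursion; the factorial bound and the differential equation both come from it.\<close>

lemma bessel_coeff_Suc:
  "4 * (real k + 1) * (real k + \<alpha> + 1) * bessel_coeff \<alpha> (Suc k) = - bessel_coeff \<alpha> k"
proof -
  have pos: "0 < real k + \<alpha> + 1" using \<alpha> of_nat_0_le_iff[of k] by linarith
  then have G: "Gamma (\<alpha> + real (Suc k) + 1) = (real k + \<alpha> + 1) * Gamma (\<alpha> + real k + 1)"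
    using Gamma_plus1[of "\<alpha> + real k + 1"] plus_one_in_nonpos_Ints_imp nonpos_Ints_nonpos[of "\<alpha> + real k + 1"]
    by (force simp: add_ac)
  have G': "Gamma (\<alpha> + real k + 1) > 0"
    using pos by (intro Gamma_real_pos) (simp add: add_ac)
  have f: "fact (Suc k) = (real k + 1) * (fact k :: real)" by (simp add: add_ac)
  \<comment> \<open>Stated for free positive reals, so that factorial, Gamma and power terms are
    atoms and only field arithmetic is left.\<close>
  have *: "4 * n * p * (g * (- s / (4 * e * (n * F) * (p * G)))) = - (g * (s / (e * F * G)))"
    if "n > 0" "p > 0" "G > 0" "e > 0" "F > 0" for n p G e F g s :: real
    using that by (simp add: divide_simps)
  show ?thesis
    unfolding bessel_coeff_def G f
    using *[of "real k + 1" "real k + \<alpha> + 1" "Gamma (\<alpha> + real k + 1)" "2 ^ (2 * k)" "fact k" "Gamma (\<alpha> + 1)" "(-1) ^ k"] pos G'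
    by simp
qed

text \<open>Since 4 (k + \<alpha> + 1) \<ge> 1, each step of the recursion gains at least a factor k
  + 1. Comparison with the exponential series then gives convergence for every y.\<close>

lemma bessel_coeff_abs_le: "\<bar>bessel_coeff \<alpha> k\<bar> \<le> 1 / fact k"
proof (induction k)
  case 0
  then show ?case by (simp add: bessel_coeff_0)
next
  case (Suc k)
  define p where "p = 4 * (real k + \<alpha> + 1)"
  have p: "1 \<le> p" using \<alpha> of_nat_0_le_iff[of k] by (simp add: p_def)
  have "(real k + 1) * (p * bessel_coeff \<alpha> (Suc k)) = - bessel_coeff \<alpha> k"
    using bessel_coeff_Suc[of k] by (simp add: p_def algebra_simps)
  then have "\<bar>(real k + 1) * (p * bessel_coeff \<alpha> (Suc k))\<bar> = \<bar>bessel_coeff \<alpha> k\<bar>"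
    by simp
  then have "(real k + 1) * (p * \<bar>bessel_coeff \<alpha> (Suc k)\<bar>) = \<bar>bessel_coeff \<alpha> k\<bar>"
    using p by (simp add: abs_mult)
  moreover have "(real k + 1) * (1 * \<bar>bessel_coeff \<alpha> (Suc k)\<bar>) \<le> (real k + 1) * (p * \<bar>bessel_coeff \<alpha> (Suc k)\<bar>)"
    using p by (intro mult_left_mono mult_right_mono) auto
  ultimately have "(real k + 1) * \<bar>bessel_coeff \<alpha> (Suc k)\<bar> \<le> 1 / fact k"
    using Suc by simp
  then have "\<bar>bessel_coeff \<alpha> (Suc k)\<bar> \<le> (1 / fact k) / (real k + 1)"
    by (subst pos_le_divide_eq) (auto simp: mult.commute)
  then show ?case by (simp add: mult.commute add.commute)
qed

lemma bessel_summable: "summable (\<lambda>k. bessel_coeff \<alpha> k * y ^ k)"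
proof (rule summable_comparison_test')
  show "summable (\<lambda>k. inverse (fact k) * \<bar>y\<bar> ^ k)"
    by (rule summable_exp)
  show "norm (bessel_coeff \<alpha> k * y ^ k) \<le> inverse (fact k) * \<bar>y\<bar> ^ k" for k
    using mult_right_mono[OF bessel_coeff_abs_le[of k], of "\<bar>y\<bar> ^ k"]
    by (simp add: abs_mult power_abs divide_inverse)
qed

lemma bessel_j_eq: "bessel_j \<alpha> t = bessel_J \<alpha> (t\<^sup>2)"
proof -
  have pos: "Gamma (\<alpha> + 1) \<noteq> 0" using \<alpha> by (intro less_imp_neq[THEN not_sym] Gamma_real_pos) simp
  have eq: "bessel_coeff \<alpha> k * (t\<^sup>2) ^ k =
      Gamma (\<alpha> + 1) * ((-1) ^ k * t ^ (2 * k) / (2 ^ (2 * k) * fact k * Gamma (\<alpha> + real k + 1)))" for k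
    by (simp add: bessel_coeff_def power_mult)
  have "summable (\<lambda>k. Gamma (\<alpha> + 1) * ((-1) ^ k * t ^ (2 * k) / (2 ^ (2 * k) * fact k * Gamma (\<alpha> + real k + 1))))"
    using bessel_summable[of "t\<^sup>2"] unfolding eq .
  then have "summable (\<lambda>k. (-1) ^ k * t ^ (2 * k) / (2 ^ (2 * k) * fact k * Gamma (\<alpha> + real k + 1)))"
    using pos by (simp only: summable_cmult_iff) simp
  then show ?thesis
    unfolding bessel_j_def bessel_J_def eq by (rule suminf_mult[symmetric])
qed

definition bessel_J' where "bessel_J' y = (\<Sum>k. diffs (bessel_coeff \<alpha>) k * y ^ k)"
definition bessel_J'' where "bessel_J'' y = (\<Sum>k. diffs (diffs (bessel_coeff \<alpha>)) k * y ^ k)"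

lemma summable_diffs: "summable (\<lambda>k. diffs (bessel_coeff \<alpha>) k * y ^ k)"
  by (rule termdiff_converges_all) (rule bessel_summable)

lemma summable_diffs2: "summable (\<lambda>k. diffs (diffs (bessel_coeff \<alpha>)) k * y ^ k)"
  by (rule termdiff_converges_all) (rule summable_diffs)

lemma DERIV_bessel_J: "(bessel_J \<alpha> has_field_derivative bessel_J' y) (at y)"
  unfolding bessel_J_def[abs_def] bessel_J'_def
  by (rule termdiffs_strong_converges_everywhere) (rule bessel_summable)

lemma DERIV_bessel_J': "(bessel_J' has_field_derivative bessel_J'' y) (at y)"
  unfolding bessel_J'_def[abs_def] bessel_J''_def
  by (rule termdiffs_strong_converges_everywhere) (rule summable_diffs)

text \<open>Bessel's equation j'' + ((2 \<alpha> + 1) / t) j' + j = 0 rewritten in y = t^2; the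
  coefficient of y^k on the left is the recursion of \<open>bessel_coeff\<close>.\<close>

lemma bessel_J_ODE: "4 * y * bessel_J'' y + 4 * (\<alpha> + 1) * bessel_J' y + bessel_J \<alpha> y = 0"
proof -
  have shift: "(\<lambda>k. real k * diffs (bessel_coeff \<alpha>) k * y ^ k) sums (y * bessel_J'' y)"
  proof -
    have "(\<lambda>k. y * (diffs (diffs (bessel_coeff \<alpha>)) k * y ^ k)) sums (y * bessel_J'' y)"
      unfolding bessel_J''_def by (intro sums_mult summable_sums summable_diffs2)
    also have "(\<lambda>k. y * (diffs (diffs (bessel_coeff \<alpha>)) k * y ^ k)) =
        (\<lambda>k. real (Suc k) * diffs (bessel_coeff \<alpha>) (Suc k) * y ^ Suc k)"
      by (simp add: diffs_def fun_eq_iff mult_ac)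
    finally have "(\<lambda>k. real (Suc k) * diffs (bessel_coeff \<alpha>) (Suc k) * y ^ Suc k) sums (y * bessel_J'' y)" .
    \<comment> \<open>The summand at k = 0 vanishes, so shifting the index by one leaves the sum
      unchanged.\<close>
    then show ?thesis
      using sums_Suc_iff[of "\<lambda>k. real k * diffs (bessel_coeff \<alpha>) k * y ^ k"] by simp
  qed
  have "(\<lambda>k. 4 * (real k * diffs (bessel_coeff \<alpha>) k * y ^ k)
      + (4 * (\<alpha> + 1)) * (diffs (bessel_coeff \<alpha>) k * y ^ k) + bessel_coeff \<alpha> k * y ^ k)
    sums (4 * (y * bessel_J'' y) + (4 * (\<alpha> + 1)) * bessel_J' y + bessel_J \<alpha> y)"
    unfolding bessel_J'_def bessel_J_def
    by (intro sums_add sums_mult shift summable_sums summable_diffs bessel_summable)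
  moreover have "4 * (real k * diffs (bessel_coeff \<alpha>) k * y ^ k)
      + (4 * (\<alpha> + 1)) * (diffs (bessel_coeff \<alpha>) k * y ^ k) + bessel_coeff \<alpha> k * y ^ k = 0" for k
  proof -
    have "4 * (real k * diffs (bessel_coeff \<alpha>) k * y ^ k)
      + (4 * (\<alpha> + 1)) * (diffs (bessel_coeff \<alpha>) k * y ^ k) + bessel_coeff \<alpha> k * y ^ k =
      (4 * (real k + 1) * (real k + \<alpha> + 1) * bessel_coeff \<alpha> (Suc k) + bessel_coeff \<alpha> k) * y ^ k"
      by (simp add: diffs_def algebra_simps)
    then show ?thesis unfolding bessel_coeff_Suc by simp
  qed
  ultimately have "(\<lambda>k. 0) sums (4 * (y * bessel_J'' y) + (4 * (\<alpha> + 1)) * bessel_J' y + bessel_J \<alpha> y)"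
    by (simp only:)
  from sums_unique2[OF this sums_zero] show ?thesis by (simp add: mult_ac)
qed

text \<open>The energy \<open>J\<^sup>2 + 4 y J'\<^sup>2\<close> has derivative \<open>- 4 (2 \<alpha> + 1) J'\<^sup>2\<close> by the differential equation.\<close>

lemma bessel_J_abs_le_1:
  assumes "0 \<le> y"
  shows "\<bar>bessel_J \<alpha> y\<bar> \<le> 1"
proof -
  define E where "E y = (bessel_J \<alpha> y)\<^sup>2 + 4 * y * (bessel_J' y)\<^sup>2" for y
  have "(E has_field_derivative (- 4 * (2 * \<alpha> + 1) * (bessel_J' y)\<^sup>2)) (at y)" for y
  proof -
    have "(E has_field_derivative (2 * bessel_J \<alpha> y * bessel_J' y + (4 * (bessel_J' y)\<^sup>2
        + 4 * y * (2 * bessel_J' y * bessel_J'' y)))) (at y)"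
      unfolding E_def[abs_def]
      by (rule derivative_eq_intros DERIV_bessel_J DERIV_bessel_J' refl | simp)+
    also have "2 * bessel_J \<alpha> y * bessel_J' y + (4 * (bessel_J' y)\<^sup>2
        + 4 * y * (2 * bessel_J' y * bessel_J'' y)) =
        2 * bessel_J' y * (4 * y * bessel_J'' y + 4 * (\<alpha> + 1) * bessel_J' y + bessel_J \<alpha> y)
        - 4 * (2 * \<alpha> + 1) * (bessel_J' y)\<^sup>2"
      by (simp add: power2_eq_square algebra_simps)
    finally show ?thesis unfolding bessel_J_ODE by (simp add: algebra_simps)
  qed
  note der = this
  have "E y \<le> E 0"
  proof (intro DERIV_nonpos_imp_nonincreasing[OF assms])
    fix z
    have "(E has_field_derivative (- 4 * (2 * \<alpha> + 1) * (bessel_J' z)\<^sup>2)) (at z)" by (rule der)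
    moreover have "- 4 * (2 * \<alpha> + 1) * (bessel_J' z)\<^sup>2 \<le> 0"
      using \<alpha> by (intro mult_nonpos_nonneg) auto
    ultimately show "\<exists>D. (E has_field_derivative D) (at z) \<and> D \<le> 0" by blast
  qed
  also have "E 0 = 1"
    by (simp add: E_def bessel_J_def bessel_coeff_0 powser_zero del: power_0_left)
  finally have "(bessel_J \<alpha> y)\<^sup>2 \<le> 1"
    using mult_nonneg_nonneg[OF assms zero_le_power2[of "bessel_J' y"]] by (simp add: E_def)
  then show ?thesis by (simp add: abs_square_le_1)
qed

lemma bessel_j_abs_le_1: "\<bar>bessel_j \<alpha> t\<bar> \<le> 1"
  unfolding bessel_j_eq by (rule bessel_J_abs_le_1) simp

lemma continuous_on_bessel_j [continuous_intros]:
  assumes "continuous_on S f"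
  shows "continuous_on S (\<lambda>x. bessel_j \<alpha> (f x))"
proof -
  have "continuous_on UNIV (bessel_J \<alpha>)"
    using DERIV_bessel_J by (intro DERIV_continuous_on) (auto intro: has_field_derivative_at_within)
  moreover have "continuous_on S (\<lambda>x. (f x)\<^sup>2)"
    using assms by (rule continuous_on_power)
  ultimately show ?thesis
    unfolding bessel_j_eq by (rule continuous_on_compose2) simp
qed

end

section \<open>Moments and Hankel transform of a Gaussian\<close>

text \<open>The substitution u = r t^2 in Euler's integral for Gamma (\<beta> + 1). The exponent is
  general because the Bessel series calls for every \<beta> = \<alpha> + k.\<close>

lemma gaussian_moment:
  fixes \<beta> r :: real
  assumes "\<beta> > -1" "r > 0"
  shows "set_integrable lborel {0<..} (\<lambda>t. t powr (2 * \<beta> + 1) * exp (- r * t\<^sup>2))"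
    and "(LINT t:{0<..}|lborel. t powr (2 * \<beta> + 1) * exp (- r * t\<^sup>2)) = Gamma (\<beta> + 1) / (2 * r powr (\<beta> + 1))"
proof -
  define f where "f u = u powr \<beta> / exp u" for u :: real
  define g where "g t = r * t\<^sup>2" for t
  have f: "f absolutely_integrable_on {0<..} \<and> integral {0<..} f = Gamma (\<beta> + 1)"
  proof
    have hi: "(f has_integral Gamma (\<beta> + 1)) {0<..}"
    proof -
      have "(f has_integral Gamma (\<beta> + 1)) {0..}"
        using Gamma_integral_real[of "\<beta> + 1"] assms by (simp add: f_def[abs_def])
      moreover have "negligible ({0..} - {0<..} :: real set)"
        by (rule negligible_subset[of "{0}"]) auto
      moreover have "{0<..} - {0..} = ({} :: real set)" by auto
      ultimately show ?thesis
        by (subst has_integral_spike_set_eq[of _ "{0..}"]) (auto intro: negligible_subset)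
    qed
    then show "integral {0<..} f = Gamma (\<beta> + 1)" by (rule integral_unique)
    show "f absolutely_integrable_on {0<..}"
      by (rule nonnegative_absolutely_integrable_1) (use hi in \<open>auto simp: f_def intro: has_integral_integrable\<close>)
  qed
  have img: "g ` {0<..} = {0<..}"
  proof (intro equalityI subsetI)
    fix x :: real assume "x \<in> {0<..}"
    then show "x \<in> g ` {0<..}"
      using assms by (intro image_eqI[of _ _ "sqrt (x / r)"]) (auto simp: g_def)
  qed (use assms in \<open>auto simp: g_def\<close>)
  have inj: "inj_on g {0<..}"
    using assms by (auto simp: inj_on_def g_def)
  have der: "(g has_field_derivative (2 * r * t)) (at t within {0<..})" for t
    unfolding g_def[abs_def] by (auto intro!: derivative_eq_intros)
  have cv: "(\<lambda>t. \<bar>2 * r * t\<bar> * f (g t)) absolutely_integrable_on {0<..} \<and>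
      integral {0<..} (\<lambda>t. \<bar>2 * r * t\<bar> * f (g t)) = Gamma (\<beta> + 1)"
    using has_absolute_integral_change_of_variables_1'[of "{0<..}" g "\<lambda>t. 2 * r * t" f "Gamma (\<beta> + 1)"]
      der inj f by (simp add: img)
  define h where "h t = t powr (2 * \<beta> + 1) * exp (- r * t\<^sup>2)" for t
  \<comment> \<open>The Jacobian 2 r t supplies the extra power of t and one factor r.\<close>
  have eq: "\<bar>2 * r * t\<bar> * f (g t) = 2 * r powr (\<beta> + 1) * h t" if "t \<in> {0<..}" for t
  proof -
    have t: "0 < t" using that by simp
    have "(r * t\<^sup>2) powr \<beta> = r powr \<beta> * t powr (2 * \<beta>)"
      using t assms by (simp add: powr_mult powr_powr flip: powr_numeral)
    then show ?thesis
      using t assms by (simp add: f_def g_def h_def powr_add exp_minus field_simps)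
  qed
  have ai: "(\<lambda>t. 2 * r powr (\<beta> + 1) * h t) absolutely_integrable_on {0<..}"
    using cv by (subst set_integrable_cong[OF refl refl eq[symmetric]]) auto
  have ai2: "h absolutely_integrable_on {0<..}"
    using absolutely_integrable_scaleR_left[OF ai, of "1 / (2 * r powr (\<beta> + 1))"] assms by simp
  have ii: "2 * r powr (\<beta> + 1) * integral {0<..} h = Gamma (\<beta> + 1)"
    using cv integral_cong[of "{0<..}" "\<lambda>t. \<bar>2 * r * t\<bar> * f (g t)", OF eq] by simp
  \<comment> \<open>The change of variables lives on the completed measure; Borel measurability
    brings integrability back to \<open>lborel\<close>.\<close>
  have meas: "(\<lambda>t. indicator {0<..} t *\<^sub>R h t) \<in> borel_measurable lborel"
    unfolding h_def by measurable
  show *: "set_integrable lborel {0<..} (\<lambda>t. t powr (2 * \<beta> + 1) * exp (- r * t\<^sup>2))"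
    using ai2 meas unfolding h_def[symmetric, abs_def] set_integrable_def
    by (simp add: integrable_completion)
  have "(LINT t:{0<..}|lborel. h t) = integral {0<..} h"
    using * by (intro set_borel_integral_eq_integral(2)) (simp add: h_def)
  then show "(LINT t:{0<..}|lborel. t powr (2 * \<beta> + 1) * exp (- r * t\<^sup>2)) = Gamma (\<beta> + 1) / (2 * r powr (\<beta> + 1))"
    using ii assms by (simp add: h_def field_simps)
qed

text \<open>Termwise integration of the Bessel series: the moment of order \<alpha> + k contributes
  Gamma (\<alpha> + k + 1), which cancels the Gamma in the coefficient, and what remains is the
  exponential series of - s^2 / (4 r).\<close>

lemma hankel_gaussian:
  fixes \<alpha> r s :: real
  assumes \<alpha>: "\<alpha> > - 1 / 2" and r: "r > 0"
  shows "set_integrable lborel {0<..} (\<lambda>t. t powr (2 * \<alpha> + 1) * (exp (- r * t\<^sup>2) * bessel_j \<alpha> (t * s)))"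
    and "(LINT t:{0<..}|lborel. t powr (2 * \<alpha> + 1) * (exp (- r * t\<^sup>2) * bessel_j \<alpha> (t * s))) =
      Gamma (\<alpha> + 1) / (2 * r powr (\<alpha> + 1)) * exp (- s\<^sup>2 / (4 * r))"
proof -
  define F where "F k t = indicator {0<..} t *\<^sub>R (t powr (2 * \<alpha> + 1) * (exp (- r * t\<^sup>2) * (bessel_coeff \<alpha> k * (t * s) ^ (2 * k))))"
    for k t
  define q where "q k = s ^ (2 * k) * bessel_coeff \<alpha> k * (Gamma (\<alpha> + real k + 1) / (2 * r powr (\<alpha> + real k + 1)))" for k
  have a: "\<alpha> + real k > -1" for k using \<alpha> of_nat_0_le_iff[of k] by linarith
  have Feq: "F k t = (s ^ (2 * k) * bessel_coeff \<alpha> k) * (indicator {0<..} t *\<^sub>R (t powr (2 * (\<alpha> + real k) + 1) * exp (- r * t\<^sup>2)))" for k t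
  proof (cases "0 < t")
    case True
    have "t powr (2 * (\<alpha> + real k) + 1) = t powr (2 * \<alpha> + 1) * t powr real (2 * k)"
      by (simp add: powr_add[symmetric] algebra_simps)
    also have "t powr real (2 * k) = t ^ (2 * k)"
      using True by (rule powr_realpow)
    finally show ?thesis using True by (simp add: F_def power_mult_distrib)
  qed (simp add: F_def)
  have Fint: "integrable lborel (F k)" for k
    unfolding Feq[abs_def] using gaussian_moment(1)[OF a r, of k] unfolding set_integrable_def
    by (intro integrable_mult_right) auto
  have FI: "(LINT t|lborel. F k t) = q k" for k
    unfolding Feq[abs_def] q_def using gaussian_moment(2)[OF a r, of k] unfolding set_lebesgue_integral_def
    by (subst integral_mult_right_zero) (simp add: add_ac)
  \<comment> \<open>Each F k has constant sign, so its absolute integral is the absolute value of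
    its integral; summability of these values justifies the interchange.\<close>
  have FA: "(LINT t|lborel. norm (F k t)) = \<bar>q k\<bar>" for k
  proof -
    have "norm (F k t) = \<bar>s ^ (2 * k) * bessel_coeff \<alpha> k\<bar> * (indicator {0<..} t *\<^sub>R (t powr (2 * (\<alpha> + real k) + 1) * exp (- r * t\<^sup>2)))" for t
      unfolding Feq by (simp add: abs_mult split: split_indicator)
    moreover have "Gamma (\<alpha> + real k + 1) > 0" using a[of k] by (intro Gamma_real_pos) simp
    ultimately show ?thesis
      using gaussian_moment(2)[OF a r, of k] unfolding set_lebesgue_integral_def
      by (simp add: q_def abs_mult add_ac)
  qed
  have qeq: "q k = Gamma (\<alpha> + 1) / (2 * r powr (\<alpha> + 1)) * ((- s\<^sup>2 / (4 * r)) ^ k /\<^sub>R fact k)" for k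
  proof -
    have "Gamma (\<alpha> + real k + 1) > 0" using a[of k] by (intro Gamma_real_pos) simp
    moreover have "r powr (\<alpha> + real k + 1) = r powr (\<alpha> + 1) * r ^ k"
      using r by (simp add: powr_add powr_realpow)
    moreover have "(- s\<^sup>2 / (4 * r)) ^ k = (-1) ^ k * (s\<^sup>2) ^ k / (4 ^ k * r ^ k)"
      by (simp only: power_divide power_mult_distrib power_minus[of "s\<^sup>2"])
    moreover have "s ^ (2 * k) = (s\<^sup>2) ^ k" "2 ^ (2 * k) = (4 :: real) ^ k"
      by (simp_all add: power_mult)
    moreover have "S * (g1 * (e / (f4 * F * G))) * (G / (2 * (R * rk))) = g1 / (2 * R) * (inverse F * (e * S / (f4 * rk)))"
      if "G > 0" for S g1 e f4 F G R rk :: real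
      using that by (simp add: divide_simps)
    ultimately show ?thesis
      unfolding q_def bessel_coeff_def real_scaleR_def by (simp only:)
  qed
  have qs: "summable (\<lambda>k. \<bar>q k\<bar>)"
  proof -
    have "summable (\<lambda>k. \<bar>Gamma (\<alpha> + 1) / (2 * r powr (\<alpha> + 1))\<bar> * norm ((- s\<^sup>2 / (4 * r)) ^ k /\<^sub>R fact k))"
      by (intro summable_mult summable_norm_exp)
    then show ?thesis by (simp add: qeq abs_mult)
  qed
  have Fsums: "F' sums (indicator {0<..} t *\<^sub>R (t powr (2 * \<alpha> + 1) * (exp (- r * t\<^sup>2) * bessel_j \<alpha> (t * s))))"
     if "F' = (\<lambda>k. F k t)" for t F'
  proof -
    have "(\<lambda>k. bessel_coeff \<alpha> k * ((t * s)\<^sup>2) ^ k) sums bessel_j \<alpha> (t * s)"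
      unfolding bessel_j_eq[OF \<alpha>] bessel_J_def by (intro summable_sums bessel_summable[OF \<alpha>])
    then show ?thesis
      unfolding that F_def by (intro sums_scaleR_right sums_mult) (simp add: power_mult)
  qed
  have Fsummable: "summable (\<lambda>k. norm (F k t))" for t
  proof -
    \<comment> \<open>A power series that converges at a point of larger modulus, here the argument
      plus 1, converges absolutely.\<close>
    have "summable (\<lambda>k. norm (bessel_coeff \<alpha> k * ((t * s)\<^sup>2) ^ k))"
      by (intro powser_insidea[where x="\<bar>(t * s)\<^sup>2\<bar> + 1"] bessel_summable[OF \<alpha>]) simp
    then have "summable (\<lambda>k. \<bar>indicator {0<..} t * (t powr (2 * \<alpha> + 1) * exp (- r * t\<^sup>2))\<bar> * norm (bessel_coeff \<alpha> k * ((t * s)\<^sup>2) ^ k))"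
      by (rule summable_mult)
    moreover have "norm (F k t) = \<bar>indicator {0<..} t * (t powr (2 * \<alpha> + 1) * exp (- r * t\<^sup>2))\<bar> * norm (bessel_coeff \<alpha> k * ((t * s)\<^sup>2) ^ k)" for k
      unfolding F_def power_mult by (simp add: abs_mult)
    ultimately show ?thesis by (simp only:)
  qed
  have eqs: "(\<lambda>t. \<Sum>k. F k t) = (\<lambda>t. indicator {0<..} t *\<^sub>R (t powr (2 * \<alpha> + 1) * (exp (- r * t\<^sup>2) * bessel_j \<alpha> (t * s))))"
    using Fsums[OF refl] by (intro ext sums_unique[symmetric])
  have "integrable lborel (\<lambda>t. \<Sum>k. F k t)"
    by (rule integrable_suminf[OF Fint]) (simp_all only: FA qs Fsummable AE_I2)
  then show "set_integrable lborel {0<..} (\<lambda>t. t powr (2 * \<alpha> + 1) * (exp (- r * t\<^sup>2) * bessel_j \<alpha> (t * s)))"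
    unfolding eqs set_integrable_def .
  have "(LINT t|lborel. (\<Sum>k. F k t)) = (\<Sum>k. (LINT t|lborel. F k t))"
    by (rule integral_suminf[OF Fint]) (simp_all only: FA qs Fsummable AE_I2)
  also have "\<dots> = Gamma (\<alpha> + 1) / (2 * r powr (\<alpha> + 1)) * exp (- s\<^sup>2 / (4 * r))"
    unfolding FI qeq exp_def by (intro suminf_mult summable_exp_generic)
  finally show "(LINT t:{0<..}|lborel. t powr (2 * \<alpha> + 1) * (exp (- r * t\<^sup>2) * bessel_j \<alpha> (t * s))) =
      Gamma (\<alpha> + 1) / (2 * r powr (\<alpha> + 1)) * exp (- s\<^sup>2 / (4 * r))"
    unfolding eqs set_lebesgue_integral_def .
qed

section \<open>The Weinstein measure\<close>

text \<open>The characteristic function of the standard normal law, multiplied by sqrt (2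
  pi).\<close>

lemma gaussian_fourier_1d:
  "integrable lborel (\<lambda>x. exp (- complex_of_real (x\<^sup>2 / 2)) * iexp (t * x))"
  "(LINT x|lborel. exp (- complex_of_real (x\<^sup>2 / 2)) * iexp (t * x)) = complex_of_real (sqrt (2 * pi) * exp (- t\<^sup>2 / 2))"
proof -
  interpret prob_space std_normal_distribution
    by (rule prob_space_normal_density) simp
  have "integrable std_normal_distribution (\<lambda>x. iexp (t * x))"
    by (rule integrable_iexp) auto
  then have i: "integrable lborel (\<lambda>x. std_normal_density x *\<^sub>R iexp (t * x))"
    by (subst (asm) integrable_density) auto
  have I: "(LINT x|lborel. std_normal_density x *\<^sub>R iexp (t * x)) = exp (- t\<^sup>2 / 2)"
    using fun_cong[OF char_std_normal_distribution, of t]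
    unfolding char_def by (subst (asm) integral_density) auto
  have eq: "exp (- complex_of_real (x\<^sup>2 / 2)) * iexp (t * x) = complex_of_real (sqrt (2 * pi)) * (std_normal_density x *\<^sub>R iexp (t * x))" for x
    by (simp add: std_normal_density_def scaleR_conv_of_real exp_of_real[symmetric])
  show "integrable lborel (\<lambda>x. exp (- complex_of_real (x\<^sup>2 / 2)) * iexp (t * x))"
    unfolding eq using i by (rule integrable_mult_right)
  show "(LINT x|lborel. exp (- complex_of_real (x\<^sup>2 / 2)) * iexp (t * x)) = complex_of_real (sqrt (2 * pi) * exp (- t\<^sup>2 / 2))"
    unfolding eq integral_mult_right_zero I by simp
qed

text \<open>\<open>lborel\<close> is the image of a product of one-dimensional measures, and both
  the Gaussian and the phase factor over the basis vectors.\<close>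

lemma gaussian_fourier:
  fixes \<xi> :: "'a::euclidean_space"
  shows "integrable lborel (\<lambda>x::'a. complex_of_real (exp (- (norm x)\<^sup>2 / 2)) * iexp (x \<bullet> \<xi>))"
    and "(LINT x|lborel. complex_of_real (exp (- (norm x)\<^sup>2 / 2)) * iexp (x \<bullet> \<xi>)) =
      complex_of_real ((2 * pi) powr (real DIM('a) / 2) * exp (- (norm \<xi>)\<^sup>2 / 2))"
proof -
  interpret product_sigma_finite "\<lambda>_::'a. lborel :: real measure" ..
  define h where "h b x = exp (- complex_of_real (x\<^sup>2 / 2)) * iexp ((\<xi> \<bullet> b) * x)" for b :: 'a and x
  define f where "f x = complex_of_real (exp (- (norm x)\<^sup>2 / 2)) * iexp (x \<bullet> \<xi>)" for x :: 'a
  have f: "f (\<Sum>b\<in>Basis. g b *\<^sub>R b) = (\<Prod>b\<in>Basis. h b (g b))" for g :: "'a \<Rightarrow> real"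
  proof -
    define x where "x = (\<Sum>b\<in>Basis. g b *\<^sub>R b)"
    have xb: "x \<bullet> b = g b" if "b \<in> Basis" for b
      using that by (simp add: x_def)
    have n: "(norm x)\<^sup>2 = (\<Sum>b\<in>Basis. (g b)\<^sup>2)"
      unfolding power2_norm_eq_inner euclidean_inner[of x x] by (rule sum.cong) (auto simp: xb power2_eq_square)
    have i: "x \<bullet> \<xi> = (\<Sum>b\<in>Basis. g b * (\<xi> \<bullet> b))"
      by (simp add: euclidean_inner[of x \<xi>] xb)
    show ?thesis
      unfolding x_def[symmetric] f_def h_def n i prod.distrib exp_sum[OF finite_Basis, symmetric]
      by (simp add: exp_of_real[symmetric] sum_distrib_left sum_negf sum_divide_distrib mult_ac)
  qed
  have [measurable]: "f \<in> borel_measurable borel"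
    unfolding f_def by measurable
  have i: "integrable lborel (h b)" for b
    unfolding h_def by (rule gaussian_fourier_1d)
  have "integrable (distr (\<Pi>\<^sub>M b\<in>Basis. lborel) borel (\<lambda>f. \<Sum>b\<in>Basis. f b *\<^sub>R b)) f"
    by (subst integrable_distr_eq) (auto simp: f i intro!: product_integrable_prod)
  then have "integrable lborel f"
    by (subst lborel_eq)
  then show "integrable lborel (\<lambda>x::'a. complex_of_real (exp (- (norm x)\<^sup>2 / 2)) * iexp (x \<bullet> \<xi>))"
    by (simp add: f_def[abs_def])
  have "(LINT x|lborel. f x) = (LINT g|(\<Pi>\<^sub>M b\<in>Basis. lborel). (\<Prod>b\<in>Basis. h b (g b)))"
    by (subst lborel_eq, subst integral_distr) (auto simp: f)
  also have "\<dots> = (\<Prod>b\<in>Basis. (LINT x|lborel. h b x))"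
    by (rule product_integral_prod) (auto simp: i)
  also have "\<dots> = (\<Prod>b\<in>(Basis::'a set). complex_of_real (sqrt (2 * pi) * exp (- (\<xi> \<bullet> b)\<^sup>2 / 2)))"
    unfolding h_def gaussian_fourier_1d(2) ..
  also have "\<dots> = complex_of_real (sqrt (2 * pi) ^ DIM('a) * exp (\<Sum>b\<in>(Basis::'a set). - (\<xi> \<bullet> b)\<^sup>2 / 2))"
    by (simp add: prod.distrib exp_sum)
  also have "(\<Sum>b\<in>(Basis::'a set). - (\<xi> \<bullet> b)\<^sup>2 / 2) = - (norm \<xi>)\<^sup>2 / 2"
    unfolding power2_norm_eq_inner euclidean_inner[of \<xi> \<xi>]
    by (simp add: power2_eq_square sum_negf sum_divide_distrib)
  also have "sqrt (2 * pi) ^ DIM('a) = (2 * pi) powr (real DIM('a) / 2)"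
    by (simp add: powr_half_sqrt[symmetric] powr_powr flip: powr_realpow)
  finally show "(LINT x|lborel. complex_of_real (exp (- (norm x)\<^sup>2 / 2)) * iexp (x \<bullet> \<xi>)) =
      complex_of_real ((2 * pi) powr (real DIM('a) / 2) * exp (- (norm \<xi>)\<^sup>2 / 2))"
    by (simp add: f_def)
qed

section \<open>The half-space, reflection and dilation\<close>

lemma open_half_space: "open (half_space :: ('d::finite) pt set)"
  unfolding half_space_def by (intro open_Collect_less continuous_intros)

lemma half_space_sets [measurable, simp]: "half_space \<in> sets borel"
  by (rule borel_open[OF open_half_space])

lemma flip_flip [simp]: "flip (flip x) = x"
  by (simp add: flip_def)

lemma fst_flip [simp]: "fst (flip x) = - fst x" and snd_flip [simp]: "snd (flip x) = snd x"
  by (simp_all add: flip_def)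

lemma flip_half_space [simp]: "flip x \<in> half_space \<longleftrightarrow> x \<in> half_space"
  by (simp add: half_space_def)

lemma measurable_flip [measurable]: "flip \<in> borel_measurable borel"
  unfolding flip_def[abs_def] by (intro borel_measurable_continuous_onI continuous_intros)

text \<open>Reflection is a diagonal linear map with entries -1 and 1, so its Jacobian is 1.\<close>

lemma lborel_distr_flip: "distr lborel borel (flip :: ('d::finite) pt \<Rightarrow> _) = lborel"
proof -
  \<comment> \<open>Among the basis vectors of the product, a zero last coordinate singles out those
    of the first factor, where the sign changes.\<close>
  define c :: "'d pt \<Rightarrow> real" where "c j = (if snd j = 0 then -1 else 1)" for j
  have T: "0 + (\<Sum>j\<in>Basis. (c j * (x \<bullet> j)) *\<^sub>R j) = flip x" for x
  proof (rule euclidean_eqI)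
    fix b :: "'d pt" assume b: "b \<in> Basis"
    then have "(0 + (\<Sum>j\<in>Basis. (c j * (x \<bullet> j)) *\<^sub>R j)) \<bullet> b = c b * (x \<bullet> b)"
      by simp
    also have "\<dots> = flip x \<bullet> b"
      using b by (auto simp: c_def flip_def Basis_prod_def inner_prod_def)
    finally show "(0 + (\<Sum>j\<in>Basis. (c j * (x \<bullet> j)) *\<^sub>R j)) \<bullet> b = flip x \<bullet> b" .
  qed
  have p: "(\<Prod>j\<in>Basis. \<bar>c j\<bar>) = 1"
    by (intro prod.neutral) (auto simp: c_def)
  have "lborel = density (distr lborel borel (\<lambda>x. 0 + (\<Sum>j\<in>Basis. (c j * (x \<bullet> j)) *\<^sub>R j))) (\<lambda>_. (\<Prod>j\<in>Basis. \<bar>c j\<bar>))"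
    by (rule lborel_affine_euclidean) (auto simp: c_def)
  then show ?thesis
    unfolding T p by (simp add: density_1)
qed

text \<open>Scaling multiplies Lebesgue measure by a positive constant, so null sets are preserved.
  This transfers the essential bound of a multiplier to its dilate.\<close>

lemma AE_lborel_scaleR:
  fixes \<sigma> :: real
  assumes "\<sigma> \<noteq> 0" and "AE x in (lborel :: 'a::euclidean_space measure). P x"
  shows "AE x in lborel. P (\<sigma> *\<^sub>R (x :: 'a))"
proof -
  have "lborel = density (distr lborel borel ((*\<^sub>R) \<sigma>)) (\<lambda>_::'a. ennreal (\<bar>\<sigma>\<bar> ^ DIM('a)))"
    using lborel_affine[OF assms(1), of "0::'a"] by simp
  note eq = this
  have "AE x in density (distr lborel borel ((*\<^sub>R) \<sigma>)) (\<lambda>_::'a. ennreal (\<bar>\<sigma>\<bar> ^ DIM('a))). P x"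
    using assms(2) by (subst (asm) eq)
  then have "AE x in distr lborel borel ((*\<^sub>R) \<sigma>). P (x :: 'a)"
    using assms(1) by (subst (asm) AE_density) auto
  then show ?thesis
    by (rule AE_distrD[rotated]) simp
qed

section \<open>Null sets, product integrals and reflection invariance of the Weinstein
  measure\<close>

definition weinstein_density :: "real \<Rightarrow> ('d::finite) pt \<Rightarrow> real" where
  "weinstein_density \<alpha> x = snd x powr (2 * \<alpha> + 1) /
     ((2 * pi) powr (real CARD('d) / 2) * 2 powr \<alpha> * Gamma (\<alpha> + 1))"

lemma measurable_weinstein_density [measurable]: "weinstein_density \<alpha> \<in> borel_measurable borel"
  unfolding weinstein_density_def[abs_def] borel_prod[symmetric] by measurable

lemma space_weinstein [simp]: "space (weinstein_measure \<alpha>) = half_space"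
  by (simp add: weinstein_measure_def space_restrict_space)

lemma sets_weinstein: "sets (weinstein_measure \<alpha>) = sets (restrict_space borel half_space)"
  by (simp add: weinstein_measure_def sets_restrict_space)

lemma measurable_weinsteinI [measurable (raw)]:
  "f \<in> borel \<rightarrow>\<^sub>M N \<Longrightarrow> f \<in> weinstein_measure \<alpha> \<rightarrow>\<^sub>M N"
  by (subst measurable_cong_sets[OF sets_weinstein refl]) (rule measurable_restrict_space1)

text \<open>Extension by zero yields a Borel function on the whole space, the form in which
  measurable functions are later approximated by continuous ones.\<close>

lemma measurable_weinstein_indicator:
  fixes f :: "('d::finite) pt \<Rightarrow> 'b::real_normed_vector"
  assumes "f \<in> borel_measurable (weinstein_measure \<alpha>)"
  shows "(\<lambda>x. indicator half_space x *\<^sub>R f x) \<in> borel_measurable borel"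
  using assms unfolding measurable_cong_sets[OF sets_weinstein refl]
  by (subst (asm) borel_measurable_restrict_space_iff) auto

context
  fixes \<alpha> :: real
  assumes \<alpha>: "\<alpha> > - 1 / 2"
begin

lemma weinstein_const_pos: "0 < (2 * pi) powr (real n / 2) * 2 powr \<alpha> * Gamma (\<alpha> + 1)"
  using \<alpha> by (intro mult_pos_pos Gamma_real_pos) auto

lemma weinstein_density_nonneg: "0 \<le> weinstein_density \<alpha> x"
  unfolding weinstein_density_def by (intro divide_nonneg_pos weinstein_const_pos) simp

lemma weinstein_density_pos: "x \<in> half_space \<Longrightarrow> 0 < weinstein_density \<alpha> x"
  unfolding weinstein_density_def by (intro divide_pos_pos weinstein_const_pos) (simp add: half_space_def)

lemma weinstein_measure_eq:
  "weinstein_measure \<alpha> = density (restrict_space lborel half_space) (\<lambda>x. ennreal (weinstein_density \<alpha> x))"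
  by (simp add: weinstein_measure_def weinstein_density_def)

text \<open>The density is positive throughout the half-space, so the null sets there are those of
  Lebesgue measure.\<close>

lemma AE_weinstein_iff:
  "(AE x in weinstein_measure \<alpha>. P x) \<longleftrightarrow> (AE x in lborel. x \<in> half_space \<longrightarrow> P x)"
proof -
  have "(AE x in weinstein_measure \<alpha>. P x) \<longleftrightarrow>
      (AE x in restrict_space lborel half_space. 0 < ennreal (weinstein_density \<alpha> x) \<longrightarrow> P x)"
    unfolding weinstein_measure_eq by (rule AE_density) (auto intro!: measurable_restrict_space1)
  also have "\<dots> \<longleftrightarrow> (AE x in lborel. x \<in> half_space \<longrightarrow> (0 < ennreal (weinstein_density \<alpha> x) \<longrightarrow> P x))"
    by (rule AE_restrict_space_iff) simp
  also have "\<dots> \<longleftrightarrow> (AE x in lborel. x \<in> half_space \<longrightarrow> P x)"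
    by (intro AE_cong) (auto simp: weinstein_density_pos)
  finally show ?thesis .
qed

lemma
  fixes f :: "('d::finite) pt \<Rightarrow> 'b::{banach, second_countable_topology}"
  assumes f: "f \<in> borel_measurable (weinstein_measure \<alpha>)"
  shows integrable_weinstein_iff: "integrable (weinstein_measure \<alpha>) f \<longleftrightarrow>
      integrable lborel (\<lambda>x. indicator half_space x *\<^sub>R (weinstein_density \<alpha> x *\<^sub>R f x))" (is ?A)
    and integral_weinstein_eq: "integral\<^sup>L (weinstein_measure \<alpha>) f =
      (\<integral>x. indicator half_space x *\<^sub>R (weinstein_density \<alpha> x *\<^sub>R f x) \<partial>lborel)" (is ?B)
proof -
  have f': "f \<in> borel_measurable (restrict_space lborel half_space)"
    using f by (simp add: weinstein_measure_eq)
  have [measurable]: "weinstein_density \<alpha> \<in> borel_measurable (restrict_space lborel half_space)"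
    by (rule measurable_restrict_space1) simp
  show ?A
    unfolding weinstein_measure_eq
    by (subst integrable_density[OF f']) (auto simp: weinstein_density_nonneg integrable_restrict_space)
  show ?B
    unfolding weinstein_measure_eq
    by (subst integral_density[OF f']) (auto simp: weinstein_density_nonneg integral_restrict_space)
qed

lemma sigma_finite_weinstein: "sigma_finite_measure (weinstein_measure \<alpha> :: ('d::finite) pt measure)"
proof -
  interpret sigma_finite_measure "restrict_space (lborel :: 'd pt measure) half_space"
    by (rule sigma_finite_measure_restrict_space) (auto simp: sigma_finite_lborel)
  show ?thesis
    unfolding weinstein_measure_eq
    by (subst sigma_finite_iff_density_finite) (auto intro!: measurable_restrict_space1)
qed

text \<open>The density depends on the last coordinate alone, so Fubini splits the integral; the
  power weight stays with B and the normalising constant is pulled out.\<close>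

lemma
  fixes A :: "(real ^ 'd::finite) \<Rightarrow> complex" and B :: "real \<Rightarrow> real"
  assumes A: "integrable lborel A" and B: "set_integrable lborel {0<..} (\<lambda>t. t powr (2 * \<alpha> + 1) * B t)"
    and Bm: "B \<in> borel_measurable borel"
  shows integrable_weinstein_product: "integrable (weinstein_measure \<alpha>) (\<lambda>x. A (fst x) * complex_of_real (B (snd x)))" (is ?A)
    and integral_weinstein_product: "(\<integral>x. A (fst x) * complex_of_real (B (snd x)) \<partial>weinstein_measure \<alpha>) =
      integral\<^sup>L lborel A * complex_of_real (LINT t:{0<..}|lborel. t powr (2 * \<alpha> + 1) * B t) /
        complex_of_real ((2 * pi) powr (real CARD('d) / 2) * 2 powr \<alpha> * Gamma (\<alpha> + 1))" (is ?B)
proof -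
  define c where "c = (2 * pi) powr (real CARD('d) / 2) * 2 powr \<alpha> * Gamma (\<alpha> + 1)"
  \<comment> \<open>Indicator, weight and constant are absorbed into the second factor, which turns
    the integrand into a pure product on the full space.\<close>
  define B' where "B' t = complex_of_real (indicator {0<..} t * (t powr (2 * \<alpha> + 1) * B t) / c)" for t
  have iB: "integrable lborel (\<lambda>t. indicator {0<..} t * (t powr (2 * \<alpha> + 1) * B t))"
    using B by (simp add: set_integrable_def)
  have B': "integrable lborel B'"
    unfolding B'_def by (intro integrable_of_real integrable_divide iB)
  have IB': "integral\<^sup>L lborel B' = complex_of_real (LINT t:{0<..}|lborel. t powr (2 * \<alpha> + 1) * B t) / complex_of_real c"
    unfolding B'_def set_lebesgue_integral_def integral_complex_of_real by simp
  have [measurable]: "A \<in> borel_measurable borel"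
    using A by auto
  have m: "(\<lambda>x. A (fst x) * complex_of_real (B (snd x))) \<in> borel_measurable (borel :: 'd pt measure)"
    unfolding borel_prod[symmetric] using Bm by measurable
  then have m': "(\<lambda>x. A (fst x) * complex_of_real (B (snd x))) \<in> borel_measurable (weinstein_measure \<alpha> :: 'd pt measure)"
    by measurable
  have eq: "indicator half_space x *\<^sub>R (weinstein_density \<alpha> x *\<^sub>R (A (fst x) * complex_of_real (B (snd x)))) =
      A (fst x) * B' (snd x)" for x :: "'d pt"
    by (simp add: B'_def c_def weinstein_density_def half_space_def scaleR_conv_of_real indicator_def)
  have [measurable]: "B' \<in> borel_measurable borel"
    using B' by auto
  have int: "integrable (lborel \<Otimes>\<^sub>M lborel) (\<lambda>x. A (fst x) * B' (snd x))"
  proof (rule lborel_pair.Fubini_integrable)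
    have "integrable lborel (\<lambda>x. norm (A x) * (\<integral>y. norm (B' y) \<partial>lborel))"
      by (intro integrable_mult_left integrable_norm A)
    then show "integrable lborel (\<lambda>x. \<integral>y. norm (A (fst (x, y)) * B' (snd (x, y))) \<partial>lborel)"
      by (simp add: norm_mult)
    show "AE x in lborel. integrable lborel (\<lambda>y. A (fst (x, y)) * B' (snd (x, y)))"
      using B' by simp
  qed measurable
  show ?A
    unfolding integrable_weinstein_iff[OF m'] eq using int by (simp add: lborel_prod)
  have "(\<integral>x. A (fst x) * B' (snd x) \<partial>(lborel \<Otimes>\<^sub>M lborel)) = (\<integral>x. (\<integral>y. A x * B' y \<partial>lborel) \<partial>lborel)"
    using lborel_pair.integral_fst'[OF int] by simp
  also have "\<dots> = integral\<^sup>L lborel A * integral\<^sup>L lborel B'"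
    by simp
  finally show ?B
    unfolding integral_weinstein_eq[OF m'] eq IB' c_def[symmetric] by (simp add: lborel_prod)
qed

lemma flip_measurable_weinstein [measurable]:
  "flip \<in> weinstein_measure \<alpha> \<rightarrow>\<^sub>M weinstein_measure \<alpha>"
  unfolding measurable_cong_sets[OF sets_weinstein sets_weinstein]
  by (intro measurable_restrict_space2 measurable_restrict_space1) (auto simp: space_restrict_space)

text \<open>Reflection preserves Lebesgue measure and fixes the last coordinate, which is all that
  the density sees.\<close>

lemma distr_flip: "distr (weinstein_measure \<alpha>) (weinstein_measure \<alpha>) flip = (weinstein_measure \<alpha> :: ('d::finite) pt measure)"
proof (rule measure_eqI)
  fix A assume "A \<in> sets (distr (weinstein_measure \<alpha>) (weinstein_measure \<alpha>) (flip :: 'd pt \<Rightarrow> _))"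
  then have A: "A \<in> sets (weinstein_measure \<alpha> :: 'd pt measure)" by simp
  have em: "emeasure (weinstein_measure \<alpha>) A = (\<integral>\<^sup>+x. ennreal (weinstein_density \<alpha> x) * indicator A x \<partial>lborel)"
    and Ab: "A \<in> sets borel"
    if A: "A \<in> sets (weinstein_measure \<alpha> :: 'd pt measure)" for A
  proof -
    have A': "A \<subseteq> half_space" "A \<in> sets borel"
      using A by (auto simp: sets_weinstein sets_restrict_space_iff)
    then show "A \<in> sets borel" by simp
    have "emeasure (weinstein_measure \<alpha>) A = (\<integral>\<^sup>+x. ennreal (weinstein_density \<alpha> x) * indicator A x \<partial>restrict_space lborel half_space)"
      unfolding weinstein_measure_eq using A
      by (intro emeasure_density) (auto intro!: measurable_restrict_space1 simp: weinstein_measure_eq)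
    also have "\<dots> = (\<integral>\<^sup>+x. ennreal (weinstein_density \<alpha> x) * indicator A x * indicator half_space x \<partial>lborel)"
      by (rule nn_integral_restrict_space) simp
    also have "\<dots> = (\<integral>\<^sup>+x. ennreal (weinstein_density \<alpha> x) * indicator A x \<partial>lborel)"
      using A' by (intro nn_integral_cong) (auto split: split_indicator)
    finally show "emeasure (weinstein_measure \<alpha>) A = (\<integral>\<^sup>+x. ennreal (weinstein_density \<alpha> x) * indicator A x \<partial>lborel)" .
  qed
  have fA: "flip -` A \<inter> space (weinstein_measure \<alpha>) \<in> sets (weinstein_measure \<alpha> :: 'd pt measure)"
    using A by (rule measurable_sets[OF flip_measurable_weinstein])
  have "A \<subseteq> half_space" using sets.sets_into_space[OF A] by simp
  then have fe: "flip -` A \<inter> space (weinstein_measure \<alpha>) = flip -` A"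
    using flip_half_space unfolding space_weinstein by blast
  note [measurable] = Ab[OF A]
  have "emeasure (weinstein_measure \<alpha>) A = (\<integral>\<^sup>+x. ennreal (weinstein_density \<alpha> x) * indicator A x \<partial>distr lborel borel flip)"
    unfolding lborel_distr_flip by (rule em[OF A])
  also have "\<dots> = (\<integral>\<^sup>+x. ennreal (weinstein_density \<alpha> (flip x)) * indicator A (flip x) \<partial>lborel)"
    by (rule nn_integral_distr) measurable
  also have "\<dots> = (\<integral>\<^sup>+x. ennreal (weinstein_density \<alpha> x) * indicator (flip -` A) x \<partial>lborel)"
    by (intro nn_integral_cong) (auto simp: weinstein_density_def split: split_indicator)
  also have "\<dots> = emeasure (weinstein_measure \<alpha>) (flip -` A)"
    using em[OF fA] unfolding fe by simp
  also have "\<dots> = emeasure (distr (weinstein_measure \<alpha>) (weinstein_measure \<alpha>) flip) A"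
    using emeasure_distr[OF flip_measurable_weinstein A] unfolding fe by simp
  finally show "emeasure (distr (weinstein_measure \<alpha>) (weinstein_measure \<alpha>) flip) A = emeasure (weinstein_measure \<alpha>) A" ..
qed simp

lemma AE_weinstein_flip:
  assumes "AE x in weinstein_measure \<alpha>. P x"
  shows "AE x in weinstein_measure \<alpha>. P (flip x)"
proof -
  have "AE x in distr (weinstein_measure \<alpha>) (weinstein_measure \<alpha>) flip. P x"
    unfolding distr_flip by (rule assms)
  then show ?thesis by (rule AE_distrD[OF flip_measurable_weinstein])
qed

lemma integral_flip:
  fixes f :: "('d::finite) pt \<Rightarrow> 'b::{banach, second_countable_topology}"
  assumes "f \<in> borel_measurable (weinstein_measure \<alpha>)"
  shows "(\<integral>x. f (flip x) \<partial>weinstein_measure \<alpha>) = integral\<^sup>L (weinstein_measure \<alpha>) f"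
  using integral_distr[OF flip_measurable_weinstein assms] unfolding distr_flip by simp

lemma integrable_flip:
  fixes f :: "('d::finite) pt \<Rightarrow> 'b::{banach, second_countable_topology}"
  assumes "integrable (weinstein_measure \<alpha>) f"
  shows "integrable (weinstein_measure \<alpha>) (\<lambda>x. f (flip x))"
  using integrable_distr_eq[OF flip_measurable_weinstein borel_measurable_integrable[OF assms]] assms
  unfolding distr_flip by simp

lemma measurable_flip_comp:
  "f \<in> borel_measurable (weinstein_measure \<alpha>) \<Longrightarrow> (\<lambda>x. f (flip x)) \<in> borel_measurable (weinstein_measure \<alpha>)"
  by (rule measurable_compose[OF flip_measurable_weinstein])

lemma l2_flip: "f \<in> l2 (weinstein_measure \<alpha>) \<Longrightarrow> (\<lambda>x. f (flip x)) \<in> l2 (weinstein_measure \<alpha>)"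
  unfolding l2_def using integrable_flip[of "\<lambda>x. (cmod (f x))\<^sup>2"] measurable_flip_comp by auto

lemma dilate_measurable:
  assumes "\<sigma> > 0" "m \<in> borel_measurable (weinstein_measure \<alpha>)"
  shows "dilate \<sigma> m \<in> borel_measurable (weinstein_measure \<alpha>)"
proof -
  have "(\<lambda>x. \<sigma> *\<^sub>R x) \<in> weinstein_measure \<alpha> \<rightarrow>\<^sub>M weinstein_measure \<alpha>"
    unfolding measurable_cong_sets[OF sets_weinstein sets_weinstein] using assms(1)
    by (intro measurable_restrict_space2 measurable_restrict_space1) (auto simp: space_restrict_space half_space_def)
  from measurable_compose[OF this assms(2)] show ?thesis
    by (simp add: dilate_def[abs_def])
qed

lemma AE_weinstein_scaleR:
  assumes "\<sigma> > 0" "AE x in weinstein_measure \<alpha>. P x"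
  shows "AE x in weinstein_measure \<alpha>. P (\<sigma> *\<^sub>R x)"
  using AE_lborel_scaleR[of \<sigma> "\<lambda>x. x \<in> half_space \<longrightarrow> P x"] assms
  by (auto simp: AE_weinstein_iff half_space_def)

end

section \<open>The Weinstein transform of integrable functions\<close>

lemma l2_bounded_integrable:
  assumes "integrable M f" "\<And>x. cmod (f x) \<le> C"
  shows "f \<in> l2 M"
proof (rule l2_dominated)
  show "integrable M (\<lambda>x. C * cmod (f x))"
    using assms(1) by simp
  have "(cmod (f x))\<^sup>2 \<le> C * cmod (f x)" for x
    unfolding power2_eq_square by (intro mult_right_mono assms) simp
  then show "AE x in M. (cmod (f x))\<^sup>2 \<le> C * cmod (f x)" by simp
qed (use assms in auto)

lemma weinstein_kernel_sym: "weinstein_kernel \<alpha> \<xi> x = weinstein_kernel \<alpha> x \<xi>"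
  by (simp add: weinstein_kernel_def inner_commute mult.commute)

lemma weinstein_kernel_flip: "weinstein_kernel \<alpha> (flip \<xi>) x = weinstein_kernel \<alpha> \<xi> (flip x)"
  by (simp add: weinstein_kernel_def)

text \<open>The Bessel factor is real, so conjugation acts on the phase alone.\<close>

lemma cnj_weinstein_kernel: "cnj (weinstein_kernel \<alpha> \<xi> x) = weinstein_kernel \<alpha> (flip \<xi>) x"
  by (simp add: weinstein_kernel_def exp_cnj)

context
  fixes \<alpha> :: real
  assumes \<alpha>: "\<alpha> > - 1 / 2"
begin

lemma norm_weinstein_kernel: "cmod (weinstein_kernel \<alpha> \<xi> x) \<le> 1"
  using bessel_j_abs_le_1[OF \<alpha>] by (simp add: weinstein_kernel_def norm_mult)

lemma measurable_weinstein_kernel [measurable (raw)]: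
  assumes "f \<in> borel_measurable M" "g \<in> borel_measurable M"
  shows "(\<lambda>z. weinstein_kernel \<alpha> (f z) (g z)) \<in> borel_measurable M"
  by (rule borel_measurable_continuous_Pair[OF assms])
     (unfold weinstein_kernel_def, intro continuous_intros continuous_on_bessel_j[OF \<alpha>])

lemma measurable_weinstein_id: "(\<lambda>x. x) \<in> borel_measurable (weinstein_measure \<alpha>)"
  by (rule measurable_weinsteinI) simp

lemma weinstein_integrand_integrable:
  assumes "integrable (weinstein_measure \<alpha>) f"
  shows "integrable (weinstein_measure \<alpha>) (\<lambda>x. f x * weinstein_kernel \<alpha> \<xi> x)"
proof (rule Bochner_Integration.integrable_bound[OF assms])
  have [measurable]: "f \<in> borel_measurable (weinstein_measure \<alpha>)" using assms by auto
  note measurable_weinstein_id [measurable]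
  show "(\<lambda>x. f x * weinstein_kernel \<alpha> \<xi> x) \<in> borel_measurable (weinstein_measure \<alpha>)"
    by measurable
  show "AE x in weinstein_measure \<alpha>. norm (f x * weinstein_kernel \<alpha> \<xi> x) \<le> norm (f x)"
    by (intro AE_I2) (simp add: norm_mult mult_left_le norm_weinstein_kernel)
qed

lemma weinstein_L1_measurable:
  assumes "integrable (weinstein_measure \<alpha>) f"
  shows "weinstein_L1 \<alpha> f \<in> borel_measurable (weinstein_measure \<alpha>)"
proof -
  interpret sigma_finite_measure "weinstein_measure \<alpha>" by (rule sigma_finite_weinstein[OF \<alpha>])
  have [measurable]: "f \<in> borel_measurable (weinstein_measure \<alpha>)" using assms by auto
  note measurable_weinstein_id [measurable]
  have [measurable]: "fst \<in> borel_measurable (weinstein_measure \<alpha> \<Otimes>\<^sub>M weinstein_measure \<alpha>)"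
      "snd \<in> borel_measurable (weinstein_measure \<alpha> \<Otimes>\<^sub>M weinstein_measure \<alpha>)"
    by (auto intro: measurable_compose[OF _ measurable_weinstein_id, simplified])
  show ?thesis
    unfolding weinstein_L1_def[abs_def]
    by (rule borel_measurable_lebesgue_integral) (simp add: split_beta')
qed

lemma weinstein_L1_bound:
  assumes "integrable (weinstein_measure \<alpha>) f"
  shows "cmod (weinstein_L1 \<alpha> f \<xi>) \<le> (\<integral>x. cmod (f x) \<partial>weinstein_measure \<alpha>)"
proof -
  have "cmod (weinstein_L1 \<alpha> f \<xi>) \<le> (\<integral>x. cmod (f x * weinstein_kernel \<alpha> \<xi> x) \<partial>weinstein_measure \<alpha>)"
    unfolding weinstein_L1_def by (rule integral_norm_bound)
  also have "\<dots> \<le> (\<integral>x. cmod (f x) \<partial>weinstein_measure \<alpha>)"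
    by (intro integral_mono integrable_norm weinstein_integrand_integrable assms)
       (simp add: norm_mult mult_left_le norm_weinstein_kernel)
  finally show ?thesis .
qed

lemma weinstein_L1_add:
  assumes "integrable (weinstein_measure \<alpha>) f" "integrable (weinstein_measure \<alpha>) g"
  shows "weinstein_L1 \<alpha> (\<lambda>x. f x + g x) \<xi> = weinstein_L1 \<alpha> f \<xi> + weinstein_L1 \<alpha> g \<xi>"
  unfolding weinstein_L1_def using weinstein_integrand_integrable[OF assms(1)] weinstein_integrand_integrable[OF assms(2)]
  by (simp add: distrib_right)

lemma weinstein_L1_cmult: "weinstein_L1 \<alpha> (\<lambda>x. c * f x) \<xi> = c * weinstein_L1 \<alpha> f \<xi>"
  unfolding weinstein_L1_def by (simp add: mult.assoc)

lemma weinstein_L1_flip: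
  assumes "f \<in> borel_measurable (weinstein_measure \<alpha>)"
  shows "weinstein_L1 \<alpha> (\<lambda>x. f (flip x)) \<xi> = weinstein_L1 \<alpha> f (flip \<xi>)"
proof -
  note [measurable] = assms measurable_weinstein_id
  have "weinstein_L1 \<alpha> f (flip \<xi>) = (\<integral>x. (\<lambda>x. f (flip x) * weinstein_kernel \<alpha> \<xi> x) (flip x) \<partial>weinstein_measure \<alpha>)"
    by (simp add: weinstein_L1_def weinstein_kernel_flip)
  also have "\<dots> = weinstein_L1 \<alpha> (\<lambda>x. f (flip x)) \<xi>"
    unfolding weinstein_L1_def
    by (rule integral_flip[OF \<alpha>]) (intro borel_measurable_times measurable_flip_comp[OF \<alpha>] assms, measurable)
  finally show ?thesis ..
qed

lemma weinstein_L1_cnj: "weinstein_L1 \<alpha> (\<lambda>x. cnj (f x)) \<xi> = cnj (weinstein_L1 \<alpha> f (flip \<xi>))"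
proof -
  have "cnj (weinstein_L1 \<alpha> f (flip \<xi>)) = (\<integral>x. cnj (f x * weinstein_kernel \<alpha> (flip \<xi>) x) \<partial>weinstein_measure \<alpha>)"
    unfolding weinstein_L1_def by (rule Bochner_Integration.integral_cnj[symmetric])
  then show ?thesis
    by (simp add: weinstein_L1_def cnj_weinstein_kernel)
qed

lemma weinstein_L1_cong_AE:
  assumes "f \<in> borel_measurable (weinstein_measure \<alpha>)" "g \<in> borel_measurable (weinstein_measure \<alpha>)"
    "AE x in weinstein_measure \<alpha>. f x = g x"
  shows "weinstein_L1 \<alpha> f \<xi> = weinstein_L1 \<alpha> g \<xi>"
proof -
  note [measurable] = assms(1,2) measurable_weinstein_id
  show ?thesis
    unfolding weinstein_L1_def by (rule integral_cong_AE) (measurable, use assms(3) in auto)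
qed

text \<open>The kernel is bounded by 1, so the double integral of f, kernel and g converges
  absolutely; Fubini and the symmetry of the kernel allow it to be read in either order.\<close>

lemma weinstein_L1_multiplication:
  assumes f: "integrable (weinstein_measure \<alpha>) f" and g: "integrable (weinstein_measure \<alpha>) g"
  shows "(\<integral>\<xi>. weinstein_L1 \<alpha> f \<xi> * g \<xi> \<partial>weinstein_measure \<alpha>) = (\<integral>x. f x * weinstein_L1 \<alpha> g x \<partial>weinstein_measure \<alpha>)"
proof -
  let ?W = "weinstein_measure \<alpha>"
  interpret W: sigma_finite_measure ?W by (rule sigma_finite_weinstein[OF \<alpha>])
  interpret pair_sigma_finite ?W ?W ..
  have [measurable]: "f \<in> borel_measurable ?W" "g \<in> borel_measurable ?W" using f g by auto
  have [measurable]: "fst \<in> borel_measurable (?W \<Otimes>\<^sub>M ?W)" "snd \<in> borel_measurable (?W \<Otimes>\<^sub>M ?W)"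
    by (auto intro: measurable_compose[OF _ measurable_weinstein_id, simplified])
  have prod: "integrable (?W \<Otimes>\<^sub>M ?W) (\<lambda>z. f (fst z) * g (snd z))"
  proof (rule Fubini_integrable)
    have "integrable ?W (\<lambda>x. norm (f x) * (\<integral>y. norm (g y) \<partial>?W))"
      by (intro integrable_mult_left integrable_norm f)
    then show "integrable ?W (\<lambda>x. \<integral>y. norm (f (fst (x, y)) * g (snd (x, y))) \<partial>?W)"
      by (simp add: norm_mult)
    show "AE x in ?W. integrable ?W (\<lambda>y. f (fst (x, y)) * g (snd (x, y)))"
      using g by simp
  qed measurable
  have int: "integrable (?W \<Otimes>\<^sub>M ?W) (\<lambda>(x, \<xi>). f x * weinstein_kernel \<alpha> \<xi> x * g \<xi>)"
  proof (rule Bochner_Integration.integrable_bound[OF prod])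
    show "(\<lambda>(x, \<xi>). f x * weinstein_kernel \<alpha> \<xi> x * g \<xi>) \<in> borel_measurable (?W \<Otimes>\<^sub>M ?W)"
      unfolding split_beta' by measurable
    have "cmod (f x * weinstein_kernel \<alpha> \<xi> x * g \<xi>) \<le> cmod (f x * g \<xi>)" for x \<xi>
    proof -
      have "cmod (f x * weinstein_kernel \<alpha> \<xi> x * g \<xi>) = cmod (f x * g \<xi>) * cmod (weinstein_kernel \<alpha> \<xi> x)"
        by (simp add: norm_mult)
      also have "\<dots> \<le> cmod (f x * g \<xi>)"
        by (intro mult_left_le norm_weinstein_kernel) simp
      finally show ?thesis .
    qed
    then show "AE z in ?W \<Otimes>\<^sub>M ?W. norm (case z of (x, \<xi>) \<Rightarrow> f x * weinstein_kernel \<alpha> \<xi> x * g \<xi>) \<le> norm (f (fst z) * g (snd z))"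
      by (simp add: split_beta)
  qed
  have "(\<integral>\<xi>. weinstein_L1 \<alpha> f \<xi> * g \<xi> \<partial>?W) = (\<integral>\<xi>. (\<integral>x. f x * weinstein_kernel \<alpha> \<xi> x * g \<xi> \<partial>?W) \<partial>?W)"
    by (simp add: weinstein_L1_def)
  also have "\<dots> = (\<integral>x. (\<integral>\<xi>. f x * weinstein_kernel \<alpha> \<xi> x * g \<xi> \<partial>?W) \<partial>?W)"
    by (rule Fubini_integral[OF int])
  also have "\<dots> = (\<integral>x. f x * weinstein_L1 \<alpha> g x \<partial>?W)"
    unfolding weinstein_L1_def integral_mult_right_zero[symmetric]
    by (intro Bochner_Integration.integral_cong refl) (simp add: weinstein_kernel_sym[of \<alpha>] mult_ac)
  finally show ?thesis .
qed

text \<open>This class is invariant under the transform, which is isometric on it by the multiplication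
  formula.\<close>

definition invertible_fun :: "(('d::finite) pt \<Rightarrow> complex) \<Rightarrow> bool" where
  "invertible_fun g \<longleftrightarrow> integrable (weinstein_measure \<alpha>) g \<and> g \<in> l2 (weinstein_measure \<alpha>) \<and>
     integrable (weinstein_measure \<alpha>) (weinstein_L1 \<alpha> g) \<and> weinstein_L1 \<alpha> g \<in> l2 (weinstein_measure \<alpha>) \<and>
     (AE x in weinstein_measure \<alpha>. weinstein_L1 \<alpha> (weinstein_L1 \<alpha> g) x = g (flip x))"

lemma invertible_fun_add:
  assumes "invertible_fun f" "invertible_fun g"
  shows "invertible_fun (\<lambda>x. f x + g x)"
proof -
  have "weinstein_L1 \<alpha> (\<lambda>x. f x + g x) = (\<lambda>\<xi>. weinstein_L1 \<alpha> f \<xi> + weinstein_L1 \<alpha> g \<xi>)"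
    using assms by (intro ext weinstein_L1_add) (auto simp: invertible_fun_def)
  moreover have "weinstein_L1 \<alpha> (\<lambda>\<xi>. weinstein_L1 \<alpha> f \<xi> + weinstein_L1 \<alpha> g \<xi>) =
      (\<lambda>x. weinstein_L1 \<alpha> (weinstein_L1 \<alpha> f) x + weinstein_L1 \<alpha> (weinstein_L1 \<alpha> g) x)"
    using assms by (intro ext weinstein_L1_add) (auto simp: invertible_fun_def)
  ultimately show ?thesis
    using assms unfolding invertible_fun_def by (auto intro!: l2_add)
qed

lemma invertible_fun_cmult:
  assumes "invertible_fun f"
  shows "invertible_fun (\<lambda>x. c * f x)"
  using assms unfolding invertible_fun_def weinstein_L1_cmult[abs_def] by (auto intro!: l2_cmult)

text \<open>Write F for \<open>weinstein_L1 \<alpha>\<close>. Since F F f agrees a.e. with the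
  reflection of f, F F F f is the reflection of F f; F is an integral, so a.e. equal arguments give
  the same values everywhere.\<close>

lemma invertible_fun_L1:
  assumes "invertible_fun f"
  shows "invertible_fun (weinstein_L1 \<alpha> f)"
proof -
  let ?W = "weinstein_measure \<alpha>"
  have m: "f \<in> borel_measurable ?W" "weinstein_L1 \<alpha> f \<in> borel_measurable ?W"
    "weinstein_L1 \<alpha> (weinstein_L1 \<alpha> f) \<in> borel_measurable ?W"
    using assms by (auto simp: invertible_fun_def intro: weinstein_L1_measurable)
  have ae: "AE x in ?W. f (flip x) = weinstein_L1 \<alpha> (weinstein_L1 \<alpha> f) x"
    using assms by (auto simp: invertible_fun_def elim: AE_mp)
  have "weinstein_L1 \<alpha> (weinstein_L1 \<alpha> (weinstein_L1 \<alpha> f)) x = weinstein_L1 \<alpha> f (flip x)" for x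
    using weinstein_L1_cong_AE[OF measurable_flip_comp[OF \<alpha> m(1)] m(3) ae] weinstein_L1_flip[OF m(1)] by simp
  moreover have "integrable ?W (weinstein_L1 \<alpha> (weinstein_L1 \<alpha> f))"
    using assms integrable_cong_AE[OF measurable_flip_comp[OF \<alpha> m(1)] m(3) ae]
    by (auto simp: invertible_fun_def intro: integrable_flip[OF \<alpha>])
  moreover have "weinstein_L1 \<alpha> (weinstein_L1 \<alpha> f) \<in> l2 ?W"
    using assms by (intro l2_cong_AE[OF l2_flip[OF \<alpha>] m(3) ae]) (auto simp: invertible_fun_def)
  ultimately show ?thesis
    using assms by (auto simp: invertible_fun_def)
qed

lemma invertible_fun_flip:
  assumes "invertible_fun f"
  shows "invertible_fun (\<lambda>x. f (flip x))"
proof -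
  let ?W = "weinstein_measure \<alpha>"
  have m: "f \<in> borel_measurable ?W" "weinstein_L1 \<alpha> f \<in> borel_measurable ?W"
    using assms by (auto simp: invertible_fun_def intro: weinstein_L1_measurable)
  have 1: "weinstein_L1 \<alpha> (\<lambda>x. f (flip x)) = (\<lambda>\<xi>. weinstein_L1 \<alpha> f (flip \<xi>))"
    by (intro ext weinstein_L1_flip m)
  have 2: "weinstein_L1 \<alpha> (\<lambda>\<xi>. weinstein_L1 \<alpha> f (flip \<xi>)) = (\<lambda>x. weinstein_L1 \<alpha> (weinstein_L1 \<alpha> f) (flip x))"
    by (intro ext weinstein_L1_flip m)
  show ?thesis
    using assms AE_weinstein_flip[OF \<alpha>, of "\<lambda>x. weinstein_L1 \<alpha> (weinstein_L1 \<alpha> f) x = f (flip x)"]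
    unfolding invertible_fun_def 1 2 by (auto intro!: l2_flip[OF \<alpha>] integrable_flip[OF \<alpha>])
qed

lemma invertible_fun_cnj:
  assumes "invertible_fun f"
  shows "invertible_fun (\<lambda>x. cnj (f x))"
proof -
  let ?W = "weinstein_measure \<alpha>"
  have m: "weinstein_L1 \<alpha> f \<in> borel_measurable ?W"
    using assms by (auto simp: invertible_fun_def)
  have 1: "weinstein_L1 \<alpha> (\<lambda>x. cnj (f x)) = (\<lambda>\<xi>. cnj (weinstein_L1 \<alpha> f (flip \<xi>)))"
    by (intro ext weinstein_L1_cnj)
  \<comment> \<open>The reflection created by moving the conjugation outside meets the one already
    present, and the two cancel.\<close>
  have 2: "weinstein_L1 \<alpha> (\<lambda>\<xi>. cnj (weinstein_L1 \<alpha> f (flip \<xi>))) = (\<lambda>x. cnj (weinstein_L1 \<alpha> (weinstein_L1 \<alpha> f) x))"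
    by (simp add: weinstein_L1_cnj weinstein_L1_flip[OF m] fun_eq_iff)
  show ?thesis
    using assms unfolding invertible_fun_def 1 2
    by (auto intro!: l2_cnj l2_flip[OF \<alpha>] integrable_flip[OF \<alpha>])
qed

text \<open>Let g be the conjugate of the reflected f. Then F g is the conjugate of F f, and F F g
  is the conjugate of f, so the multiplication formula for f and F g reads as equality of the
  squared norms.\<close>

lemma invertible_fun_isometry:
  assumes f: "invertible_fun f"
  shows "l2norm (weinstein_measure \<alpha>) (weinstein_L1 \<alpha> f) = l2norm (weinstein_measure \<alpha>) f"
proof -
  let ?W = "weinstein_measure \<alpha>"
  define g where "g x = cnj (f (flip x))" for x
  have g: "invertible_fun g"
    unfolding g_def[abs_def] by (intro invertible_fun_cnj invertible_fun_flip f)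
  have gF: "weinstein_L1 \<alpha> g = (\<lambda>\<xi>. cnj (weinstein_L1 \<alpha> f \<xi>))"
    unfolding g_def using f
    by (simp add: weinstein_L1_cnj weinstein_L1_flip fun_eq_iff invertible_fun_def borel_measurable_integrable)
  have sq: "complex_of_real (\<integral>x. (cmod (u x))\<^sup>2 \<partial>?W) = (\<integral>x. u x * cnj (u x) \<partial>?W)" for u :: "'a pt \<Rightarrow> complex"
    by (simp add: complex_norm_square[symmetric] del: of_real_power)
  have "(\<integral>x. weinstein_L1 \<alpha> f x * weinstein_L1 \<alpha> g x \<partial>?W) = (\<integral>x. f x * weinstein_L1 \<alpha> (weinstein_L1 \<alpha> g) x \<partial>?W)"
    using f g by (intro weinstein_L1_multiplication) (auto simp: invertible_fun_def)
  also have "\<dots> = (\<integral>x. f x * cnj (f x) \<partial>?W)"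
  proof (rule integral_cong_AE)
    show "AE x in ?W. f x * weinstein_L1 \<alpha> (weinstein_L1 \<alpha> g) x = f x * cnj (f x)"
      using g by (auto simp: invertible_fun_def g_def elim: AE_mp)
    show "(\<lambda>x. f x * weinstein_L1 \<alpha> (weinstein_L1 \<alpha> g) x) \<in> borel_measurable ?W"
      using f g by (auto simp: invertible_fun_def intro!: borel_measurable_times weinstein_L1_measurable)
    show "(\<lambda>x. f x * cnj (f x)) \<in> borel_measurable ?W"
      using f invertible_fun_cnj[OF f]
      by (intro borel_measurable_times) (auto simp: invertible_fun_def borel_measurable_integrable)
  qed
  finally show ?thesis
    unfolding gF sq[symmetric] l2norm_def by simp
qed

section \<open>Explicit transforms of Gaussians\<close>

text \<open>A and its normalised Fourier transform B stay abstract because the formula serves once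
  for a modulated and once for a translated Gaussian. The constant is Gamma (\<alpha> + 1) / (2
  r^(\<alpha> + 1)) divided by 2^\<alpha> Gamma (\<alpha> + 1).\<close>

lemma weinstein_L1_gaussian_product:
  fixes A :: "real ^ 'd::finite \<Rightarrow> complex"
  assumes A: "\<And>\<xi>. integrable lborel (\<lambda>x. A x * iexp (- (x \<bullet> \<xi>)))"
    and B: "\<And>\<xi>. (\<integral>x. A x * iexp (- (x \<bullet> \<xi>)) \<partial>lborel) = complex_of_real ((2 * pi) powr (real CARD('d) / 2)) * B \<xi>"
    and r: "r > 0"
  shows "integrable (weinstein_measure \<alpha>) (\<lambda>x. A (fst x) * complex_of_real (exp (- r * (snd x)\<^sup>2)))"
    and "weinstein_L1 \<alpha> (\<lambda>x. A (fst x) * complex_of_real (exp (- r * (snd x)\<^sup>2))) \<xi> =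
      complex_of_real ((2 * r) powr (- (\<alpha> + 1))) * (B (fst \<xi>) * complex_of_real (exp (- (1 / (4 * r)) * (snd \<xi>)\<^sup>2)))"
proof -
  have "set_integrable lborel {0<..} (\<lambda>t. t powr (2 * \<alpha> + 1) * exp (- r * t\<^sup>2))"
    using \<alpha> r by (intro gaussian_moment) auto
  \<comment> \<open>At frequency 0 the assumption says that A itself is integrable.\<close>
  then show "integrable (weinstein_measure \<alpha>) (\<lambda>x. A (fst x) * complex_of_real (exp (- r * (snd x)\<^sup>2)))"
    using A[of 0] by (intro integrable_weinstein_product[OF \<alpha>]) auto
  have "(\<lambda>t. bessel_j \<alpha> (t * snd \<xi>)) \<in> borel_measurable borel"
    by (intro borel_measurable_continuous_onI continuous_on_bessel_j[OF \<alpha>] continuous_intros)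
  then have m: "(\<lambda>t. exp (- r * t\<^sup>2) * bessel_j \<alpha> (t * snd \<xi>)) \<in> borel_measurable borel"
    by measurable
  have "weinstein_L1 \<alpha> (\<lambda>x. A (fst x) * complex_of_real (exp (- r * (snd x)\<^sup>2))) \<xi> =
     (\<integral>x. (\<lambda>x. A x * iexp (- (x \<bullet> fst \<xi>))) (fst x) * complex_of_real (exp (- r * (snd x)\<^sup>2) * bessel_j \<alpha> (snd x * snd \<xi>))
       \<partial>weinstein_measure \<alpha>)"
    unfolding weinstein_L1_def weinstein_kernel_def
    by (intro Bochner_Integration.integral_cong refl) (simp add: mult_ac)
  also have "\<dots> = complex_of_real ((2 * pi) powr (real CARD('d) / 2)) * B (fst \<xi>) *
      complex_of_real (Gamma (\<alpha> + 1) / (2 * r powr (\<alpha> + 1)) * exp (- (snd \<xi>)\<^sup>2 / (4 * r))) /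
      complex_of_real ((2 * pi) powr (real CARD('d) / 2) * 2 powr \<alpha> * Gamma (\<alpha> + 1))"
    by (subst integral_weinstein_product[OF \<alpha> A hankel_gaussian(1)[OF \<alpha> r] m])
       (simp only: B hankel_gaussian(2)[OF \<alpha> r])
  also have "\<dots> = complex_of_real ((2 * r) powr (- (\<alpha> + 1))) * (B (fst \<xi>) * complex_of_real (exp (- (1 / (4 * r)) * (snd \<xi>)\<^sup>2)))"
  proof -
    have "Gamma (\<alpha> + 1) > 0" using \<alpha> by (intro Gamma_real_pos) simp
    moreover have "(2 * r) powr (- (\<alpha> + 1)) = 1 / (2 * 2 powr \<alpha> * r powr (\<alpha> + 1))"
      using r by (simp only: powr_minus_divide powr_mult powr_add) simp
    ultimately show ?thesis by simp
  qed
  finally show "weinstein_L1 \<alpha> (\<lambda>x. A (fst x) * complex_of_real (exp (- r * (snd x)\<^sup>2))) \<xi> = \<dots>" .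
qed

text \<open>The transform turns modulation by b into translation by b, and r into 1 / (4 r); a
  second transform turns the translation into modulation by -b and restores r, while the two
  constants multiply to 1. The net effect is a change of sign of b, that is, a reflection of
  x'.\<close>

lemma invertible_fun_gaussian:
  fixes b :: "real ^ 'd::finite"
  assumes r: "r > 0"
  shows "invertible_fun (\<lambda>x. (complex_of_real (exp (- (norm (fst x))\<^sup>2 / 2)) * iexp (fst x \<bullet> b)) *
    complex_of_real (exp (- r * (snd x)\<^sup>2)))"
proof -
  define A where "A x = complex_of_real (exp (- (norm x)\<^sup>2 / 2)) * iexp (x \<bullet> b)" for x :: "real ^ 'd"
  define A' where "A' x = complex_of_real (exp (- (norm (x - b))\<^sup>2 / 2))" for x :: "real ^ 'd"
  define B where "B x = complex_of_real (exp (- (norm x)\<^sup>2 / 2)) * iexp (- (x \<bullet> b))" for x :: "real ^ 'd"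
  define c where "c = complex_of_real ((2 * r) powr (- (\<alpha> + 1)))"
  have A_mult: "A x * iexp (- (x \<bullet> \<xi>)) = complex_of_real (exp (- (norm x)\<^sup>2 / 2)) * iexp (x \<bullet> (b - \<xi>))" for x \<xi>
    by (simp add: A_def mult.assoc exp_add[symmetric] algebra_simps inner_diff_right)
  have A: "integrable lborel (\<lambda>x. A x * iexp (- (x \<bullet> \<xi>)))"
     "(\<integral>x. A x * iexp (- (x \<bullet> \<xi>)) \<partial>lborel) = complex_of_real ((2 * pi) powr (real CARD('d) / 2)) * A' \<xi>" for \<xi>
    unfolding A_mult using gaussian_fourier[of "b - \<xi>"] by (simp_all add: A'_def norm_minus_commute)
  have A'_shift: "A' (b + x) * iexp (- ((b + x) \<bullet> \<xi>)) = iexp (- (b \<bullet> \<xi>)) * (complex_of_real (exp (- (norm x)\<^sup>2 / 2)) * iexp (x \<bullet> (- \<xi>)))" for x \<xi>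
    by (simp add: A'_def exp_add[symmetric] inner_add_left algebra_simps)
  have A': "integrable lborel (\<lambda>x. A' x * iexp (- (x \<bullet> \<xi>)))"
     "(\<integral>x. A' x * iexp (- (x \<bullet> \<xi>)) \<partial>lborel) = complex_of_real ((2 * pi) powr (real CARD('d) / 2)) * B \<xi>" for \<xi>
  proof -
    have [measurable]: "(\<lambda>x. A' x * iexp (- (x \<bullet> \<xi>))) \<in> borel_measurable borel"
      unfolding A'_def by measurable
    have "integrable (distr lborel borel ((+) b)) (\<lambda>x. A' x * iexp (- (x \<bullet> \<xi>)))"
      by (subst integrable_distr_eq) (auto simp only: A'_shift intro!: integrable_mult_right gaussian_fourier, measurable)
    then show "integrable lborel (\<lambda>x. A' x * iexp (- (x \<bullet> \<xi>)))"
      by (simp only: lborel_distr_plus)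
    have "(\<integral>x. A' x * iexp (- (x \<bullet> \<xi>)) \<partial>(distr lborel borel ((+) b))) =
        (\<integral>x. A' (b + x) * iexp (- ((b + x) \<bullet> \<xi>)) \<partial>lborel)"
      by (rule integral_distr) measurable
    also have "\<dots> = complex_of_real ((2 * pi) powr (real CARD('d) / 2)) * B \<xi>"
      unfolding A'_shift integral_mult_right_zero gaussian_fourier(2)
      by (simp add: B_def inner_commute)
    finally show "(\<integral>x. A' x * iexp (- (x \<bullet> \<xi>)) \<partial>lborel) = complex_of_real ((2 * pi) powr (real CARD('d) / 2)) * B \<xi>"
      by (simp only: lborel_distr_plus)
  qed
  define f where "f x = A (fst x) * complex_of_real (exp (- r * (snd x)\<^sup>2))" for x
  define g where "g x = A' (fst x) * complex_of_real (exp (- (1 / (4 * r)) * (snd x)\<^sup>2))" for x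
  have r': "1 / (4 * r) > 0" using r by simp
  have Ff: "weinstein_L1 \<alpha> f = (\<lambda>\<xi>. c * g \<xi>)"
    unfolding f_def[abs_def] g_def c_def by (intro ext weinstein_L1_gaussian_product A r)
  have Fg: "c * weinstein_L1 \<alpha> g x = f (flip x)" for x
  proof -
    have "(2 * r) powr (- (\<alpha> + 1)) * (2 * (1 / (4 * r))) powr (- (\<alpha> + 1)) = 1"
      using r by (simp flip: powr_mult)
    then have "c * complex_of_real ((2 * (1 / (4 * r))) powr (- (\<alpha> + 1))) = 1"
      unfolding c_def of_real_mult[symmetric] by simp
    moreover have "weinstein_L1 \<alpha> g x = complex_of_real ((2 * (1 / (4 * r))) powr (- (\<alpha> + 1))) *
        (B (fst x) * complex_of_real (exp (- (1 / (4 * (1 / (4 * r)))) * (snd x)\<^sup>2)))"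
      unfolding g_def[abs_def] by (intro weinstein_L1_gaussian_product A' r')
    moreover have "B (fst x) = A (fst (flip x))"
      by (simp add: A_def B_def)
    ultimately show ?thesis
      using r by (simp add: f_def mult.assoc[symmetric])
  qed
  have int: "integrable (weinstein_measure \<alpha>) f" "integrable (weinstein_measure \<alpha>) g"
    unfolding f_def[abs_def] g_def[abs_def]
    by (rule weinstein_L1_gaussian_product(1)[OF A r] weinstein_L1_gaussian_product(1)[OF A' r'])+
  have bd: "cmod (f x) \<le> 1" "cmod (g x) \<le> 1" for x
    using r by (auto simp: f_def g_def A_def A'_def norm_mult intro!: mult_le_one)
  have "invertible_fun f"
    unfolding invertible_fun_def Ff weinstein_L1_cmult[abs_def] Fg
    using int by (auto intro!: l2_cmult l2_bounded_integrable bd)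
  then show ?thesis
    by (simp add: f_def[abs_def] A_def)
qed

end

section \<open>Density and separation\<close>

inductive_set exp_span :: "(('d::finite) pt \<Rightarrow> complex) set" where
  base: "r \<ge> 0 \<Longrightarrow> (\<lambda>x. iexp (fst x \<bullet> b) * complex_of_real (exp (- r * (snd x)\<^sup>2))) \<in> exp_span"
| add: "f \<in> exp_span \<Longrightarrow> g \<in> exp_span \<Longrightarrow> (\<lambda>x. f x + g x) \<in> exp_span"
| cmult: "f \<in> exp_span \<Longrightarrow> (\<lambda>x. c * f x) \<in> exp_span"

lemma exp_span_const: "(\<lambda>x. c) \<in> exp_span"
  using exp_span.cmult[OF exp_span.base[of 0 0], of c] by simp

lemma exp_span_mult_base:
  assumes r: "r \<ge> 0" and g: "g \<in> exp_span"
  shows "(\<lambda>x. (iexp (fst x \<bullet> b) * complex_of_real (exp (- r * (snd x)\<^sup>2))) * g x) \<in> exp_span"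
  using g
proof induction
  case (base s c)
  have "(\<lambda>x. (iexp (fst x \<bullet> b) * complex_of_real (exp (- r * (snd x)\<^sup>2))) *
      (iexp (fst x \<bullet> c) * complex_of_real (exp (- s * (snd x)\<^sup>2)))) =
      (\<lambda>x. iexp (fst x \<bullet> (b + c)) * complex_of_real (exp (- (r + s) * (snd x)\<^sup>2)))"
  proof
    fix x :: "'a pt"
    have "exp (- (r + s) * (snd x)\<^sup>2) = exp (- r * (snd x)\<^sup>2) * exp (- s * (snd x)\<^sup>2)"
      by (simp add: exp_add[symmetric] algebra_simps)
    moreover have "iexp (fst x \<bullet> (b + c)) = iexp (fst x \<bullet> b) * iexp (fst x \<bullet> c)"
      by (simp add: exp_add inner_add_right distrib_left)
    ultimately show "(iexp (fst x \<bullet> b) * complex_of_real (exp (- r * (snd x)\<^sup>2))) *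
      (iexp (fst x \<bullet> c) * complex_of_real (exp (- s * (snd x)\<^sup>2))) =
      iexp (fst x \<bullet> (b + c)) * complex_of_real (exp (- (r + s) * (snd x)\<^sup>2))"
      by (simp only: of_real_mult mult_ac)
  qed
  then show ?case
    using exp_span.base[of "r + s" "b + c"] r base by simp
next
  case (add f g)
  then show ?case using exp_span.add by (simp only: distrib_left)
next
  case (cmult f c)
  then show ?case using exp_span.cmult[OF cmult.IH, of c] by (simp only: mult.left_commute)
qed

lemma exp_span_mult:
  assumes "f \<in> exp_span" "g \<in> exp_span"
  shows "(\<lambda>x. f x * g x) \<in> exp_span"
  using assms(1)
proof induction
  case (base r b)
  then show ?case by (rule exp_span_mult_base[OF _ assms(2)])
next
  case (add f g)
  then show ?case using exp_span.add by (simp only: distrib_right)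
next
  case (cmult f c)
  then show ?case using exp_span.cmult[OF cmult.IH, of c] by (simp only: mult.assoc)
qed

lemma exp_span_sum:
  assumes "finite I" "\<And>i. i \<in> I \<Longrightarrow> f i \<in> exp_span"
  shows "(\<lambda>x. \<Sum>i\<in>I. f i x) \<in> exp_span"
  using assms by induction (auto intro: exp_span_const exp_span.add)

lemma exp_span_continuous: "f \<in> exp_span \<Longrightarrow> continuous_on UNIV f"
  by (induction rule: exp_span.induct) (auto intro!: continuous_intros)

lemma exp_span_bounded: "f \<in> exp_span \<Longrightarrow> \<exists>C. \<forall>x. cmod (f x) \<le> C"
proof (induction rule: exp_span.induct)
  case (base r b)
  then show ?case by (intro exI[of _ 1]) (simp add: norm_mult)
next
  case (add f g)
  then obtain C D where "\<forall>x. cmod (f x) \<le> C" "\<forall>x. cmod (g x) \<le> D" by blast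
  then show ?case
    by (intro exI[of _ "C + D"]) (meson add_mono norm_triangle_le)
next
  case (cmult f c)
  then obtain C where "\<forall>x. cmod (f x) \<le> C" by blast
  then show ?case
    by (intro exI[of _ "cmod c * C"]) (simp add: norm_mult mult_left_mono)
qed

text \<open>Bounded coordinates in the span that converge to \<open>(x', x\<^bsub>d+1\<^esub>\<^sup>2)\<close> as \<open>n\<close> tends to infinity.\<close>

definition trig_coord :: "nat \<Rightarrow> ('d::finite) pt \<Rightarrow> 'd pt" where
  "trig_coord n x = (\<chi> i. real (Suc n) * sin (fst x $ i / real (Suc n)),
     real (Suc n) * (1 - exp (- (snd x)\<^sup>2 / real (Suc n))))"

text \<open>Up to scalar factors, Euler's formula writes the sine as a difference of two phases with
  r = 0, and the last coordinate is a constant minus one exponential with r = 1 / (n + 1).\<close>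

lemma trig_coord_component:
  fixes b :: "('d::finite) pt"
  assumes "b \<in> Basis"
  shows "(\<lambda>x. complex_of_real (trig_coord n x \<bullet> b)) \<in> exp_span"
proof -
  consider i where "b = (axis i 1, 0)" | "b = (0, 1)"
    using assms by (auto simp: Basis_prod_def Basis_vec_def)
  then show ?thesis
  proof cases
    case 1
    define e :: "real ^ 'd" where "e = axis i (1 / real (Suc n))"
    have e: "x \<bullet> e = x $ i / real (Suc n)" for x
      by (simp add: e_def inner_axis)
    have "(\<lambda>x. complex_of_real (trig_coord n x \<bullet> b)) =
      (\<lambda>x. (of_nat (Suc n) / (2 * \<i>)) * (iexp (fst x \<bullet> e) * complex_of_real (exp (- 0 * (snd x)\<^sup>2))) +
           (- of_nat (Suc n) / (2 * \<i>)) * (iexp (fst x \<bullet> (- e)) * complex_of_real (exp (- 0 * (snd x)\<^sup>2))))"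
      unfolding fun_eq_iff 1 trig_coord_def e inner_minus_right
      by (simp add: inner_axis sin_of_real[symmetric] sin_exp_eq diff_divide_distrib right_diff_distrib mult_ac del: of_nat_Suc)
    then show ?thesis
      by (simp only:) (intro exp_span.add exp_span.cmult exp_span.base order_refl)
  next
    case 2
    have "(\<lambda>x. complex_of_real (trig_coord n x \<bullet> b)) =
      (\<lambda>x. real (Suc n) + (- real (Suc n)) * (iexp (fst x \<bullet> 0) * complex_of_real (exp (- (1 / real (Suc n)) * (snd x)\<^sup>2))))"
      unfolding fun_eq_iff 2 trig_coord_def by (simp add: right_diff_distrib del: of_nat_Suc)
    then show ?thesis
      by (simp only:) (intro exp_span.add exp_span.cmult exp_span.base exp_span_const, simp)
  qed
qed

text \<open>Polynomials arise from linear functionals by sums and products, linear functionals are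
  combinations of coordinates, and the span is an algebra.\<close>

lemma exp_span_polynomial:
  fixes p :: "('d::finite) pt \<Rightarrow> real"
  assumes "real_polynomial_function p"
  shows "(\<lambda>x. complex_of_real (p (trig_coord n x))) \<in> exp_span"
  using assms
proof induction
  case (linear f)
  interpret bounded_linear f by fact
  have f: "f y = (\<Sum>b\<in>Basis. (y \<bullet> b) * f b)" for y
  proof -
    have "f y = f (\<Sum>b\<in>Basis. (y \<bullet> b) *\<^sub>R b)" by (simp add: euclidean_representation)
    also have "\<dots> = (\<Sum>b\<in>Basis. (y \<bullet> b) * f b)" by (simp add: sum scaleR)
    finally show ?thesis .
  qed
  have "complex_of_real (f y) = (\<Sum>b\<in>Basis. complex_of_real (f b) * complex_of_real (y \<bullet> b))" for y
    by (subst f) (simp add: mult.commute)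
  then have "(\<lambda>x. complex_of_real (f (trig_coord n x))) =
      (\<lambda>x. \<Sum>b\<in>Basis. complex_of_real (f b) * complex_of_real (trig_coord n x \<bullet> b))"
    by (intro ext)
  then show ?case
    by (simp only:) (intro exp_span_sum exp_span.cmult trig_coord_component finite_Basis)
next
  case (const c)
  then show ?case by (rule exp_span_const)
next
  case (add f g)
  then show ?case by (simp add: exp_span.add)
next
  case (mult f g)
  then show ?case by (simp add: exp_span_mult)
qed

text \<open>Boundedness makes the closure of the range compact; for each fixed n this is the set on
  which Stone-Weierstrass is applied.\<close>

lemma bounded_trig_coord: "bounded (range (trig_coord n))"
proof -
  have "norm (trig_coord n (x :: 'a pt)) \<le> real CARD('a) * real (Suc n) + real (Suc n)" for x
  proof -
    have "norm (fst (trig_coord n x)) \<le> (\<Sum>i\<in>UNIV. \<bar>fst (trig_coord n x) $ i\<bar>)"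
      by (rule norm_le_l1_cart)
    also have "\<dots> \<le> (\<Sum>i\<in>(UNIV :: 'a set). real (Suc n))"
      by (intro sum_mono) (simp add: trig_coord_def abs_mult mult_left_le del: of_nat_Suc)
    also have "\<dots> = real CARD('a) * real (Suc n)" by simp
    finally have 1: "norm (fst (trig_coord n x)) \<le> real CARD('a) * real (Suc n)" .
    have "exp (- (snd x)\<^sup>2 / real (Suc n)) \<le> 1" by simp
    moreover have "exp (- (snd x)\<^sup>2 / real (Suc n)) > 0" by simp
    ultimately have "\<bar>1 - exp (- (snd x)\<^sup>2 / real (Suc n))\<bar> \<le> 1" by linarith
    then have 2: "norm (snd (trig_coord n x)) \<le> real (Suc n)"
      by (simp add: trig_coord_def abs_mult mult_left_le del: of_nat_Suc)
    have "norm (trig_coord n x) \<le> norm (fst (trig_coord n x)) + norm (snd (trig_coord n x))"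
      using norm_Pair_le[of "fst (trig_coord n x)" "snd (trig_coord n x)"] by simp
    with 1 2 show ?thesis by linarith
  qed
  then show ?thesis by (auto simp: bounded_iff)
qed

lemma DERIV_0_LIMSEQ:
  fixes f :: "real \<Rightarrow> real"
  assumes "(f has_field_derivative D) (at 0)" "f 0 = 0"
  shows "(\<lambda>n. real (Suc n) * f (1 / real (Suc n))) \<longlonglongrightarrow> D"
proof -
  have "((\<lambda>h. f h / h) \<longlongrightarrow> D) (at 0)"
    using assms by (simp add: DERIV_def)
  moreover have "filterlim (\<lambda>n. inverse (real (Suc n))) (at 0) sequentially"
    unfolding filterlim_at using LIMSEQ_inverse_real_of_nat by (auto simp del: of_nat_Suc)
  ultimately have "(\<lambda>n. f (inverse (real (Suc n))) / inverse (real (Suc n))) \<longlonglongrightarrow> D"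
    by (rule filterlim_compose)
  then show ?thesis by (simp add: divide_inverse mult.commute del: of_nat_Suc)
qed

text \<open>The coordinates are difference quotients at 0 with step h = 1 / (n + 1), of sin (x_i h)
  and of 1 - exp (- t^2 h).\<close>

lemma trig_coord_tendsto: "(\<lambda>n. trig_coord n x) \<longlonglongrightarrow> (fst x, (snd x)\<^sup>2)"
  unfolding trig_coord_def
proof (intro tendsto_Pair vec_tendstoI)
  fix i
  have "((\<lambda>h. sin (fst x $ i * h)) has_field_derivative fst x $ i) (at 0)"
    by (auto intro!: derivative_eq_intros)
  from DERIV_0_LIMSEQ[OF this]
  show "(\<lambda>n. (\<chi> i. real (Suc n) * sin (fst x $ i / real (Suc n))) $ i) \<longlonglongrightarrow> fst x $ i"
    by simp
next
  have "((\<lambda>h. 1 - exp (- (snd x)\<^sup>2 * h)) has_field_derivative (snd x)\<^sup>2) (at 0)"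
    by (auto intro!: derivative_eq_intros)
  from DERIV_0_LIMSEQ[OF this]
  show "(\<lambda>n. real (Suc n) * (1 - exp (- (snd x)\<^sup>2 / real (Suc n)))) \<longlonglongrightarrow> (snd x)\<^sup>2"
    by simp
qed

section \<open>Weighted density of the span in L^2\<close>

context
  fixes \<alpha> :: real and w :: "('d::finite) pt \<Rightarrow> real"
  assumes \<alpha>: "\<alpha> > - 1 / 2"
    and w_measurable: "w \<in> borel_measurable (weinstein_measure \<alpha>)"
    and w_integrable: "integrable (weinstein_measure \<alpha>) (\<lambda>x. (w x)\<^sup>2)"
    and w_pos: "\<And>x. 0 < w x"
begin

text \<open>The closure of the weighted span in L^2. The weight w is a parameter because a fixed
  Gaussian is used once in full, for density, and once as its square root, for separation.\<close>

definition approximable :: "('d pt \<Rightarrow> complex) \<Rightarrow> bool" where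
  "approximable f \<longleftrightarrow> f \<in> l2 (weinstein_measure \<alpha>) \<and>
     (\<forall>e>0. \<exists>q\<in>exp_span. l2norm (weinstein_measure \<alpha>) (\<lambda>x. f x - complex_of_real (w x) * q x) < e)"

lemma weight_l2: "(\<lambda>x. complex_of_real (w x)) \<in> l2 (weinstein_measure \<alpha>)"
  using w_measurable w_integrable by (simp add: l2_def)

lemma weight_mult_l2:
  assumes "g \<in> borel_measurable (weinstein_measure \<alpha>)" "\<And>x. cmod (g x) \<le> C"
  shows "(\<lambda>x. complex_of_real (w x) * g x) \<in> l2 (weinstein_measure \<alpha>)"
  using w_measurable assms
  by (intro l2_mono[OF _ weight_l2, of _ C] AE_I2)
     (auto simp: norm_mult mult.commute[of C] intro!: mult_left_mono)

lemma weight_exp_span_l2: "q \<in> exp_span \<Longrightarrow> (\<lambda>x. complex_of_real (w x) * q x) \<in> l2 (weinstein_measure \<alpha>)"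
  using exp_span_bounded[of q]
  by (auto intro!: weight_mult_l2 measurable_weinsteinI borel_measurable_continuous_onI exp_span_continuous)

lemma approximable_limit:
  assumes u: "\<And>n. approximable (u n)" and f: "f \<in> l2 (weinstein_measure \<alpha>)"
    and lim: "(\<lambda>n. l2norm (weinstein_measure \<alpha>) (\<lambda>x. u n x - f x)) \<longlonglongrightarrow> 0"
  shows "approximable f"
  unfolding approximable_def
proof (intro conjI f allI impI)
  fix e :: real assume e: "e > 0"
  then obtain n where n: "l2norm (weinstein_measure \<alpha>) (\<lambda>x. u n x - f x) < e / 2"
    using order_tendstoD(2)[OF lim, of "e / 2"] by (auto simp: eventually_sequentially)
  obtain q where q: "q \<in> exp_span" "l2norm (weinstein_measure \<alpha>) (\<lambda>x. u n x - complex_of_real (w x) * q x) < e / 2"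
    using u[of n] e by (auto simp: approximable_def dest: spec[of _ "e / 2"])
  have "l2norm (weinstein_measure \<alpha>) (\<lambda>x. f x - complex_of_real (w x) * q x) < e"
    using l2norm_triangle_diff[OF f _ weight_exp_span_l2[OF q(1)], of "u n"] u[of n] n q(2)
    by (simp add: approximable_def l2norm_minus_commute[of _ f])
  with q(1) show "\<exists>q\<in>exp_span. l2norm (weinstein_measure \<alpha>) (\<lambda>x. f x - complex_of_real (w x) * q x) < e" by blast
qed

text \<open>For fixed n, a continuous function of \<open>trig_coord n x\<close> is uniformly close
  to a polynomial in these coordinates, since they stay in a compact set; the weight converts the
  uniform error into an L^2 error. Letting n grow recovers g by dominated convergence with majorant
  K w.\<close>

lemma approximable_continuous:
  fixes g :: "'d pt \<Rightarrow> complex"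
  assumes g: "continuous_on UNIV g" and bd: "\<And>x. cmod (g x) \<le> K"
  shows "approximable (\<lambda>x. complex_of_real (w x) * g x)"
proof (rule approximable_limit)
  \<comment> \<open>On the half-space \<rho> undoes the squaring of the last coordinate; the
    absolute value makes it continuous everywhere.\<close>
  define \<rho> :: "'d pt \<Rightarrow> 'd pt" where "\<rho> y = (fst y, sqrt \<bar>snd y\<bar>)" for y
  define G where "G y = g (\<rho> y)" for y
  have G: "continuous_on UNIV G"
    unfolding G_def \<rho>_def by (intro continuous_on_compose2[OF g] continuous_intros) auto
  have tc: "continuous_on UNIV (trig_coord n :: 'd pt \<Rightarrow> _)" for n
    unfolding trig_coord_def by (intro continuous_intros) auto
  have Gn: "(\<lambda>x. G (trig_coord n x)) \<in> borel_measurable (weinstein_measure \<alpha>)" for n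
    by (intro measurable_weinsteinI borel_measurable_continuous_onI continuous_on_compose2[OF G tc]) auto
  show "approximable (\<lambda>x. complex_of_real (w x) * G (trig_coord n x))" for n
    unfolding approximable_def
  proof (intro conjI allI impI)
    show "(\<lambda>x. complex_of_real (w x) * G (trig_coord n x)) \<in> l2 (weinstein_measure \<alpha>)"
      by (rule weight_mult_l2[OF Gn, where C=K]) (simp add: G_def bd)
    fix e :: real assume e: "e > 0"
    define N where "N = l2norm (weinstein_measure \<alpha>) (\<lambda>x. complex_of_real (w x))"
    have N: "N \<ge> 0" by (simp add: N_def)
    \<comment> \<open>The L^2 error will be at most d N; the summand 1 avoids division by zero and
      keeps d N below e.\<close>
    define d where "d = e / (2 * (N + 1))"
    have d: "d > 0" using e N by (simp add: d_def)
    have "compact (closure (range (trig_coord n :: 'd pt \<Rightarrow> _)))"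
      using bounded_trig_coord by (simp add: compact_closure)
    from Stone_Weierstrass_polynomial_function[OF this continuous_on_subset[OF G] d]
    obtain P where P: "polynomial_function P"
      "\<And>y. y \<in> closure (range (trig_coord n)) \<Longrightarrow> norm (G y - P y) < d" by auto
    define q where "q x = P (trig_coord n x)" for x
    have "real_polynomial_function (\<lambda>y. Re (P y))" "real_polynomial_function (\<lambda>y. Im (P y))"
      using P(1) bounded_linear_Re bounded_linear_Im by (auto simp: polynomial_function_def o_def)
    then have "(\<lambda>x. complex_of_real (Re (P (trig_coord n x))) + \<i> * complex_of_real (Im (P (trig_coord n x)))) \<in> exp_span"
      by (intro exp_span.add exp_span.cmult exp_span_polynomial)
    then have q: "q \<in> exp_span"
      by (simp add: q_def[abs_def] complex_eq[symmetric])
    have "l2norm (weinstein_measure \<alpha>) (\<lambda>x. complex_of_real (w x) * G (trig_coord n x) - complex_of_real (w x) * q x) \<le>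
        l2norm (weinstein_measure \<alpha>) (\<lambda>x. complex_of_real d * complex_of_real (w x))"
      unfolding l2norm_def
    proof (intro real_sqrt_le_mono integral_mono)
      show "integrable (weinstein_measure \<alpha>) (\<lambda>x. (cmod (complex_of_real (w x) * G (trig_coord n x) - complex_of_real (w x) * q x))\<^sup>2)"
        by (intro l2_integrable l2_diff weight_exp_span_l2 q weight_mult_l2[OF Gn, where C=K]) (simp add: G_def bd)
      show "integrable (weinstein_measure \<alpha>) (\<lambda>x. (cmod (complex_of_real d * complex_of_real (w x)))\<^sup>2)"
        by (intro l2_integrable l2_cmult weight_l2)
      fix x :: "'d pt"
      have "trig_coord n x \<in> closure (range (trig_coord n))"
        by (rule subsetD[OF closure_subset]) simp
      from P(2)[OF this] have "cmod (G (trig_coord n x) - q x) \<le> d" by (simp add: q_def)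
      then have "w x * cmod (G (trig_coord n x) - q x) \<le> d * w x"
        using w_pos[of x] by (simp add: mult.commute)
      moreover have "complex_of_real (w x) * G (trig_coord n x) - complex_of_real (w x) * q x = w x * (G (trig_coord n x) - q x)"
        by (simp add: right_diff_distrib)
      ultimately show "(cmod (complex_of_real (w x) * G (trig_coord n x) - complex_of_real (w x) * q x))\<^sup>2 \<le> (cmod (complex_of_real d * complex_of_real (w x)))\<^sup>2"
        using w_pos[of x] d by (intro power_mono) (auto simp: norm_mult)
    qed
    also have "\<dots> = d * N"
      using d unfolding l2norm_cmult N_def by simp
    also have "\<dots> < e"
      using e N by (simp add: d_def field_simps add_strict_increasing)
    finally show "\<exists>q\<in>exp_span. l2norm (weinstein_measure \<alpha>) (\<lambda>x. complex_of_real (w x) * G (trig_coord n x) - complex_of_real (w x) * q x) < e"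
      using q by blast
  qed
  have gm: "g \<in> borel_measurable (weinstein_measure \<alpha>)"
    by (intro measurable_weinsteinI borel_measurable_continuous_onI g)
  show "(\<lambda>x. complex_of_real (w x) * g x) \<in> l2 (weinstein_measure \<alpha>)"
    by (rule weight_mult_l2[OF gm bd])
  show "(\<lambda>n. l2norm (weinstein_measure \<alpha>) (\<lambda>x. complex_of_real (w x) * G (trig_coord n x) - complex_of_real (w x) * g x)) \<longlonglongrightarrow> 0"
  proof (rule l2_dominated_convergence(2)[where w="\<lambda>x. K * w x"])
    show "integrable (weinstein_measure \<alpha>) (\<lambda>x. (K * w x)\<^sup>2)"
      using w_integrable by (simp add: power_mult_distrib)
    show "AE x in weinstein_measure \<alpha>. (\<lambda>n. complex_of_real (w x) * G (trig_coord n x)) \<longlonglongrightarrow> complex_of_real (w x) * g x"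
    proof (rule AE_I2)
      fix x :: "'d pt" assume "x \<in> space (weinstein_measure \<alpha>)"
      then have "g x = G (fst x, (snd x)\<^sup>2)"
        by (simp add: G_def \<rho>_def half_space_def)
      moreover have "(\<lambda>n. G (trig_coord n x)) \<longlonglongrightarrow> G (fst x, (snd x)\<^sup>2)"
        by (rule continuous_on_tendsto_compose[OF G trig_coord_tendsto]) auto
      ultimately show "(\<lambda>n. complex_of_real (w x) * G (trig_coord n x)) \<longlonglongrightarrow> complex_of_real (w x) * g x"
        by (intro tendsto_intros) simp
    qed
    show "AE x in weinstein_measure \<alpha>. cmod (complex_of_real (w x) * G (trig_coord n x)) \<le> K * w x" for n
      using w_pos bd by (intro AE_I2) (simp add: norm_mult G_def mult.commute[of K] mult_left_mono less_imp_le)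
  qed (use w_measurable Gn gm in measurable)
qed

text \<open>Where |f| \<le> k w the quotient f / w is bounded, and a bounded measurable function is
  an a.e. limit of uniformly bounded continuous ones. So the truncations F k are approximable, and
  they tend to f because w is positive.\<close>

lemma exp_span_dense:
  assumes f: "f \<in> l2 (weinstein_measure \<alpha>)" and e: "e > 0"
  shows "\<exists>q\<in>exp_span. l2norm (weinstein_measure \<alpha>) (\<lambda>x. f x - complex_of_real (w x) * q x) < e"
proof -
  note [measurable] = w_measurable l2_measurable[OF f]
  define F where "F k x = (if cmod (f x) \<le> real k * w x then f x else 0)" for k x
  have Fm [measurable]: "F k \<in> borel_measurable (weinstein_measure \<alpha>)" for k
    unfolding F_def by measurable
  have "approximable (F k)" for k
  proof -
    define h where "h x = indicator half_space x *\<^sub>R (F k x / w x)" for x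
    have hk: "cmod (h x) \<le> real k" for x
      using w_pos[of x] by (auto simp: h_def F_def indicator_def norm_divide field_simps)
    have "h \<in> borel_measurable borel"
      unfolding h_def by (intro measurable_weinstein_indicator) measurable
    then have "h \<in> borel_measurable lebesgue"
      by (intro measurable_completion) simp
    then have "h measurable_on UNIV"
      by (intro lebesgue_measurable_imp_measurable_on) auto
    then obtain N g where N: "negligible N" and g: "\<And>n. continuous_on UNIV (g n)"
      and lim: "\<And>x. x \<notin> N \<Longrightarrow> (\<lambda>n. g n x) \<longlonglongrightarrow> h x"
      unfolding measurable_on_def by auto
    \<comment> \<open>Projection to the ball of radius k is continuous and fixes the limit h, so the
      approximants acquire the common bound k that domination requires.\<close>
    define G where "G n x = closest_point (cball 0 (real k)) (g n x)" for n x
    have cp: "continuous_on UNIV (closest_point (cball (0 :: complex) (real k)))"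
      by (intro continuous_on_closest_point) auto
    have Gc: "continuous_on UNIV (G n)" for n
      unfolding G_def by (intro continuous_on_compose2[OF cp g]) auto
    have Gk: "cmod (G n x) \<le> real k" for n x
      using closest_point_in_set[of "cball (0 :: complex) (real k)" "g n x"] by (simp add: G_def)
    have Gm: "G n \<in> borel_measurable (weinstein_measure \<alpha>)" for n
      by (intro measurable_weinsteinI borel_measurable_continuous_onI Gc)
    have Glim: "(\<lambda>n. G n x) \<longlonglongrightarrow> h x" if "x \<notin> N" for x
    proof -
      have "(\<lambda>n. G n x) \<longlonglongrightarrow> closest_point (cball 0 (real k)) (h x)"
        unfolding G_def by (rule continuous_on_tendsto_compose[OF cp lim[OF that]]) auto
      then show ?thesis using hk by (simp add: closest_point_self)
    qed
    have "AE x in lebesgue. x \<notin> N"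
      using N by (intro AE_not_in) (simp add: negligible_iff_null_sets)
    then have "AE x in weinstein_measure \<alpha>. x \<notin> N"
      unfolding AE_weinstein_iff[OF \<alpha>] by (auto simp: AE_completion_iff)
    then have "AE x in weinstein_measure \<alpha>. x \<notin> N \<and> x \<in> half_space"
      using AE_space[of "weinstein_measure \<alpha>"] by (auto elim: AE_mp)
    then have ae: "AE x in weinstein_measure \<alpha>. (\<lambda>n. complex_of_real (w x) * G n x) \<longlonglongrightarrow> F k x"
    proof eventually_elim
      case (elim x)
      have "(\<lambda>n. complex_of_real (w x) * G n x) \<longlonglongrightarrow> complex_of_real (w x) * h x"
        using elim by (intro tendsto_intros Glim) auto
      moreover have "complex_of_real (w x) * h x = F k x"
        using elim w_pos[of x] by (simp add: h_def)
      ultimately show ?case by simp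
    qed
    have dom: "AE x in weinstein_measure \<alpha>. cmod (complex_of_real (w x) * G n x) \<le> real k * w x" for n
      using w_pos Gk by (intro AE_I2) (simp add: norm_mult mult.commute[of "real k"] mult_left_mono less_imp_le)
    have kw: "integrable (weinstein_measure \<alpha>) (\<lambda>x. (real k * w x)\<^sup>2)"
      using w_integrable by (simp add: power_mult_distrib)
    have wGm: "(\<lambda>x. complex_of_real (w x) * G n x) \<in> borel_measurable (weinstein_measure \<alpha>)" for n
      using Gm[of n] by measurable
    note dc = l2_dominated_convergence[OF wGm Fm kw ae dom]
    show ?thesis
      by (rule approximable_limit[OF approximable_continuous[OF Gc Gk] dc])
  qed
  note approx = this
  have lim: "(\<lambda>k. l2norm (weinstein_measure \<alpha>) (\<lambda>x. F k x - f x)) \<longlonglongrightarrow> 0"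
  proof (rule l2_dominated_convergence(2)[where w="\<lambda>x. cmod (f x)"])
    show "AE x in weinstein_measure \<alpha>. (\<lambda>k. F k x) \<longlonglongrightarrow> f x"
    proof (rule AE_I2)
      fix x
      obtain K :: nat where K: "cmod (f x) / w x \<le> real K" using real_arch_simple by blast
      have "F k x = f x" if "K \<le> k" for k
      proof -
        have "cmod (f x) / w x \<le> real k" using K that by linarith
        then show ?thesis using w_pos[of x] by (simp add: F_def field_simps)
      qed
      then show "(\<lambda>k. F k x) \<longlonglongrightarrow> f x"
        by (intro tendsto_eventually eventually_sequentiallyI[of K])
    qed
    show "AE x in weinstein_measure \<alpha>. cmod (F k x) \<le> cmod (f x)" for k
      by (intro AE_I2) (simp add: F_def)
  qed (use l2_integrable[OF f] in measurable)
  have "approximable f"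
    by (rule approximable_limit[OF approx f lim])
  then show ?thesis
    using e by (simp add: approximable_def)
qed

end

section \<open>The Gaussian weight, density and separation\<close>

text \<open>The square root of exp (- |x'|^2 / 2 - t^2 / 2), whence the 1/4. Separation splits that
  Gaussian evenly: one half makes the function square-integrable, the other weights the test
  function.\<close>

definition half_gaussian :: "('d::finite) pt \<Rightarrow> real" where
  "half_gaussian x = exp (- (norm (fst x))\<^sup>2 / 4) * exp (- (snd x)\<^sup>2 / 4)"

lemma half_gaussian_pos: "0 < half_gaussian x"
  by (simp add: half_gaussian_def)

lemma half_gaussian_le_1: "half_gaussian x \<le> 1"
  unfolding half_gaussian_def by (intro mult_le_one) auto

lemma half_gaussian_square:
  "(half_gaussian x)\<^sup>2 = exp (- (norm (fst x))\<^sup>2 / 2) * exp (- (1 / 2) * (snd x)\<^sup>2)"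
  by (simp add: half_gaussian_def power_mult_distrib exp_double[symmetric])

context
  fixes \<alpha> :: real
  assumes \<alpha>: "\<alpha> > - 1 / 2"
begin

lemma half_gaussian_measurable: "half_gaussian \<in> borel_measurable (weinstein_measure \<alpha>)"
  unfolding half_gaussian_def[abs_def]
  by (intro measurable_weinsteinI borel_measurable_continuous_onI continuous_intros) auto

text \<open>The factor raises r to r + 1/2, which is positive even for r = 0, so each generator
  becomes one of the invertible Gaussians.\<close>

lemma invertible_fun_exp_span:
  assumes "q \<in> exp_span"
  shows "invertible_fun \<alpha> (\<lambda>x. complex_of_real ((half_gaussian x)\<^sup>2) * q x)"
  using assms
proof induction
  case (base r b)
  have "(\<lambda>x. complex_of_real ((half_gaussian x)\<^sup>2) * (iexp (fst x \<bullet> b) * complex_of_real (exp (- r * (snd x)\<^sup>2)))) =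
    (\<lambda>x. (complex_of_real (exp (- (norm (fst x))\<^sup>2 / 2)) * iexp (fst x \<bullet> b)) *
    complex_of_real (exp (- (r + 1 / 2) * (snd x)\<^sup>2)))"
  proof
    fix x :: "'a pt"
    have "exp (- (r + 1 / 2) * (snd x)\<^sup>2) = exp (- (1 / 2) * (snd x)\<^sup>2) * exp (- r * (snd x)\<^sup>2)"
      by (simp add: exp_add[symmetric] algebra_simps)
    then show "complex_of_real ((half_gaussian x)\<^sup>2) * (iexp (fst x \<bullet> b) * complex_of_real (exp (- r * (snd x)\<^sup>2))) =
      (complex_of_real (exp (- (norm (fst x))\<^sup>2 / 2)) * iexp (fst x \<bullet> b)) * complex_of_real (exp (- (r + 1 / 2) * (snd x)\<^sup>2))"
      unfolding half_gaussian_square by (simp only: of_real_mult mult_ac)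
  qed
  then show ?case
    using invertible_fun_gaussian[OF \<alpha>, of "r + 1 / 2" b] base by simp
next
  case (add f g)
  then show ?case
    using invertible_fun_add[OF \<alpha> add.IH] by (simp only: distrib_left)
next
  case (cmult f c)
  then show ?case
    using invertible_fun_cmult[OF \<alpha> cmult.IH, of c] by (simp only: mult.left_commute)
qed

lemma half_gaussian_integrable:
  "integrable (weinstein_measure \<alpha>) (\<lambda>x :: ('d::finite) pt. (half_gaussian x)\<^sup>2)"
proof -
  have "invertible_fun \<alpha> (\<lambda>x :: 'd pt. complex_of_real ((half_gaussian x)\<^sup>2) * 1)"
    by (intro invertible_fun_exp_span exp_span_const)
  then show ?thesis
    by (simp add: invertible_fun_def[OF \<alpha>] complex_of_real_integrable_eq del: of_real_power)
qed

lemma half_gaussian_l2: "(\<lambda>x :: ('d::finite) pt. complex_of_real (half_gaussian x)) \<in> l2 (weinstein_measure \<alpha>)"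
proof (rule l2_dominated[OF _ half_gaussian_integrable])
  show "(\<lambda>x :: 'd pt. complex_of_real (half_gaussian x)) \<in> borel_measurable (weinstein_measure \<alpha>)"
    using half_gaussian_measurable by measurable
qed simp

text \<open>Weighted density with the full Gaussian as weight; its square is integrable because the
  Gaussian is at most 1.\<close>

lemma invertible_fun_dense:
  fixes f :: "('d::finite) pt \<Rightarrow> complex"
  assumes f: "f \<in> l2 (weinstein_measure \<alpha>)" and e: "e > 0"
  obtains g where "invertible_fun \<alpha> g" "l2norm (weinstein_measure \<alpha>) (\<lambda>x. f x - g x) < e"
proof -
  have "\<exists>q\<in>exp_span. l2norm (weinstein_measure \<alpha>) (\<lambda>x. f x - complex_of_real ((half_gaussian x)\<^sup>2) * q x) < e"
  proof (rule exp_span_dense[OF \<alpha> _ _ _ f e])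
    show "integrable (weinstein_measure \<alpha>) (\<lambda>x :: 'd pt. ((half_gaussian x)\<^sup>2)\<^sup>2)"
    proof (rule Bochner_Integration.integrable_bound[OF half_gaussian_integrable])
      show "AE x :: 'd pt in weinstein_measure \<alpha>. norm (((half_gaussian x)\<^sup>2)\<^sup>2) \<le> norm ((half_gaussian x)\<^sup>2)"
      proof (rule AE_I2)
        fix x :: "'d pt"
        have "(half_gaussian x)\<^sup>2 \<le> 1"
          by (rule power_le_one[OF less_imp_le[OF half_gaussian_pos] half_gaussian_le_1])
        then have "(half_gaussian x)\<^sup>2 * (half_gaussian x)\<^sup>2 \<le> (half_gaussian x)\<^sup>2"
          by (intro mult_left_le) auto
        then show "norm (((half_gaussian x)\<^sup>2)\<^sup>2) \<le> norm ((half_gaussian x)\<^sup>2)"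
          unfolding power2_eq_square[of "(half_gaussian x)\<^sup>2"] by simp
      qed
    qed (use half_gaussian_measurable in measurable)
    show "(\<lambda>x :: 'd pt. (half_gaussian x)\<^sup>2) \<in> borel_measurable (weinstein_measure \<alpha>)"
      by (intro borel_measurable_power half_gaussian_measurable)
    show "0 < (half_gaussian x)\<^sup>2" for x :: "'d pt"
      by (intro zero_less_power half_gaussian_pos)
  qed
  then obtain q where "q \<in> exp_span" "l2norm (weinstein_measure \<alpha>) (\<lambda>x. f x - complex_of_real ((half_gaussian x)\<^sup>2) * q x) < e" ..
  then show ?thesis
    by (intro that[OF invertible_fun_exp_span])
qed

text \<open>With H the half Gaussian, only v H must lie in L^2, so that bounded v are covered. The
  conjugate of u = v H is approximated by H q, while u H q = v H^2 q integrates to zero because H^2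
  q is invertible.\<close>

lemma invertible_fun_separating:
  fixes v :: "('d::finite) pt \<Rightarrow> complex"
  assumes v: "v \<in> borel_measurable (weinstein_measure \<alpha>)"
    and vH: "(\<lambda>x. v x * half_gaussian x) \<in> l2 (weinstein_measure \<alpha>)"
    and orth: "\<And>g. invertible_fun \<alpha> g \<Longrightarrow> (\<integral>x. v x * g x \<partial>weinstein_measure \<alpha>) = 0"
  shows "AE x in weinstein_measure \<alpha>. v x = 0"
proof -
  let ?W = "weinstein_measure \<alpha>"
  define u where "u x = v x * half_gaussian x" for x
  have u: "u \<in> l2 ?W" using vH by (simp add: u_def[abs_def])
  have "l2norm ?W u = 0"
  proof (rule ccontr)
    assume "l2norm ?W u \<noteq> 0"
    then have pos: "l2norm ?W u > 0" using l2norm_nonneg[of ?W u] by linarith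
    \<comment> \<open>An error below the norm of u is enough: Cauchy-Schwarz would then make the
      squared norm of u smaller than itself.\<close>
    from exp_span_dense[OF \<alpha> half_gaussian_measurable half_gaussian_integrable half_gaussian_pos l2_cnj[OF u] pos]
    obtain q where q: "q \<in> exp_span" "l2norm ?W (\<lambda>x. cnj (u x) - complex_of_real (half_gaussian x) * q x) < l2norm ?W u" ..
    define p where "p x = complex_of_real (half_gaussian x) * q x" for x
    obtain C where C: "\<And>x. cmod (q x) \<le> C" using exp_span_bounded[OF q(1)] by blast
    have "q \<in> borel_measurable ?W"
      by (intro measurable_weinsteinI borel_measurable_continuous_onI exp_span_continuous q)
    then have pm: "p \<in> borel_measurable ?W"
      unfolding p_def[abs_def] using half_gaussian_measurable by measurable
    have p: "p \<in> l2 ?W"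
    proof (rule l2_mono[OF pm])
      show "(\<lambda>x. complex_of_real (half_gaussian x)) \<in> l2 ?W"
        by (rule half_gaussian_l2)
      show "AE x in ?W. cmod (p x) \<le> C * cmod (complex_of_real (half_gaussian x))"
      proof (rule AE_I2)
        fix x :: "'d pt"
        show "cmod (p x) \<le> C * cmod (complex_of_real (half_gaussian x))"
          using mult_right_mono[OF C[of x], of "half_gaussian x"] half_gaussian_pos[of x]
          by (simp add: p_def norm_mult mult.commute)
      qed
    qed
    have "(\<integral>x. u x * p x \<partial>?W) = (\<integral>x. v x * (complex_of_real ((half_gaussian x)\<^sup>2) * q x) \<partial>?W)"
      by (intro Bochner_Integration.integral_cong refl) (simp add: u_def p_def power2_eq_square)
    also have "\<dots> = 0"
      by (intro orth invertible_fun_exp_span q)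
    finally have up: "(\<integral>x. u x * p x \<partial>?W) = 0" .
    have "complex_of_real ((l2norm ?W u)\<^sup>2) = (\<integral>x. u x * cnj (u x) \<partial>?W)"
      unfolding l2norm_square by (simp add: complex_norm_square[symmetric] del: of_real_power)
    also have "\<dots> = (\<integral>x. u x * (cnj (u x) - p x) \<partial>?W)"
      using up l2_integrable_mult[OF u l2_cnj[OF u]] l2_integrable_mult[OF u p]
      by (simp add: right_diff_distrib)
    finally have "(l2norm ?W u)\<^sup>2 = cmod (\<integral>x. u x * (cnj (u x) - p x) \<partial>?W)"
      by (metis norm_of_real abs_of_nonneg zero_le_power2)
    also have "\<dots> \<le> l2norm ?W u * l2norm ?W (\<lambda>x. cnj (u x) - p x)"
      by (intro l2_norm_integral_mult_le u l2_diff l2_cnj p)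
    also have "\<dots> < l2norm ?W u * l2norm ?W u"
      using q(2) pos by (simp add: p_def)
    finally show False by (simp add: power2_eq_square)
  qed
  then have "AE x in ?W. u x = 0"
    using l2norm_eq_0_iff_AE[OF u] by simp
  then show ?thesis
    by eventually_elim (simp add: u_def less_imp_neq[OF half_gaussian_pos, THEN not_sym])
qed

end

section \<open>The Plancherel theorem\<close>

lemma norm_powr_2: "norm x powr 2 = (norm x)\<^sup>2"
  by (cases "norm x = 0") (auto simp: powr_numeral)

lemma Lp_space_2: "Lp_space \<alpha> 2 = l2 (weinstein_measure \<alpha>)"
  by (simp add: Lp_space_def l2_def norm_powr_2)

lemma Lp_norm_2: "Lp_norm \<alpha> 2 f = l2norm (weinstein_measure \<alpha>) f"
  by (simp add: Lp_norm_def l2norm_def norm_powr_2 powr_half_sqrt)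

lemma Lp_space_1_integrable:
  fixes f :: "('d::finite) pt \<Rightarrow> complex"
  shows "f \<in> Lp_space \<alpha> 1 \<Longrightarrow> integrable (weinstein_measure \<alpha>) f"
  by (auto simp: Lp_space_def intro: integrable_norm_cancel)

context
  fixes \<alpha> :: real
  assumes \<alpha>: "\<alpha> > - 1 / 2"
begin

text \<open>The transform on \<open>L\<^sup>2\<close> characterised by duality: \<open>u\<close> is the transform of \<open>f\<close>.\<close>

definition weak_transform :: "(('d::finite) pt \<Rightarrow> complex) \<Rightarrow> ('d pt \<Rightarrow> complex) \<Rightarrow> bool" where
  "weak_transform f u \<longleftrightarrow> u \<in> l2 (weinstein_measure \<alpha>) \<and>
     (\<forall>g. invertible_fun \<alpha> g \<longrightarrow>
        (\<integral>x. u x * g x \<partial>weinstein_measure \<alpha>) = (\<integral>x. f x * weinstein_L1 \<alpha> g x \<partial>weinstein_measure \<alpha>))"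

lemma invertible_fun_l2:
  assumes "invertible_fun \<alpha> g"
  shows "g \<in> l2 (weinstein_measure \<alpha>)" "weinstein_L1 \<alpha> g \<in> l2 (weinstein_measure \<alpha>)"
    "integrable (weinstein_measure \<alpha>) g"
  using assms by (auto simp: invertible_fun_def[OF \<alpha>])

lemma weak_transform_add:
  assumes "f \<in> l2 (weinstein_measure \<alpha>)" "f' \<in> l2 (weinstein_measure \<alpha>)" "weak_transform f u" "weak_transform f' u'"
  shows "weak_transform (\<lambda>x. f x + f' x) (\<lambda>x. u x + u' x)"
  using assms unfolding weak_transform_def
  by (auto simp: distrib_right l2_integrable_mult invertible_fun_l2 intro: l2_add)

lemma weak_transform_cmult:
  assumes "weak_transform f u"
  shows "weak_transform (\<lambda>x. c * f x) (\<lambda>x. c * u x)"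
  using assms unfolding weak_transform_def by (auto simp: mult.assoc intro: l2_cmult)

lemma weak_transform_diff:
  assumes "f \<in> l2 (weinstein_measure \<alpha>)" "f' \<in> l2 (weinstein_measure \<alpha>)" "weak_transform f u" "weak_transform f' u'"
  shows "weak_transform (\<lambda>x. f x - f' x) (\<lambda>x. u x - u' x)"
  using weak_transform_add[OF assms(1) l2_cmult[OF assms(2)] assms(3) weak_transform_cmult[OF assms(4)], of "-1"]
  by simp

lemma l2_mult_half_gaussian:
  assumes "u \<in> l2 (weinstein_measure \<alpha>)"
  shows "(\<lambda>x. u x * complex_of_real (half_gaussian x)) \<in> l2 (weinstein_measure \<alpha>)"
proof (rule l2_mono[OF _ assms, of _ 1])
  show "(\<lambda>x. u x * complex_of_real (half_gaussian x)) \<in> borel_measurable (weinstein_measure \<alpha>)"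
    using half_gaussian_measurable[OF \<alpha>] l2_measurable[OF assms] by measurable
  show "AE x in weinstein_measure \<alpha>. cmod (u x * complex_of_real (half_gaussian x)) \<le> 1 * cmod (u x)"
    by (intro AE_I2) (simp add: norm_mult mult_left_le half_gaussian_le_1 half_gaussian_pos less_imp_le)
qed

text \<open>The difference is orthogonal to every invertible function, and these separate.\<close>

lemma weak_transform_unique:
  fixes f u v :: "('d::finite) pt \<Rightarrow> complex"
  assumes u: "weak_transform f u" and v: "weak_transform f v"
  shows "AE x in weinstein_measure \<alpha>. u x = v x"
proof -
  have ul: "u \<in> l2 (weinstein_measure \<alpha>)" and vl: "v \<in> l2 (weinstein_measure \<alpha>)"
    using u v by (auto simp: weak_transform_def)
  have "AE x in weinstein_measure \<alpha>. u x - v x = 0"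
  proof (rule invertible_fun_separating[OF \<alpha>])
    show "(\<lambda>x. u x - v x) \<in> borel_measurable (weinstein_measure \<alpha>)"
      using l2_measurable[OF l2_diff[OF ul vl]] .
    show "(\<lambda>x. (u x - v x) * complex_of_real (half_gaussian x)) \<in> l2 (weinstein_measure \<alpha>)"
      by (rule l2_mult_half_gaussian[OF l2_diff[OF ul vl]])
    fix g :: "'d pt \<Rightarrow> complex" assume g: "invertible_fun \<alpha> g"
    show "(\<integral>x. (u x - v x) * g x \<partial>weinstein_measure \<alpha>) = 0"
      using u v g l2_integrable_mult[OF ul invertible_fun_l2(1)[OF g]] l2_integrable_mult[OF vl invertible_fun_l2(1)[OF g]]
      by (simp add: weak_transform_def left_diff_distrib)
  qed
  then show ?thesis by simp
qed

text \<open>The integral transform of f is a priori only bounded, so its difference from u is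
  controlled through the half Gaussian. Against invertible functions the two agree, u by duality and
  the integral by the multiplication formula.\<close>

lemma weak_transform_L1:
  fixes f :: "('d::finite) pt \<Rightarrow> complex"
  assumes f: "integrable (weinstein_measure \<alpha>) f" and u: "weak_transform f u"
  shows "AE x in weinstein_measure \<alpha>. u x = weinstein_L1 \<alpha> f x"
proof -
  let ?W = "weinstein_measure \<alpha>"
  define C where "C = (\<integral>x. cmod (f x) \<partial>?W)"
  have C: "cmod (weinstein_L1 \<alpha> f x) \<le> C" for x
    unfolding C_def by (rule weinstein_L1_bound[OF \<alpha> f])
  have Fm: "weinstein_L1 \<alpha> f \<in> borel_measurable ?W"
    by (rule weinstein_L1_measurable[OF \<alpha> f])
  have ul: "u \<in> l2 ?W" using u by (simp add: weak_transform_def)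
  have "AE x in ?W. u x - weinstein_L1 \<alpha> f x = 0"
  proof (rule invertible_fun_separating[OF \<alpha>])
    show "(\<lambda>x. u x - weinstein_L1 \<alpha> f x) \<in> borel_measurable ?W"
      by (intro borel_measurable_diff Fm l2_measurable[OF ul])
    have H: "(\<lambda>x :: 'd pt. complex_of_real (half_gaussian x)) \<in> l2 ?W"
      by (rule half_gaussian_l2[OF \<alpha>])
    have "(\<lambda>x. weinstein_L1 \<alpha> f x * complex_of_real (half_gaussian x)) \<in> l2 ?W"
    proof (rule l2_mono[OF _ H, of _ C])
      show "(\<lambda>x. weinstein_L1 \<alpha> f x * complex_of_real (half_gaussian x)) \<in> borel_measurable ?W"
        by (intro borel_measurable_times Fm l2_measurable[OF H])
      show "AE x in ?W. cmod (weinstein_L1 \<alpha> f x * complex_of_real (half_gaussian x)) \<le> C * cmod (complex_of_real (half_gaussian x))"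
        unfolding norm_mult by (intro AE_I2 mult_right_mono C) simp
    qed
    from l2_diff[OF l2_mult_half_gaussian[OF ul] this]
    show "(\<lambda>x. (u x - weinstein_L1 \<alpha> f x) * complex_of_real (half_gaussian x)) \<in> l2 ?W"
      by (simp add: left_diff_distrib)
    fix g :: "'d pt \<Rightarrow> complex" assume g: "invertible_fun \<alpha> g"
    have gi: "integrable ?W g" by (rule invertible_fun_l2[OF g])
    have i: "integrable ?W (\<lambda>x. weinstein_L1 \<alpha> f x * g x)"
    proof (rule Bochner_Integration.integrable_bound)
      show "integrable ?W (\<lambda>x. C * cmod (g x))" using gi by simp
      show "(\<lambda>x. weinstein_L1 \<alpha> f x * g x) \<in> borel_measurable ?W"
        using gi by (intro borel_measurable_times Fm) auto
      have "cmod (weinstein_L1 \<alpha> f x * g x) \<le> C * cmod (g x)" for x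
        unfolding norm_mult by (intro mult_right_mono C) simp
      then show "AE x in ?W. norm (weinstein_L1 \<alpha> f x * g x) \<le> norm (C * cmod (g x))"
        by (intro AE_I2 order_trans[OF _ abs_ge_self[of "C * cmod (g _)"], unfolded real_norm_def[symmetric]])
    qed
    show "(\<integral>x. (u x - weinstein_L1 \<alpha> f x) * g x \<partial>?W) = 0"
      using u g i l2_integrable_mult[OF ul invertible_fun_l2(1)[OF g]] weinstein_L1_multiplication[OF \<alpha> f gi]
      by (simp add: weak_transform_def left_diff_distrib)
  qed
  then show ?thesis by simp
qed

section \<open>From the dense class to all of L^2\<close>

text \<open>The multiplication formula holds for each g n and survives L^2 limits on both sides.
  This both constructs the transform and recognises it in an arbitrary extension.\<close>

lemma weak_transform_limit:
  fixes f u :: "('d::finite) pt \<Rightarrow> complex"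
  assumes g: "\<And>n. invertible_fun \<alpha> (g n)" and f: "f \<in> l2 (weinstein_measure \<alpha>)"
    and gf: "(\<lambda>n. l2norm (weinstein_measure \<alpha>) (\<lambda>x. g n x - f x)) \<longlonglongrightarrow> 0"
    and u: "u \<in> l2 (weinstein_measure \<alpha>)"
    and gu: "(\<lambda>n. l2norm (weinstein_measure \<alpha>) (\<lambda>x. weinstein_L1 \<alpha> (g n) x - u x)) \<longlonglongrightarrow> 0"
  shows "weak_transform f u"
  unfolding weak_transform_def
proof (intro conjI u allI impI)
  fix p :: "'d pt \<Rightarrow> complex" assume p: "invertible_fun \<alpha> p"
  have "(\<lambda>n. \<integral>x. weinstein_L1 \<alpha> (g n) x * p x \<partial>weinstein_measure \<alpha>) \<longlonglongrightarrow> (\<integral>x. u x * p x \<partial>weinstein_measure \<alpha>)"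
    by (rule l2_tendsto_integral_mult[OF invertible_fun_l2(2)[OF g] u gu invertible_fun_l2(1)[OF p]])
  moreover have "(\<lambda>n. \<integral>x. g n x * weinstein_L1 \<alpha> p x \<partial>weinstein_measure \<alpha>) \<longlonglongrightarrow> (\<integral>x. f x * weinstein_L1 \<alpha> p x \<partial>weinstein_measure \<alpha>)"
    by (rule l2_tendsto_integral_mult[OF invertible_fun_l2(1)[OF g] f gf invertible_fun_l2(2)[OF p]])
  moreover have "(\<integral>x. weinstein_L1 \<alpha> (g n) x * p x \<partial>weinstein_measure \<alpha>) = (\<integral>x. g n x * weinstein_L1 \<alpha> p x \<partial>weinstein_measure \<alpha>)" for n
    by (rule weinstein_L1_multiplication[OF \<alpha> invertible_fun_l2(3)[OF g] invertible_fun_l2(3)[OF p]])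
  ultimately show "(\<integral>x. u x * p x \<partial>weinstein_measure \<alpha>) = (\<integral>x. f x * weinstein_L1 \<alpha> p x \<partial>weinstein_measure \<alpha>)"
    using LIMSEQ_unique by simp
qed

text \<open>With the rate 2^-(n+1), terms from index n on differ by at most 2^-n, which is the
  Cauchy condition of \<open>l2_complete\<close>.\<close>

lemma invertible_fun_approx:
  assumes f: "f \<in> l2 (weinstein_measure \<alpha>)"
  shows "\<exists>g. (\<forall>n. invertible_fun \<alpha> (g n)) \<and>
    (\<forall>n. l2norm (weinstein_measure \<alpha>) (\<lambda>x. g n x - f x) < (1 / 2) ^ Suc n) \<and>
    (\<lambda>n. l2norm (weinstein_measure \<alpha>) (\<lambda>x. g n x - f x)) \<longlonglongrightarrow> 0"
proof -
  have "\<exists>g. invertible_fun \<alpha> g \<and> l2norm (weinstein_measure \<alpha>) (\<lambda>x. g x - f x) < (1 / 2) ^ Suc n" for n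
  proof -
    have "(0::real) < (1 / 2) ^ Suc n" by simp
    from invertible_fun_dense[OF \<alpha> f this] obtain g where
      "invertible_fun \<alpha> g" "l2norm (weinstein_measure \<alpha>) (\<lambda>x. f x - g x) < (1 / 2) ^ Suc n" .
    then show ?thesis
      by (intro exI[of _ g]) (simp add: l2norm_minus_commute[of _ g])
  qed
  then obtain g where g: "\<And>n. invertible_fun \<alpha> (g n)"
    "\<And>n. l2norm (weinstein_measure \<alpha>) (\<lambda>x. g n x - f x) < (1 / 2) ^ Suc n"
    by metis
  have "(\<lambda>n. l2norm (weinstein_measure \<alpha>) (\<lambda>x. g n x - f x)) \<longlonglongrightarrow> 0"
  proof (rule tendsto_sandwich[OF _ _ tendsto_const])
    show "(\<lambda>n. (1 / 2 :: real) ^ Suc n) \<longlonglongrightarrow> 0"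
      by (intro LIMSEQ_Suc LIMSEQ_realpow_zero) auto
    show "\<forall>\<^sub>F n in sequentially. l2norm (weinstein_measure \<alpha>) (\<lambda>x. g n x - f x) \<le> (1 / 2) ^ Suc n"
      by (intro always_eventually allI less_imp_le g)
  qed simp
  with g show ?thesis by blast
qed

text \<open>Isometry on the dense class turns approximants of f into a Cauchy sequence of
  transforms; the limit is the transform of f, and norms pass to the limit.\<close>

lemma weak_transform_exists:
  assumes f: "f \<in> l2 (weinstein_measure \<alpha>)"
  obtains u where "weak_transform f u" "l2norm (weinstein_measure \<alpha>) u = l2norm (weinstein_measure \<alpha>) f"
proof -
  let ?W = "weinstein_measure \<alpha>"
  obtain g where g: "\<And>n. invertible_fun \<alpha> (g n)"
    "\<And>n. l2norm ?W (\<lambda>x. g n x - f x) < (1 / 2) ^ Suc n"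
    "(\<lambda>n. l2norm ?W (\<lambda>x. g n x - f x)) \<longlonglongrightarrow> 0"
    using invertible_fun_approx[OF f] by blast
  note gl = invertible_fun_l2[OF g(1)]
  have "l2norm ?W (\<lambda>x. weinstein_L1 \<alpha> (g m) x - weinstein_L1 \<alpha> (g n) x) \<le> (1 / 2) ^ n" if "n \<le> m" for m n
  proof -
    have inv: "invertible_fun \<alpha> (\<lambda>x. g m x - g n x)"
      using invertible_fun_add[OF \<alpha> g(1) invertible_fun_cmult[OF \<alpha> g(1)], of m "-1" n] by simp
    have "weinstein_L1 \<alpha> (\<lambda>x. g m x - g n x) = (\<lambda>x. weinstein_L1 \<alpha> (g m) x - weinstein_L1 \<alpha> (g n) x)"
      using weinstein_L1_add[OF \<alpha> gl(3)[of m], of "\<lambda>x. (-1) * g n x"] gl(3)[of n] weinstein_L1_cmult[OF \<alpha>, of "-1" "g n"]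
      by (simp add: fun_eq_iff)
    then have "l2norm ?W (\<lambda>x. weinstein_L1 \<alpha> (g m) x - weinstein_L1 \<alpha> (g n) x) = l2norm ?W (\<lambda>x. g m x - g n x)"
      using invertible_fun_isometry[OF \<alpha> inv] by simp
    also have "\<dots> \<le> l2norm ?W (\<lambda>x. g m x - f x) + l2norm ?W (\<lambda>x. f x - g n x)"
      by (rule l2norm_triangle_diff[OF gl(1) f gl(1)])
    also have "\<dots> \<le> (1 / 2) ^ Suc m + (1 / 2) ^ Suc n"
      using g(2)[of m] g(2)[of n] by (simp add: l2norm_minus_commute[of ?W f])
    also have "\<dots> \<le> (1 / 2) ^ Suc n + (1 / 2) ^ Suc n"
      using that by (intro add_right_mono power_decreasing) auto
    also have "\<dots> = (1 / 2) ^ n" by simp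
    finally show ?thesis .
  qed
  with gl(2) obtain u where u: "u \<in> l2 ?W" "(\<lambda>n. l2norm ?W (\<lambda>x. weinstein_L1 \<alpha> (g n) x - u x)) \<longlonglongrightarrow> 0"
    using l2_complete[of "\<lambda>n. weinstein_L1 \<alpha> (g n)" ?W] by blast
  have "(\<lambda>n. l2norm ?W (g n)) \<longlonglongrightarrow> l2norm ?W f"
    by (rule l2_tendsto_l2norm[OF gl(1) f g(3)])
  moreover have "(\<lambda>n. l2norm ?W (g n)) \<longlonglongrightarrow> l2norm ?W u"
    using l2_tendsto_l2norm[OF gl(2) u] by (simp add: invertible_fun_isometry[OF \<alpha> g(1)])
  ultimately have "l2norm ?W u = l2norm ?W f"
    using LIMSEQ_unique by blast
  with weak_transform_limit[OF g(1) f g(3) u] that show ?thesis by blast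
qed

lemma weak_transform_norm:
  assumes "f \<in> l2 (weinstein_measure \<alpha>)" "weak_transform f u"
  shows "l2norm (weinstein_measure \<alpha>) u = l2norm (weinstein_measure \<alpha>) f"
proof -
  obtain v where v: "weak_transform f v" "l2norm (weinstein_measure \<alpha>) v = l2norm (weinstein_measure \<alpha>) f"
    using weak_transform_exists[OF assms(1)] .
  have "l2norm (weinstein_measure \<alpha>) u = l2norm (weinstein_measure \<alpha>) v"
    using weak_transform_unique[OF assms(2) v(1)] assms(2) v(1)
    by (intro l2norm_cong_AE) (auto simp: weak_transform_def l2_measurable)
  with v(2) show ?thesis by simp
qed

text \<open>The inversion formula on L^2. To test f against g, write g as the transform of p, the
  reflection of F g; duality moves the integral to u and p, and reflection invariance of the measure
  finishes.\<close>

lemma weak_transform_inverse: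
  fixes f u :: "('d::finite) pt \<Rightarrow> complex"
  assumes f: "f \<in> l2 (weinstein_measure \<alpha>)" and u: "weak_transform f u"
  shows "weak_transform (\<lambda>x. u (flip x)) f"
  unfolding weak_transform_def
proof (intro conjI f allI impI)
  let ?W = "weinstein_measure \<alpha>"
  fix g :: "'d pt \<Rightarrow> complex" assume g: "invertible_fun \<alpha> g"
  define p where "p x = weinstein_L1 \<alpha> g (flip x)" for x
  have Fg: "invertible_fun \<alpha> (weinstein_L1 \<alpha> g)" by (rule invertible_fun_L1[OF \<alpha> g])
  have p: "invertible_fun \<alpha> p"
    unfolding p_def[abs_def] by (rule invertible_fun_flip[OF \<alpha> Fg])
  have ul: "u \<in> l2 ?W" using u by (simp add: weak_transform_def)
  have Fp: "weinstein_L1 \<alpha> p x = weinstein_L1 \<alpha> (weinstein_L1 \<alpha> g) (flip x)" for x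
    unfolding p_def using l2_measurable[OF invertible_fun_l2(2)[OF g]] by (rule weinstein_L1_flip[OF \<alpha>])
  have "AE x in ?W. weinstein_L1 \<alpha> (weinstein_L1 \<alpha> g) x = g (flip x)"
    using g by (simp add: invertible_fun_def[OF \<alpha>])
  from AE_weinstein_flip[OF \<alpha> this] have ae: "AE x in ?W. weinstein_L1 \<alpha> p x = g x"
    by (simp add: Fp)
  have "(\<integral>x. f x * g x \<partial>?W) = (\<integral>x. f x * weinstein_L1 \<alpha> p x \<partial>?W)"
    using ae by (intro integral_cong_AE borel_measurable_times l2_measurable[OF f]
        l2_measurable[OF invertible_fun_l2(1)[OF g]] l2_measurable[OF invertible_fun_l2(2)[OF p]]) auto
  also have "\<dots> = (\<integral>x. u x * p x \<partial>?W)"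
    using u p by (simp add: weak_transform_def)
  also have "\<dots> = (\<integral>x. u (flip x) * p (flip x) \<partial>?W)"
    by (rule integral_flip[OF \<alpha>, symmetric])
       (intro borel_measurable_times l2_measurable[OF ul] l2_measurable[OF invertible_fun_l2(1)[OF p]])
  finally show "(\<integral>x. f x * g x \<partial>?W) = (\<integral>x. u (flip x) * weinstein_L1 \<alpha> g x \<partial>?W)"
    by (simp add: p_def)
qed

section \<open>Plancherel extensions and the chosen transform\<close>

text \<open>Any selection of duality transforms works: sums and multiples of transforms are again
  transforms, so uniqueness gives linearity a.e. for the selected ones.\<close>

lemma plancherel_extension_exists:
  "\<exists>U. plancherel_extension \<alpha> (U :: (('d::finite) pt \<Rightarrow> complex) \<Rightarrow> 'd pt \<Rightarrow> complex)"
proof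
  define U where "U f = (SOME u. weak_transform f u)" for f :: "'d pt \<Rightarrow> complex"
  have U: "weak_transform f (U f)" if "f \<in> l2 (weinstein_measure \<alpha>)" for f
    unfolding U_def using weak_transform_exists[OF that] by (metis someI_ex)
  show "plancherel_extension \<alpha> U"
    unfolding plancherel_extension_def Lp_space_2 Lp_norm_2
  proof (intro conjI ballI allI)
    fix f :: "'d pt \<Rightarrow> complex" assume f: "f \<in> l2 (weinstein_measure \<alpha>)"
    show "U f \<in> l2 (weinstein_measure \<alpha>)" using U[OF f] by (simp add: weak_transform_def)
    show "l2norm (weinstein_measure \<alpha>) (U f) = l2norm (weinstein_measure \<alpha>) f"
      by (rule weak_transform_norm[OF f U[OF f]])
    show "AE \<xi> in weinstein_measure \<alpha>. U (\<lambda>x. c * f x) \<xi> = c * U f \<xi>" for c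
      by (rule weak_transform_unique[OF U weak_transform_cmult]) (intro l2_cmult f U)+
    show "AE \<xi> in weinstein_measure \<alpha>. U (\<lambda>x. f x + g x) \<xi> = U f \<xi> + U g \<xi>"
      if g: "g \<in> l2 (weinstein_measure \<alpha>)" for g
      by (rule weak_transform_unique[OF U weak_transform_add]) (intro l2_add f g U)+
  next
    fix g :: "'d pt \<Rightarrow> complex" assume g: "g \<in> l2 (weinstein_measure \<alpha>)"
    \<comment> \<open>By inversion the reflected transform of g is a preimage of g.\<close>
    have f: "(\<lambda>x. U g (flip x)) \<in> l2 (weinstein_measure \<alpha>)"
      using U[OF g] by (intro l2_flip[OF \<alpha>]) (simp add: weak_transform_def)
    show "\<exists>f\<in>l2 (weinstein_measure \<alpha>). AE \<xi> in weinstein_measure \<alpha>. U f \<xi> = g \<xi>"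
      using weak_transform_unique[OF U[OF f] weak_transform_inverse[OF g U[OF g]]] f by blast
  next
    fix f :: "'d pt \<Rightarrow> complex" assume f: "f \<in> Lp_space \<alpha> 1 \<inter> l2 (weinstein_measure \<alpha>)"
    show "AE \<xi> in weinstein_measure \<alpha>. U f \<xi> = weinstein_L1 \<alpha> f \<xi>"
      using f by (intro weak_transform_L1 U Lp_space_1_integrable) auto
  qed
qed

text \<open>An arbitrary extension is known only through its defining properties. Linearity,
  isometry and agreement with the integral on g n show that F (g n) is as far from U f as g n is
  from f, so U f is the limit that duality characterises.\<close>

lemma plancherel_extension_weak_transform:
  assumes U: "plancherel_extension \<alpha> U" and f: "f \<in> l2 (weinstein_measure \<alpha>)"
  shows "weak_transform f (U f)"
proof -
  let ?W = "weinstein_measure \<alpha>"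
  have Ul: "U f \<in> l2 ?W" if "f \<in> l2 ?W" for f
    using U that by (simp add: plancherel_extension_def Lp_space_2)
  have Uadd: "AE x in ?W. U (\<lambda>x. p x + q x) x = U p x + U q x" if "p \<in> l2 ?W" "q \<in> l2 ?W" for p q
    using U that by (simp add: plancherel_extension_def Lp_space_2)
  have Ucmult: "AE x in ?W. U (\<lambda>x. c * p x) x = c * U p x" if "p \<in> l2 ?W" for c p
    using U that by (simp add: plancherel_extension_def Lp_space_2)
  obtain g where g: "\<And>n. invertible_fun \<alpha> (g n)"
    "\<And>n. l2norm ?W (\<lambda>x. g n x - f x) < (1 / 2) ^ Suc n"
    "(\<lambda>n. l2norm ?W (\<lambda>x. g n x - f x)) \<longlonglongrightarrow> 0"
    using invertible_fun_approx[OF f] by blast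
  note gl = invertible_fun_l2[OF g(1)]
  have "l2norm ?W (\<lambda>x. weinstein_L1 \<alpha> (g n) x - U f x) = l2norm ?W (\<lambda>x. g n x - f x)" for n
  proof -
    \<comment> \<open>The defining properties speak of sums and multiples, so the difference is
      assembled with the scalar -1.\<close>
    have mf: "(\<lambda>x. (-1) * f x) \<in> l2 ?W" by (rule l2_cmult[OF f])
    have L: "g n \<in> Lp_space \<alpha> 1 \<inter> Lp_space \<alpha> 2"
      using gl(1)[of n] gl(3)[of n] unfolding Lp_space_2 by (auto simp: Lp_space_def)
    have "AE x in ?W. U (g n) x = weinstein_L1 \<alpha> (g n) x"
      using U L unfolding plancherel_extension_def by blast
    moreover have "AE x in ?W. U (\<lambda>x. (-1) * f x) x = (-1) * U f x"
      by (rule Ucmult[OF f])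
    moreover have "AE x in ?W. U (\<lambda>x. g n x + (-1) * f x) x = U (g n) x + U (\<lambda>x. (-1) * f x) x"
      by (rule Uadd[OF gl(1) mf])
    ultimately have ae: "AE x in ?W. weinstein_L1 \<alpha> (g n) x - U f x = U (\<lambda>x. g n x + (-1) * f x) x"
      by eventually_elim simp
    have "l2norm ?W (\<lambda>x. weinstein_L1 \<alpha> (g n) x - U f x) = l2norm ?W (U (\<lambda>x. g n x + (-1) * f x))"
      by (rule l2norm_cong_AE[OF _ _ ae]) (intro l2_measurable l2_diff Ul l2_add gl mf f)+
    also have "\<dots> = l2norm ?W (\<lambda>x. g n x + (-1) * f x)"
      using U l2_add[OF gl(1)[of n] mf] by (simp add: plancherel_extension_def Lp_space_2 Lp_norm_2)
    finally show ?thesis by simp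
  qed
  with g(3) show ?thesis
    by (intro weak_transform_limit[OF g(1) f g(3) Ul[OF f]]) simp
qed

lemma weinstein_L2_weak_transform:
  "f \<in> l2 (weinstein_measure \<alpha>) \<Longrightarrow> weak_transform f (weinstein_L2 \<alpha> f)"
  unfolding weinstein_L2_def
  by (rule plancherel_extension_weak_transform[OF someI_ex[OF plancherel_extension_exists]])

lemma weinstein_L2_l2: "f \<in> l2 (weinstein_measure \<alpha>) \<Longrightarrow> weinstein_L2 \<alpha> f \<in> l2 (weinstein_measure \<alpha>)"
  using weinstein_L2_weak_transform[of f] by (simp add: weak_transform_def)

lemma weinstein_L2_norm:
  "f \<in> l2 (weinstein_measure \<alpha>) \<Longrightarrow>
    l2norm (weinstein_measure \<alpha>) (weinstein_L2 \<alpha> f) = l2norm (weinstein_measure \<alpha>) f"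
  by (rule weak_transform_norm[OF _ weinstein_L2_weak_transform])

text \<open>L^2 inversion again; through it the multiplier operator acts on the transform side as
  plain multiplication by the dilated symbol.\<close>

lemma weinstein_inv_L2_weak_transform:
  assumes "g \<in> l2 (weinstein_measure \<alpha>)"
  shows "weinstein_inv_L2 \<alpha> g \<in> l2 (weinstein_measure \<alpha>)" "weak_transform (weinstein_inv_L2 \<alpha> g) g"
  unfolding weinstein_inv_L2_def[abs_def]
  by (rule l2_flip[OF \<alpha> weinstein_L2_l2[OF assms]])
     (rule weak_transform_inverse[OF assms weinstein_L2_weak_transform[OF assms]])

end

section \<open>The extremal function\<close>

text \<open>All dependence on p is collected in a square with positive factor D; the remainder is
  the pointwise minimum.\<close>

lemma tikhonov_complete_square:
  fixes a p M :: complex and e D :: real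
  assumes D: "D = e + (cmod M)\<^sup>2" "D > 0"
  shows "e * (cmod p)\<^sup>2 + (cmod (a - M * p))\<^sup>2 =
    D * (cmod (p - cnj M / complex_of_real D * a))\<^sup>2 + ((cmod a)\<^sup>2 - (cmod M)\<^sup>2 * (cmod a)\<^sup>2 / D)"
proof -
  \<comment> \<open>With a = D b and D = e + |M|^2 the claim becomes a polynomial identity in M, p,
    b and their conjugates.\<close>
  define b where "b = a / complex_of_real D"
  have a: "a = complex_of_real D * b" using D(2) by (simp add: b_def)
  have g: "cnj M / complex_of_real D * a = cnj M * b" by (simp add: b_def)
  have "(cmod a)\<^sup>2 = D\<^sup>2 * (cmod b)\<^sup>2" using D(2) by (simp add: a norm_mult power_mult_distrib)
  then have *: "(cmod M)\<^sup>2 * (cmod a)\<^sup>2 / D = (cmod M)\<^sup>2 * (D * (cmod b)\<^sup>2)"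
    using D(2) by (simp add: power2_eq_square)
  have Dc: "complex_of_real D = complex_of_real e + M * cnj M"
    unfolding D(1) by (simp add: complex_norm_square del: of_real_power)
  have "complex_of_real (e * (cmod p)\<^sup>2 + (cmod (a - M * p))\<^sup>2) =
     complex_of_real (D * (cmod (p - cnj M * b))\<^sup>2 + ((cmod a)\<^sup>2 - (cmod M)\<^sup>2 * (D * (cmod b)\<^sup>2)))"
    unfolding of_real_add of_real_mult of_real_diff complex_norm_square a complex_cnj_mult complex_cnj_diff
      complex_cnj_complex_of_real complex_cnj_cnj Dc
    by (simp add: algebra_simps)
  then show ?thesis
    unfolding g * of_real_eq_iff .
qed

text \<open>Expanding the square of \<eta> x - \<mu>^2; equality at
  \<open>\<mu>\<^sup>2 = \<eta> * x\<close> is the origin of the factor 4.\<close>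

lemma tikhonov_weight_bound:
  fixes x \<mu> \<eta> :: real
  assumes "\<eta> > 0" "x \<ge> 1"
  shows "x * (\<mu> / (\<eta> * x + \<mu>\<^sup>2))\<^sup>2 \<le> 1 / (4 * \<eta>)"
proof -
  have "0 < \<eta> * x" using assms by simp
  then have pos: "0 < \<eta> * x + \<mu>\<^sup>2" by (simp add: add_pos_nonneg)
  have "4 * \<eta> * (x * \<mu>\<^sup>2) \<le> (\<eta> * x + \<mu>\<^sup>2)\<^sup>2"
    using zero_le_power2[of "\<eta> * x - \<mu>\<^sup>2"] by (simp add: power2_eq_square algebra_simps)
  then show ?thesis
    using pos assms by (simp add: power_divide field_simps)
qed

theorem theorem3p7:
  fixes \<alpha> \<sigma> \<eta> :: real
    and \<zeta> :: "(real ^ 'd::finite) \<times> real \<Rightarrow> real"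
    and m h :: "(real ^ 'd) \<times> real \<Rightarrow> complex"
  assumes "\<alpha> > - 1 / 2" and "\<sigma> > 0" and "\<eta> > 0"
    and "\<zeta> \<in> borel_measurable (weinstein_measure \<alpha>)"
    and "\<And>\<xi>. \<xi> \<in> half_space \<Longrightarrow> \<zeta> \<xi> \<ge> 1"
    and "(\<lambda>\<xi>. inverse (\<zeta> \<xi>)) \<in> Lp_space \<alpha> 1"
    and "m \<in> Linf_space \<alpha>"
    and "h \<in> Lp_space \<alpha> 2"
  shows "(AE \<xi> in weinstein_measure \<alpha>.
           weinstein_L2 \<alpha> (extremal_fun \<alpha> \<zeta> m \<eta> \<sigma> h) \<xi> =
             cnj (dilate \<sigma> m \<xi>) /
               complex_of_real (\<eta> * \<zeta> \<xi> + (norm (dilate \<sigma> m \<xi>))\<^sup>2) * weinstein_L2 \<alpha> h \<xi>) \<and>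
         (H_norm \<alpha> \<zeta> (extremal_fun \<alpha> \<zeta> m \<eta> \<sigma> h))\<^sup>2 \<le> 1 / (4 * \<eta>) * (Lp_norm \<alpha> 2 h)\<^sup>2"
proof -
  note \<alpha> = assms(1) and \<eta> = assms(3) and \<zeta>1 = assms(5)
  let ?W = "weinstein_measure \<alpha> :: 'd pt measure"
  let ?U = "weinstein_L2 \<alpha> :: ('d pt \<Rightarrow> complex) \<Rightarrow> 'd pt \<Rightarrow> complex"
  note U = weinstein_L2_weak_transform[OF \<alpha>] and Ul = weinstein_L2_l2[OF \<alpha>]
  have h: "h \<in> l2 ?W" using assms(8) by (simp add: Lp_space_2)
  define M where "M = dilate \<sigma> m"
  define a where "a = ?U h"
  \<comment> \<open>D is the denominator of the claimed formula, g its right-hand side, and R the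
    part of the integrand that does not depend on the competitor.\<close>
  define D where "D \<xi> = \<eta> * \<zeta> \<xi> + (cmod (M \<xi>))\<^sup>2" for \<xi>
  define g where "g \<xi> = cnj (M \<xi>) / complex_of_real (D \<xi>) * a \<xi>" for \<xi>
  define R where "R \<xi> = (cmod (a \<xi>))\<^sup>2 - (cmod (M \<xi>))\<^sup>2 * (cmod (a \<xi>))\<^sup>2 / D \<xi>" for \<xi>
  have a: "a \<in> l2 ?W" unfolding a_def by (rule Ul[OF h])
  have [measurable]: "\<zeta> \<in> borel_measurable ?W" "a \<in> borel_measurable ?W" "M \<in> borel_measurable ?W"
    using assms a by (auto simp: M_def Linf_space_def l2_measurable intro: dilate_measurable[OF \<alpha>])
  have [measurable]: "D \<in> borel_measurable ?W" unfolding D_def by measurable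
  have cnjM [measurable]: "(\<lambda>\<xi>. cnj (M \<xi>)) \<in> borel_measurable ?W"
    by (rule borel_measurable_continuous_on[of cnj]) (auto intro: continuous_intros)
  have [measurable]: "g \<in> borel_measurable ?W" unfolding g_def by measurable
  obtain C where "AE x in ?W. cmod (m x) \<le> C"
    using assms(7) by (auto simp: Linf_space_def)
  from AE_weinstein_scaleR[OF \<alpha> assms(2) this]
  have C: "AE x in ?W. cmod (M x) \<le> C" by (simp add: M_def dilate_def)
  have Dpos: "0 < D \<xi>" if "\<xi> \<in> half_space" for \<xi>
  proof -
    have "0 < \<eta> * \<zeta> \<xi>" using \<eta> \<zeta>1[OF that] by simp
    then show ?thesis by (simp add: D_def add_pos_nonneg)
  qed
  have g_bound: "\<zeta> \<xi> * (cmod (g \<xi>))\<^sup>2 \<le> 1 / (4 * \<eta>) * (cmod (a \<xi>))\<^sup>2" if "\<xi> \<in> half_space" for \<xi>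
  proof -
    have "\<zeta> \<xi> * (cmod (g \<xi>))\<^sup>2 = (\<zeta> \<xi> * (cmod (M \<xi>) / D \<xi>)\<^sup>2) * (cmod (a \<xi>))\<^sup>2"
      using Dpos[OF that] by (simp add: g_def norm_mult norm_divide power_mult_distrib power_divide)
    also have "\<dots> \<le> 1 / (4 * \<eta>) * (cmod (a \<xi>))\<^sup>2"
      unfolding D_def by (intro mult_right_mono tikhonov_weight_bound \<eta> \<zeta>1 that) simp
    finally show ?thesis .
  qed
  have ai: "integrable ?W (\<lambda>\<xi>. 1 / (4 * \<eta>) * (cmod (a \<xi>))\<^sup>2)"
    using l2_integrable[OF a] by simp
  \<comment> \<open>Because \<zeta> \<ge> 1, the weighted bound also controls g itself.\<close>
  have g: "g \<in> l2 ?W"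
  proof (rule l2_dominated[OF _ ai])
    show "AE \<xi> in ?W. (cmod (g \<xi>))\<^sup>2 \<le> 1 / (4 * \<eta>) * (cmod (a \<xi>))\<^sup>2"
    proof (rule AE_I2)
      fix \<xi> :: "'d pt" assume "\<xi> \<in> space ?W"
      then have \<xi>: "\<xi> \<in> half_space" by simp
      have "1 * (cmod (g \<xi>))\<^sup>2 \<le> \<zeta> \<xi> * (cmod (g \<xi>))\<^sup>2"
        by (intro mult_right_mono \<zeta>1 \<xi>) simp
      with g_bound[OF \<xi>] show "(cmod (g \<xi>))\<^sup>2 \<le> 1 / (4 * \<eta>) * (cmod (a \<xi>))\<^sup>2" by simp
    qed
  qed measurable
  have \<zeta>sq: "(cmod (complex_of_real (sqrt (\<zeta> \<xi>)) * z))\<^sup>2 = \<zeta> \<xi> * (cmod z)\<^sup>2" if "\<xi> \<in> half_space" for \<xi> z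
    using \<zeta>1[OF that] by (simp add: norm_mult power_mult_distrib)
  \<comment> \<open>The ratio |M|^2 / D lies between 0 and 1, so R lies between 0 and |a|^2.\<close>
  have R: "integrable ?W R"
  proof (rule Bochner_Integration.integrable_bound[OF l2_integrable[OF a]])
    show "R \<in> borel_measurable ?W" unfolding R_def by measurable
    show "AE \<xi> in ?W. norm (R \<xi>) \<le> norm ((cmod (a \<xi>))\<^sup>2)"
    proof (rule AE_I2)
      fix \<xi> :: "'d pt" assume "\<xi> \<in> space ?W"
      then have \<xi>: "\<xi> \<in> half_space" by simp
      have "(cmod (M \<xi>))\<^sup>2 \<le> D \<xi>"
        using \<eta> \<zeta>1[OF \<xi>] by (simp add: D_def)
      then have "(cmod (M \<xi>))\<^sup>2 * (cmod (a \<xi>))\<^sup>2 / D \<xi> \<le> (cmod (a \<xi>))\<^sup>2"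
        using Dpos[OF \<xi>] mult_right_mono[of "(cmod (M \<xi>))\<^sup>2" "D \<xi>" "(cmod (a \<xi>))\<^sup>2"]
        by (simp add: pos_divide_le_eq mult.commute)
      moreover have "0 \<le> (cmod (M \<xi>))\<^sup>2 * (cmod (a \<xi>))\<^sup>2 / D \<xi>"
        using Dpos[OF \<xi>] by simp
      ultimately show "norm (R \<xi>) \<le> norm ((cmod (a \<xi>))\<^sup>2)"
        by (simp add: R_def)
    qed
  qed
  have tik: "integrable ?W (\<lambda>\<xi>. D \<xi> * (cmod (?U \<phi> \<xi> - g \<xi>))\<^sup>2)"
      "tikhonov \<alpha> \<zeta> m \<eta> \<sigma> h \<phi> = (\<integral>\<xi>. D \<xi> * (cmod (?U \<phi> \<xi> - g \<xi>))\<^sup>2 \<partial>?W) + integral\<^sup>L ?W R"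
    if \<phi>: "\<phi> \<in> H_space \<alpha> \<zeta>" for \<phi>
  proof -
    have \<phi>l: "\<phi> \<in> l2 ?W" using \<phi> by (simp add: H_space_def Lp_space_2)
    define p where "p = ?U \<phi>"
    have p: "p \<in> l2 ?W" unfolding p_def by (rule Ul[OF \<phi>l])
    note [measurable] = l2_measurable[OF p]
    have Mp: "(\<lambda>\<xi>. M \<xi> * p \<xi>) \<in> l2 ?W"
    proof (rule l2_mono[OF _ p])
      show "AE \<xi> in ?W. cmod (M \<xi> * p \<xi>) \<le> C * cmod (p \<xi>)"
        using C by eventually_elim (simp add: norm_mult mult_right_mono)
    qed measurable
    have T: "multiplier_op \<alpha> m \<sigma> \<phi> = weinstein_inv_L2 \<alpha> (\<lambda>\<xi>. M \<xi> * p \<xi>)"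
      by (simp add: multiplier_op_def M_def p_def)
    \<comment> \<open>The residual h - T \<phi> has transform a - M p, because T \<phi> is the
      inverse transform of M p and duality respects differences; isometry does the rest.\<close>
    have "l2norm ?W (\<lambda>\<xi>. a \<xi> - M \<xi> * p \<xi>) = l2norm ?W (\<lambda>x. h x - multiplier_op \<alpha> m \<sigma> \<phi> x)"
      unfolding T a_def
      by (intro weak_transform_norm[OF \<alpha>] weak_transform_diff[OF \<alpha>] l2_diff h U weinstein_inv_L2_weak_transform[OF \<alpha>] Mp)
    then have n2: "(Lp_norm \<alpha> 2 (\<lambda>x. h x - multiplier_op \<alpha> m \<sigma> \<phi> x))\<^sup>2 = (\<integral>\<xi>. (cmod (a \<xi> - M \<xi> * p \<xi>))\<^sup>2 \<partial>?W)"
      by (simp add: Lp_norm_2 l2norm_square[symmetric])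
    have i2: "integrable ?W (\<lambda>\<xi>. (cmod (a \<xi> - M \<xi> * p \<xi>))\<^sup>2)"
      by (rule l2_integrable[OF l2_diff[OF a Mp]])
    have "integrable ?W (\<lambda>\<xi>. (cmod (complex_of_real (sqrt (\<zeta> \<xi>)) * p \<xi>))\<^sup>2)"
      using \<phi> by (intro l2_integrable) (simp add: H_space_def Lp_space_2 p_def)
    then have i1: "integrable ?W (\<lambda>\<xi>. \<zeta> \<xi> * (cmod (p \<xi>))\<^sup>2)"
      by (rule Bochner_Integration.integrable_cong[OF refl, THEN iffD1, rotated]) (simp add: \<zeta>sq)
    \<comment> \<open>Needed for squaring to cancel the square root in
      \<open>H_norm\<close>.\<close>
    have "0 \<le> (\<integral>\<xi>. \<zeta> \<xi> * (cmod (p \<xi>))\<^sup>2 \<partial>?W)"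
    proof (rule integral_nonneg_AE, rule AE_I2)
      fix \<xi> :: "'d pt" assume "\<xi> \<in> space ?W"
      then show "0 \<le> \<zeta> \<xi> * (cmod (p \<xi>))\<^sup>2" using \<zeta>1[of \<xi>] by simp
    qed
    then have n1: "(H_norm \<alpha> \<zeta> \<phi>)\<^sup>2 = (\<integral>\<xi>. \<zeta> \<xi> * (cmod (p \<xi>))\<^sup>2 \<partial>?W)"
      by (simp add: H_norm_def p_def)
    have eq: "\<eta> * (\<zeta> \<xi> * (cmod (p \<xi>))\<^sup>2) + (cmod (a \<xi> - M \<xi> * p \<xi>))\<^sup>2 =
        D \<xi> * (cmod (p \<xi> - g \<xi>))\<^sup>2 + R \<xi>" if "\<xi> \<in> half_space" for \<xi>
      using tikhonov_complete_square[of "D \<xi>" "\<eta> * \<zeta> \<xi>" "M \<xi>" "p \<xi>" "a \<xi>"] Dpos[OF that]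
      by (simp add: D_def g_def R_def mult.assoc)
    have i3: "integrable ?W (\<lambda>\<xi>. D \<xi> * (cmod (p \<xi> - g \<xi>))\<^sup>2 + R \<xi>)"
      by (rule Bochner_Integration.integrable_cong[THEN iffD1, OF refl eq]) (use i1 i2 in auto)
    have "integrable ?W (\<lambda>\<xi>. D \<xi> * (cmod (p \<xi> - g \<xi>))\<^sup>2)"
      using Bochner_Integration.integrable_diff[OF i3 R] by simp
    then show i4: "integrable ?W (\<lambda>\<xi>. D \<xi> * (cmod (?U \<phi> \<xi> - g \<xi>))\<^sup>2)"
      by (simp add: p_def)
    have "tikhonov \<alpha> \<zeta> m \<eta> \<sigma> h \<phi> = (\<integral>\<xi>. \<eta> * (\<zeta> \<xi> * (cmod (p \<xi>))\<^sup>2) + (cmod (a \<xi> - M \<xi> * p \<xi>))\<^sup>2 \<partial>?W)"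
      unfolding tikhonov_def n1 n2 using i1 i2 by simp
    also have "\<dots> = (\<integral>\<xi>. D \<xi> * (cmod (p \<xi> - g \<xi>))\<^sup>2 + R \<xi> \<partial>?W)"
      by (rule Bochner_Integration.integral_cong[OF refl]) (simp add: eq)
    also have "\<dots> = (\<integral>\<xi>. D \<xi> * (cmod (?U \<phi> \<xi> - g \<xi>))\<^sup>2 \<partial>?W) + integral\<^sup>L ?W R"
      using i4 R by (simp add: p_def)
    finally show "tikhonov \<alpha> \<zeta> m \<eta> \<sigma> h \<phi> = (\<integral>\<xi>. D \<xi> * (cmod (?U \<phi> \<xi> - g \<xi>))\<^sup>2 \<partial>?W) + integral\<^sup>L ?W R" .
  qed
  have nonneg: "AE \<xi> in ?W. 0 \<le> D \<xi> * (cmod (?U \<phi> \<xi> - g \<xi>))\<^sup>2" for \<phi>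
    using Dpos by (intro AE_I2) (simp add: less_imp_le)
  \<comment> \<open>The inverse transform of g makes the excess over the integral of R vanish;
    \<open>g_bound\<close> places it in the space.\<close>
  define \<phi>0 where "\<phi>0 = weinstein_inv_L2 \<alpha> g"
  have \<phi>0: "\<phi>0 \<in> l2 ?W"
    unfolding \<phi>0_def by (rule weinstein_inv_L2_weak_transform[OF \<alpha> g])
  have U\<phi>0: "AE \<xi> in ?W. ?U \<phi>0 \<xi> = g \<xi>"
    by (rule weak_transform_unique[OF \<alpha> U[OF \<phi>0]]) (unfold \<phi>0_def, rule weinstein_inv_L2_weak_transform[OF \<alpha> g])
  have \<phi>0H: "\<phi>0 \<in> H_space \<alpha> \<zeta>"
  proof -
    have "(\<lambda>\<xi>. complex_of_real (sqrt (\<zeta> \<xi>)) * g \<xi>) \<in> l2 ?W"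
    proof (rule l2_dominated[OF _ ai])
      show "AE \<xi> in ?W. (cmod (complex_of_real (sqrt (\<zeta> \<xi>)) * g \<xi>))\<^sup>2 \<le> 1 / (4 * \<eta>) * (cmod (a \<xi>))\<^sup>2"
        using g_bound by (intro AE_I2) (simp add: \<zeta>sq)
    qed measurable
    then have "(\<lambda>\<xi>. complex_of_real (sqrt (\<zeta> \<xi>)) * ?U \<phi>0 \<xi>) \<in> l2 ?W"
    proof (rule l2_cong_AE)
      show "(\<lambda>\<xi>. complex_of_real (sqrt (\<zeta> \<xi>)) * ?U \<phi>0 \<xi>) \<in> borel_measurable ?W"
        using l2_measurable[OF Ul[OF \<phi>0]] by measurable
      show "AE \<xi> in ?W. complex_of_real (sqrt (\<zeta> \<xi>)) * g \<xi> = complex_of_real (sqrt (\<zeta> \<xi>)) * ?U \<phi>0 \<xi>"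
        using U\<phi>0 by eventually_elim simp
    qed
    then show ?thesis
      using \<phi>0 by (simp add: H_space_def Lp_space_2)
  qed
  have "(\<integral>\<xi>. D \<xi> * (cmod (?U \<phi>0 \<xi> - g \<xi>))\<^sup>2 \<partial>?W) = 0"
    using U\<phi>0 by (intro integral_eq_zero_AE) (auto elim: AE_mp)
  then have tik0: "tikhonov \<alpha> \<zeta> m \<eta> \<sigma> h \<phi>0 = integral\<^sup>L ?W R"
    using tik(2)[OF \<phi>0H] by simp
  \<comment> \<open>The value is attained at \<phi>0, and every competitor exceeds it by a
    nonnegative integral.\<close>
  have inf: "(INF \<psi>\<in>H_space \<alpha> \<zeta>. tikhonov \<alpha> \<zeta> m \<eta> \<sigma> h \<psi>) = integral\<^sup>L ?W R"
  proof (rule cInf_eq_minimum)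
    show "integral\<^sup>L ?W R \<in> tikhonov \<alpha> \<zeta> m \<eta> \<sigma> h ` H_space \<alpha> \<zeta>"
      using \<phi>0H tik0 by (intro image_eqI[of _ _ \<phi>0]) auto
    fix x assume "x \<in> tikhonov \<alpha> \<zeta> m \<eta> \<sigma> h ` H_space \<alpha> \<zeta>"
    then show "integral\<^sup>L ?W R \<le> x"
      using tik(2) integral_nonneg_AE[OF nonneg] by fastforce
  qed
  \<comment> \<open>The extremal function is a chosen minimiser; \<phi>0 witnesses that one exists,
    so the choice does attain the infimum.\<close>
  define \<psi> where "\<psi> = extremal_fun \<alpha> \<zeta> m \<eta> \<sigma> h"
  have "\<psi> \<in> H_space \<alpha> \<zeta> \<and> tikhonov \<alpha> \<zeta> m \<eta> \<sigma> h \<psi> = (INF \<psi>\<in>H_space \<alpha> \<zeta>. tikhonov \<alpha> \<zeta> m \<eta> \<sigma> h \<psi>)"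
    unfolding \<psi>_def extremal_fun_def by (rule someI[of _ \<phi>0]) (simp add: \<phi>0H tik0 inf)
  then have \<psi>: "\<psi> \<in> H_space \<alpha> \<zeta>" "tikhonov \<alpha> \<zeta> m \<eta> \<sigma> h \<psi> = integral\<^sup>L ?W R"
    by (auto simp: inf)
  \<comment> \<open>Minimality forces the excess integral to vanish, and D > 0 on the half-space
    then fixes the transform a.e.; the argument applies to any minimiser.\<close>
  have "AE \<xi> in ?W. D \<xi> * (cmod (?U \<psi> \<xi> - g \<xi>))\<^sup>2 = 0"
    using integral_nonneg_eq_0_iff_AE[OF tik(1)[OF \<psi>(1)] nonneg] tik(2)[OF \<psi>(1)] \<psi>(2) by simp
  with AE_space have U\<psi>: "AE \<xi> in ?W. ?U \<psi> \<xi> = g \<xi>"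
  proof eventually_elim
    case (elim \<xi>)
    then show ?case using Dpos[of \<xi>] by auto
  qed
  have "(H_norm \<alpha> \<zeta> \<psi>)\<^sup>2 \<le> 1 / (4 * \<eta>) * (l2norm ?W h)\<^sup>2"
  proof -
    have ae: "AE \<xi> in ?W. \<zeta> \<xi> * (cmod (?U \<psi> \<xi>))\<^sup>2 \<le> 1 / (4 * \<eta>) * (cmod (a \<xi>))\<^sup>2"
      using U\<psi> AE_space
    proof eventually_elim
      case (elim \<xi>)
      then show ?case using g_bound[of \<xi>] by simp
    qed
    have nn: "AE \<xi> in ?W. 0 \<le> \<zeta> \<xi> * (cmod (?U \<psi> \<xi>))\<^sup>2"
    proof (rule AE_I2)
      fix \<xi> :: "'d pt" assume "\<xi> \<in> space ?W"
      then show "0 \<le> \<zeta> \<xi> * (cmod (?U \<psi> \<xi>))\<^sup>2" using \<zeta>1[of \<xi>] by simp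
    qed
    have \<psi>l: "\<psi> \<in> l2 ?W" using \<psi>(1) by (simp add: H_space_def Lp_space_2)
    have "integrable ?W (\<lambda>\<xi>. \<zeta> \<xi> * (cmod (?U \<psi> \<xi>))\<^sup>2)"
    proof (rule Bochner_Integration.integrable_bound[OF ai])
      show "(\<lambda>\<xi>. \<zeta> \<xi> * (cmod (?U \<psi> \<xi>))\<^sup>2) \<in> borel_measurable ?W"
        using l2_measurable[OF Ul[OF \<psi>l]] by measurable
      show "AE \<xi> in ?W. norm (\<zeta> \<xi> * (cmod (?U \<psi> \<xi>))\<^sup>2) \<le> norm (1 / (4 * \<eta>) * (cmod (a \<xi>))\<^sup>2)"
        using ae nn
      proof eventually_elim
        case (elim \<xi>)
        then show ?case unfolding real_norm_def by linarith
      qed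
    qed
    then have "(\<integral>\<xi>. \<zeta> \<xi> * (cmod (?U \<psi> \<xi>))\<^sup>2 \<partial>?W) \<le> (\<integral>\<xi>. 1 / (4 * \<eta>) * (cmod (a \<xi>))\<^sup>2 \<partial>?W)"
      by (rule integral_mono_AE[OF _ ai ae])
    \<comment> \<open>Plancherel for h replaces the norm of its transform by its own.\<close>
    also have "\<dots> = 1 / (4 * \<eta>) * (l2norm ?W h)\<^sup>2"
      unfolding weinstein_L2_norm[OF \<alpha> h, symmetric] l2norm_square a_def by simp
    finally show ?thesis
      using integral_nonneg_AE[OF nn] by (simp add: H_norm_def)
  qed
  with U\<psi> show ?thesis
    by (simp add: \<psi>_def g_def D_def M_def a_def Lp_norm_2)
qed

end
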